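(* Let $d\ge 1$ and $p=1-q\in(0,1)$. Let $\nu$ be a probability measure on $\Omega=\{0,1\}^{\mathbb Z^d}$ such that, for some $m>0$, for all integers $\ell\ge 1$ and all $x\in\mathbb Z^d$, $$\nu\Bigl(\bigl\{\eta:\ \eta(y)=1\ \ \forall\, y\in \textstyle\prod_{i=1}^d[x_i,x_i+\ell-1]\cap\mathbb Z^d\bigr\}\Bigr)\le e^{-m\ell}.$$ Then there exist $\lambda=\lambda(m)>0$ and $C>0$ such that, for all $t>0$, $$\sup_{x\in\mathbb Z^d}\bigl|\mathbb E_\nu\bigl(\eta_t(x)\bigr)-p\bigr|\le C e^{-\lambda\, t^{1/(2d)}},$$ where $(\eta_s)_{s\ge0}$ is the East-like process on $\mathbb Z^d$ with parameter $q$ and initial law $\nu$.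
   Context: Let $\mathcal B=\{e_1,\dots,e_d\}$ be the canonical basis of $\mathbb Z^d$ and $\Omega=\{0,1\}^{\mathbb Z^d}$. The East-like process on $\mathbb Z^d$ with parameter $q\in(0,1)$, $p=1-q$, is the continuous time Markov process on $\Omega$ whose generator acts on functions depending on finitely many spins as $$\mathcal L f(\eta)=\sum_{x\in\mathbb Z^d}c_x(\eta)\bigl[\eta(x) q+(1-\eta(x))p\bigr]\bigl[f(\eta^x)-f(\eta)\bigr],$$ where $\eta^x$ is $\eta$ with the spin at $x$ flipped and $c_x(\eta)=1$ if there exists $e\in\mathcal B$ with $\eta(x-e)=0$, and $c_x(\eta)=0$ otherwise. Equivalently, each site $x$ has an independent rate-one Poisson clock; when the clock at $x$ rings and the constraint $c_x=1$ is satisfied, the spin at $x$ is replaced by an independent Bernoulli($p$) variable (value $1$ with probability $p$); otherwise nothing happens. $\mathbb E_\nu$ denotes expectation for the process whose initial configuration has law $\nu$. *)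

theory Defs
  imports "HOL-Probability.Probability"
begin

text \<open>The lattice \<open>\<int>\<^sup>d\<close> is \<open>int ^ 'd\<close> with \<open>d = CARD('d)\<close>. Spin 1 is \<open>True\<close> and spin 0 is \<open>False\<close>; the type
  \<open>bool\<close> carries the discrete topology, so \<open>'d config\<close> carries the (compact) product topology and
  \<open>'d config \<Rightarrow>\<^sub>C real\<close> is the Banach space of all continuous functions with the supremum norm.
  The \<open>\<sigma>\<close>-algebra on configurations is \<open>borel\<close>, which is the product one as \<open>\<int>\<^sup>d\<close> is countable.\<close>

type_synonym 'd config = "(int ^ 'd) \<Rightarrow> bool"

definition flip :: "int ^ 'd::finite \<Rightarrow> 'd config \<Rightarrow> 'd config" where
  "flip x \<eta> = \<eta>(x := \<not> \<eta> x)"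

definition constraint :: "int ^ 'd::finite \<Rightarrow> 'd config \<Rightarrow> real" where
  "constraint x \<eta> = (if \<exists>i. \<not> \<eta> (x - axis i 1) then 1 else 0)"

definition depends_on_finitely_many :: "('d config \<Rightarrow> 'b) \<Rightarrow> bool" where
  "depends_on_finitely_many f \<longleftrightarrow>
     (\<exists>A. finite A \<and> (\<forall>\<eta> \<eta>'. (\<forall>x\<in>A. \<eta> x = \<eta>' x) \<longrightarrow> f \<eta> = f \<eta>'))"

text \<open>Meaningful only if \<open>f\<close> depends on finitely many spins; then all but finitely many summands vanish.\<close>

definition east_generator :: "real \<Rightarrow> ('d::finite config \<Rightarrow> real) \<Rightarrow> 'd config \<Rightarrow> real" where
  "east_generator q f \<eta> =
     (\<Sum>\<^sub>\<infinity>x. constraint x \<eta> * (of_bool (\<eta> x) * q + (1 - of_bool (\<eta> x)) * (1 - q))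
              * (f (flip x \<eta>) - f \<eta>))"

definition markov_semigroup ::
  "(real \<Rightarrow> ('a::topological_space \<Rightarrow>\<^sub>C real) \<Rightarrow> ('a \<Rightarrow>\<^sub>C real)) \<Rightarrow> bool" where
  "markov_semigroup P \<longleftrightarrow>
     (\<forall>t\<ge>0. linear (P t)) \<and>
     (\<forall>f. P 0 f = f) \<and>
     (\<forall>s\<ge>0. \<forall>t\<ge>0. \<forall>f. P (s + t) f = P s (P t f)) \<and>
     (\<forall>t\<ge>0. P t (const_bcontfun 1) = const_bcontfun 1) \<and>
     (\<forall>t\<ge>0. \<forall>f. (\<forall>\<eta>. 0 \<le> apply_bcontfun f \<eta>) \<longrightarrow> (\<forall>\<eta>. 0 \<le> apply_bcontfun (P t f) \<eta>)) \<and>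
     (\<forall>f. ((\<lambda>t. P t f) \<longlongrightarrow> f) (at_right 0))"

text \<open>The graph of the infinitesimal generator: \<open>f\<close> is in its domain and is mapped to \<open>g\<close>
  (the limit is in supremum norm).\<close>

definition has_generator_value ::
  "(real \<Rightarrow> ('a::topological_space \<Rightarrow>\<^sub>C real) \<Rightarrow> ('a \<Rightarrow>\<^sub>C real)) \<Rightarrow> ('a \<Rightarrow>\<^sub>C real) \<Rightarrow> ('a \<Rightarrow>\<^sub>C real) \<Rightarrow> bool" where
  "has_generator_value P f g \<longleftrightarrow> ((\<lambda>t. (P t f - f) /\<^sub>R t) \<longlongrightarrow> g) (at_right 0)"

text \<open>The flip rates are bounded and of bounded range, so the functions of finitely many spins form a
  core: the \<open>P t\<close> with \<open>t \<ge> 0\<close> are determined by \<open>q\<close>.\<close>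

definition east_semigroup ::
  "real \<Rightarrow> (real \<Rightarrow> ('d::finite config \<Rightarrow>\<^sub>C real) \<Rightarrow> ('d config \<Rightarrow>\<^sub>C real)) \<Rightarrow> bool" where
  "east_semigroup q P \<longleftrightarrow> markov_semigroup P \<and>
     (\<forall>f. depends_on_finitely_many (apply_bcontfun f) \<longrightarrow>
        (\<exists>g. apply_bcontfun g = east_generator q (apply_bcontfun f) \<and> has_generator_value P f g))"

definition past :: "'w measure \<Rightarrow> (real \<Rightarrow> 'w \<Rightarrow> 'a::topological_space) \<Rightarrow> real \<Rightarrow> 'w measure" where
  "past M X s =
     sigma (space M) (\<Union>u\<in>{0..s}. {X u -` B \<inter> space M | B. B \<in> sets borel})"

definition markov_process ::
  "(real \<Rightarrow> ('a::topological_space \<Rightarrow>\<^sub>C real) \<Rightarrow> ('a \<Rightarrow>\<^sub>C real)) \<Rightarrow> 'a measure \<Rightarrow>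
   'w measure \<Rightarrow> (real \<Rightarrow> 'w \<Rightarrow> 'a) \<Rightarrow> bool" where
  "markov_process P \<nu> M X \<longleftrightarrow>
     prob_space M \<and>
     (\<forall>t\<ge>0. X t \<in> measurable M borel) \<and>
     distr M borel (X 0) = \<nu> \<and>
     (\<forall>s\<ge>0. \<forall>t\<ge>0. \<forall>f. AE w in M.
        real_cond_exp M (past M X s) (\<lambda>w. apply_bcontfun f (X (s + t) w)) w
          = apply_bcontfun (P t f) (X s w))"

text \<open>Times are restricted to \<open>t \<ge> 0\<close>; \<open>X t\<close> for negative \<open>t\<close> is arbitrary. No path regularity is
  required: the finite-dimensional distributions are determined by \<open>q\<close> and \<open>\<nu>\<close>.\<close>

definition east_like_process ::
  "real \<Rightarrow> 'd::finite config measure \<Rightarrow> 'w measure \<Rightarrow> (real \<Rightarrow> 'w \<Rightarrow> 'd config) \<Rightarrow> bool" where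
  "east_like_process q \<nu> M X \<longleftrightarrow> (\<exists>P. east_semigroup q P \<and> markov_process P \<nu> M X)"

definition lattice_box :: "int ^ 'd::finite \<Rightarrow> nat \<Rightarrow> (int ^ 'd) set" where
  "lattice_box x l = {y. \<forall>i. x $ i \<le> y $ i \<and> y $ i \<le> x $ i + int l - 1}"

definition exp_decaying_filled_boxes :: "real \<Rightarrow> 'd::finite config measure \<Rightarrow> bool" where
  "exp_decaying_filled_boxes m \<nu> \<longleftrightarrow>
     (\<forall>l\<ge>1. \<forall>x. measure \<nu> {\<eta>. \<forall>y\<in>lattice_box x l. \<eta> y} \<le> exp (- m * real l))"

end

theory Submission
  imports Defs
begin

text \<open>Write \<open>g\<close> for the centred spin at \<open>x\<close>. Suppose that the initial configuration has a hole at some \<open>y\<close>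
  at distance at most \<open>L\<close> below \<open>x\<close>, and let \<open>B\<close> be the box of side \<open>2L + 1\<close> with upper corner \<open>x\<close>.
  Kill the dynamics at rate one when \<open>B - {x}\<close> contains no hole. This changes \<open>P\<^sub>t g\<close> by at most
  \<open>t p\<^sup>L\<close>: orientation implies that filling the cone of depth \<open>L\<close> below a hole has probability at
  most \<open>p\<^sup>L\<close> at any time. The killed evolution of \<open>g\<close> decays in \<open>L\<^sup>2\<close> of the spins in \<open>B\<close>,
  uniformly in the spins outside, at a rate of order \<open>1/|B|\<close>: each hole of \<open>B\<close> is joined to \<open>x\<close> by
  an oriented path, along which the one-dimensional East process with a frozen hole at its origin
  has a spectral gap bounded below independently of the length. Passing from \<open>L\<^sup>2\<close> to a fixed
  initial configuration costs a factor exponential in \<open>|B|\<close>, which is affordable if \<open>|B|\<close> is a small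
  multiple of the square root of \<open>t\<close>. No hole is present near \<open>x\<close> with probability at most
  \<open>exp (- m L)\<close>. All estimates are made for Euler steps of a finite-volume dynamics, which approximate
  the semigroup by finite speed of propagation.\<close>

text \<open>The exponent is a balance. A box of side of order \<open>L\<close> gives decay over time
  \<open>t\<close> with exponent of order \<open>t / L^d\<close>, while the pointwise estimate loses
  an exponential of order \<open>L^d\<close>; this forces \<open>L\<close> of order
  \<open>t^(1/(2d))\<close>, and the remaining errors are exponentially small in \<open>L\<close>.
  The pointwise estimate is unavoidable, since the initial law need not be comparable with the
  Bernoulli measure. The obstacle to mean-square decay is degeneracy: where \<open>B - {x}\<close>
  is filled, the Dirichlet form of the box may control nothing. Killing there supplies exactly the
  missing term. Putting \<open>x\<close> at the upper corner makes orientation do the centring: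
  neither the killing rate nor any constraint at a site below or at \<open>x\<close> reads the spin
  at \<open>x\<close>, so the evolved function keeps mean zero in that spin. Euler steps with small
  step size are monotone with total weight at most one, so that positivity, Jensen and Duhamel
  arguments become finite sums; the abstract semigroup enters through its generator on functions of
  finitely many spins.\<close>

section \<open>Bernoulli averages over finitely many spins\<close>

definition indep_of :: "'a \<Rightarrow> (('a \<Rightarrow> bool) \<Rightarrow> real) \<Rightarrow> bool" where
  "indep_of z f \<longleftrightarrow> (\<forall>\<eta> v. f (\<eta>(z := v)) = f \<eta>)"

lemma indep_of_const [simp]: "indep_of z (\<lambda>_. c)"
  by (simp add: indep_of_def)

lemma indep_of_add: "indep_of z f \<Longrightarrow> indep_of z g \<Longrightarrow> indep_of z (\<lambda>\<eta>. f \<eta> + g \<eta>)"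
  and indep_of_diff: "indep_of z f \<Longrightarrow> indep_of z g \<Longrightarrow> indep_of z (\<lambda>\<eta>. f \<eta> - g \<eta>)"
  and indep_of_mult: "indep_of z f \<Longrightarrow> indep_of z g \<Longrightarrow> indep_of z (\<lambda>\<eta>. f \<eta> * g \<eta>)"
  and indep_of_power: "indep_of z f \<Longrightarrow> indep_of z (\<lambda>\<eta>. f \<eta> ^ k)"
  and indep_of_sum: "(\<And>i. i \<in> I \<Longrightarrow> indep_of z (h i)) \<Longrightarrow> indep_of z (\<lambda>\<eta>. \<Sum>i\<in>I. h i \<eta>)"
  by (simp_all add: indep_of_def)

lemmas indep_of_intros = indep_of_const indep_of_add indep_of_diff indep_of_mult indep_of_power
  indep_of_sum

lemma indep_of_spin: "z \<noteq> y \<Longrightarrow> indep_of z (\<lambda>\<eta>. of_bool (\<eta> y))"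
  and indep_of_hole: "z \<noteq> y \<Longrightarrow> indep_of z (\<lambda>\<eta>. of_bool (\<not> \<eta> y))"
  and indep_of_filled: "z \<notin> W \<Longrightarrow> indep_of z (\<lambda>\<eta>. of_bool (\<forall>w\<in>W. \<eta> w))"
  by (auto simp: indep_of_def intro!: arg_cong[where f = of_bool])

locale bernoulli_spins =
  fixes p :: real
  assumes p_pos: "0 < p" and p_less_1: "p < 1"
begin

definition resample :: "'a \<Rightarrow> (('a \<Rightarrow> bool) \<Rightarrow> real) \<Rightarrow> ('a \<Rightarrow> bool) \<Rightarrow> real" where
  "resample z f = (\<lambda>\<eta>. p * f (\<eta>(z := True)) + (1 - p) * f (\<eta>(z := False)))"

definition fluct :: "'a \<Rightarrow> (('a \<Rightarrow> bool) \<Rightarrow> real) \<Rightarrow> ('a \<Rightarrow> bool) \<Rightarrow> real" where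
  "fluct z f = (\<lambda>\<eta>. f \<eta> - resample z f \<eta>)"

text \<open>Product Bernoulli integral over the spins in \<open>A\<close>, with the spins outside
  \<open>A\<close> left as parameters. Building it from one-site averages, which commute and are
  idempotent, keeps the theory algebraic.\<close>

definition avg :: "'a set \<Rightarrow> (('a \<Rightarrow> bool) \<Rightarrow> real) \<Rightarrow> ('a \<Rightarrow> bool) \<Rightarrow> real" where
  "avg A f = Finite_Set.fold resample f A"

lemma resample_indep: "indep_of z f \<Longrightarrow> resample z f = f"
  by (auto simp: resample_def indep_of_def algebra_simps)

lemma indep_of_resample_self [simp]: "indep_of z (resample z f)"
  by (simp add: resample_def indep_of_def)

lemma indep_of_resample: "indep_of w f \<Longrightarrow> indep_of w (resample z f)"
  by (cases "w = z") (auto simp: resample_def indep_of_def fun_upd_twist[of w z])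

lemma resample_commute: "resample z (resample w f) = resample w (resample z f)"
  by (cases "w = z") (auto simp: resample_def fun_upd_twist[of w z] algebra_simps)

lemma resample_idem [simp]: "resample z (resample z f) = resample z f"
  by (rule resample_indep) simp

lemma resample_const [simp]: "resample z (\<lambda>_. c) = (\<lambda>_. c)"
  by (rule resample_indep) simp

lemma resample_add: "resample z (\<lambda>\<eta>. f \<eta> + g \<eta>) = (\<lambda>\<eta>. resample z f \<eta> + resample z g \<eta>)"
  and resample_diff: "resample z (\<lambda>\<eta>. f \<eta> - g \<eta>) = (\<lambda>\<eta>. resample z f \<eta> - resample z g \<eta>)"
  and resample_scale: "resample z (\<lambda>\<eta>. c * f \<eta>) = (\<lambda>\<eta>. c * resample z f \<eta>)"
  by (auto simp: resample_def algebra_simps)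

lemma resample_mult_left:
  "indep_of z g \<Longrightarrow> resample z (\<lambda>\<eta>. g \<eta> * f \<eta>) = (\<lambda>\<eta>. g \<eta> * resample z f \<eta>)"
  by (auto simp: resample_def indep_of_def algebra_simps)

lemma resample_sum: "resample z (\<lambda>\<eta>. \<Sum>i\<in>I. h i \<eta>) = (\<lambda>\<eta>. \<Sum>i\<in>I. resample z (h i) \<eta>)"
  by (auto simp: resample_def sum.distrib sum_distrib_left)

lemma resample_mono: "(\<And>\<eta>. f \<eta> \<le> g \<eta>) \<Longrightarrow> resample z f \<eta> \<le> resample z g \<eta>"
  using p_pos p_less_1 by (auto simp: resample_def intro!: add_mono mult_left_mono)

lemma resample_le_const: "(\<And>\<eta>. f \<eta> \<le> c) \<Longrightarrow> resample z f \<eta> \<le> c"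
  using resample_mono[of f "\<lambda>_. c" z \<eta>] by simp

lemma resample_nonneg: "(\<And>\<eta>. 0 \<le> f \<eta>) \<Longrightarrow> 0 \<le> resample z f \<eta>"
  using resample_mono[of "\<lambda>_. 0" f z \<eta>] by simp

lemma resample_fluct_commute: "resample z (fluct w f) = fluct w (resample z f)"
  by (auto simp: fluct_def resample_diff resample_commute[of w z])

lemma fluct_commute: "fluct z (fluct w f) = fluct w (fluct z f)"
  by (auto simp: fluct_def resample_diff resample_commute[of w z])

text \<open>Second moment equals squared mean plus variance, for the spin at \<open>z\<close> alone;
  the weight \<open>g\<close> is a constant for that spin.\<close>

lemma resample_pythagoras:
  assumes "indep_of z g"
  shows "resample z (\<lambda>\<eta>. g \<eta> * (f \<eta>)\<^sup>2) \<eta> =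
    g \<eta> * (resample z f \<eta>)\<^sup>2 + resample z (\<lambda>\<eta>. g \<eta> * (fluct z f \<eta>)\<^sup>2) \<eta>"
  using assms by (simp add: resample_def fluct_def indep_of_def power2_eq_square algebra_simps)

lemma resample_pythagoras_1:
  "resample z (\<lambda>\<eta>. (f \<eta>)\<^sup>2) \<eta> = (resample z f \<eta>)\<^sup>2 + resample z (\<lambda>\<eta>. (fluct z f \<eta>)\<^sup>2) \<eta>"
  using resample_pythagoras[of z "\<lambda>_. 1" f \<eta>] by simp

lemma comp_fun_idem_resample: "comp_fun_idem resample"
  by standard (auto simp: fun_eq_iff o_def resample_commute)

lemma avg_empty [simp]: "avg {} f = f"
  by (simp add: avg_def)

lemma avg_insert: "finite A \<Longrightarrow> avg (insert z A) f = resample z (avg A f)"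
  unfolding avg_def by (rule comp_fun_idem_on.fold_insert_idem[OF comp_fun_idem_resample[unfolded comp_fun_idem_def']]) auto

lemma avg_union: "finite A \<Longrightarrow> finite B \<Longrightarrow> avg (A \<union> B) f = avg A (avg B f)"
  by (induction A rule: finite_induct) (simp_all add: avg_insert)

lemma avg_resample: "finite A \<Longrightarrow> z \<in> A \<Longrightarrow> avg A (resample z f) = avg A f"
  using avg_union[of A "{z}" f] by (simp add: avg_insert insert_absorb)

lemma avg_resample_commute: "finite A \<Longrightarrow> avg A (resample z f) = resample z (avg A f)"
  by (induction A rule: finite_induct) (simp_all add: avg_insert resample_commute)

lemma avg_const [simp]: "finite A \<Longrightarrow> avg A (\<lambda>_. c) = (\<lambda>_. c)"
  by (induction A rule: finite_induct) (simp_all add: avg_insert)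

lemma avg_add: "finite A \<Longrightarrow> avg A (\<lambda>\<eta>. f \<eta> + g \<eta>) = (\<lambda>\<eta>. avg A f \<eta> + avg A g \<eta>)"
  and avg_diff: "finite A \<Longrightarrow> avg A (\<lambda>\<eta>. f \<eta> - g \<eta>) = (\<lambda>\<eta>. avg A f \<eta> - avg A g \<eta>)"
  and avg_scale: "finite A \<Longrightarrow> avg A (\<lambda>\<eta>. c * f \<eta>) = (\<lambda>\<eta>. c * avg A f \<eta>)"
  and avg_sum: "finite A \<Longrightarrow> avg A (\<lambda>\<eta>. \<Sum>i\<in>I. h i \<eta>) = (\<lambda>\<eta>. \<Sum>i\<in>I. avg A (h i) \<eta>)"
  by (induction A rule: finite_induct)
    (simp_all add: avg_insert resample_add resample_diff resample_scale resample_sum)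

lemma avg_mult_left:
  "finite A \<Longrightarrow> (\<And>z. z \<in> A \<Longrightarrow> indep_of z g) \<Longrightarrow> avg A (\<lambda>\<eta>. g \<eta> * f \<eta>) = (\<lambda>\<eta>. g \<eta> * avg A f \<eta>)"
  by (induction A rule: finite_induct) (simp_all add: avg_insert resample_mult_left)

lemma avg_mono: "finite A \<Longrightarrow> (\<And>\<eta>. f \<eta> \<le> g \<eta>) \<Longrightarrow> avg A f \<eta> \<le> avg A g \<eta>"
  by (induction A arbitrary: \<eta> rule: finite_induct) (simp_all add: avg_insert resample_mono)

lemma avg_nonneg: "finite A \<Longrightarrow> (\<And>\<eta>. 0 \<le> f \<eta>) \<Longrightarrow> 0 \<le> avg A f \<eta>"
  using avg_mono[of A "\<lambda>_. 0" f \<eta>] by simp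

text \<open>Resampling a site of \<open>A\<close> inside the average changes nothing, so the
  one-site variance identity can be inserted. The weight will be a constraint or the indicator of a
  hole.\<close>

lemma avg_pythagoras:
  assumes "finite A" "z \<in> A" "indep_of z g"
  shows "avg A (\<lambda>\<eta>. g \<eta> * (f \<eta>)\<^sup>2) \<eta> =
    avg A (\<lambda>\<eta>. g \<eta> * (resample z f \<eta>)\<^sup>2) \<eta> + avg A (\<lambda>\<eta>. g \<eta> * (fluct z f \<eta>)\<^sup>2) \<eta>"
proof -
  have "avg A (\<lambda>\<eta>. g \<eta> * (f \<eta>)\<^sup>2) = avg A (resample z (\<lambda>\<eta>. g \<eta> * (f \<eta>)\<^sup>2))"
    using assms by (simp add: avg_resample)
  also have "resample z (\<lambda>\<eta>. g \<eta> * (f \<eta>)\<^sup>2) =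
      (\<lambda>\<eta>. g \<eta> * (resample z f \<eta>)\<^sup>2 + resample z (\<lambda>\<eta>. g \<eta> * (fluct z f \<eta>)\<^sup>2) \<eta>)"
    using assms by (intro ext resample_pythagoras)
  also have "avg A \<dots> = (\<lambda>\<eta>. avg A (\<lambda>\<eta>. g \<eta> * (resample z f \<eta>)\<^sup>2) \<eta> +
      avg A (\<lambda>\<eta>. g \<eta> * (fluct z f \<eta>)\<^sup>2) \<eta>)"
    using assms by (simp add: avg_add avg_resample)
  finally show ?thesis by simp
qed

lemma avg_resample_contraction:
  assumes "finite A" "z \<in> A" "indep_of z g" "\<And>\<eta>. 0 \<le> g \<eta>"
  shows "avg A (\<lambda>\<eta>. g \<eta> * (resample z f \<eta>)\<^sup>2) \<eta> \<le> avg A (\<lambda>\<eta>. g \<eta> * (f \<eta>)\<^sup>2) \<eta>"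
  using avg_pythagoras[OF assms(1-3), of f \<eta>]
    avg_nonneg[of A "\<lambda>\<eta>. g \<eta> * (fluct z f \<eta>)\<^sup>2" \<eta>] assms by simp

lemma avg_fluct_contraction:
  assumes "finite A" "z \<in> A" "indep_of z g" "\<And>\<eta>. 0 \<le> g \<eta>"
  shows "avg A (\<lambda>\<eta>. g \<eta> * (fluct z f \<eta>)\<^sup>2) \<eta> \<le> avg A (\<lambda>\<eta>. g \<eta> * (f \<eta>)\<^sup>2) \<eta>"
  using avg_pythagoras[OF assms(1-3), of f \<eta>]
    avg_nonneg[of A "\<lambda>\<eta>. g \<eta> * (resample z f \<eta>)\<^sup>2" \<eta>] assms by simp

lemma avg_Cauchy_Schwarz:
  assumes "finite A"
  shows "(avg A (\<lambda>\<eta>. f \<eta> * g \<eta>) \<eta>)\<^sup>2 \<le> avg A (\<lambda>\<eta>. (f \<eta>)\<^sup>2) \<eta> * avg A (\<lambda>\<eta>. (g \<eta>)\<^sup>2) \<eta>"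
proof -
  define a where "a = avg A (\<lambda>\<eta>. (f \<eta>)\<^sup>2) \<eta>"
  define b where "b = avg A (\<lambda>\<eta>. (g \<eta>)\<^sup>2) \<eta>"
  define c where "c = avg A (\<lambda>\<eta>. f \<eta> * g \<eta>) \<eta>"
  have quad: "0 \<le> a * u\<^sup>2 + 2 * u * v * c + b * v\<^sup>2" for u v
  proof -
    have "0 \<le> avg A (\<lambda>\<eta>. (u * f \<eta> + v * g \<eta>)\<^sup>2) \<eta>"
      using assms by (intro avg_nonneg) auto
    also have "(\<lambda>\<eta>. (u * f \<eta> + v * g \<eta>)\<^sup>2) =
        (\<lambda>\<eta>. u\<^sup>2 * (f \<eta>)\<^sup>2 + ((2 * u * v) * (f \<eta> * g \<eta>) + v\<^sup>2 * (g \<eta>)\<^sup>2))"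
      by (simp add: power2_eq_square algebra_simps)
    finally show ?thesis
      using assms by (simp only: avg_add avg_scale a_def b_def c_def) (simp add: mult_ac)
  qed
  have nn: "0 \<le> a" "0 \<le> b"
    unfolding a_def b_def using assms by (auto intro!: avg_nonneg)
  have "c\<^sup>2 \<le> a * b"
  proof (cases "b = 0")
    case True
    \<comment> \<open>With \<open>b = 0\<close> and \<open>c\<close> nonzero, this choice of
      \<open>v\<close> makes the quadratic form equal to -1.\<close>
    have "0 \<le> a * 1\<^sup>2 + 2 * 1 * (- (a + 1) / (2 * c)) * c" if "c \<noteq> 0"
      using quad[of 1 "- (a + 1) / (2 * c)"] True by simp
    with True show ?thesis by (cases "c = 0") (auto simp: field_simps)
  next
    case False
    with nn have "0 < b" by simp
    have "0 \<le> b * (a * b - c\<^sup>2)"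
      using quad[of b "- c"] by (simp add: power2_eq_square algebra_simps)
    with \<open>0 < b\<close> show ?thesis by (simp add: zero_le_mult_iff)
  qed
  then show ?thesis by (simp add: a_def b_def c_def)
qed

lemma avg_power2_le:
  "finite A \<Longrightarrow> (avg A f \<eta>)\<^sup>2 \<le> avg A (\<lambda>\<eta>. (f \<eta>)\<^sup>2) \<eta>"
  using avg_Cauchy_Schwarz[of A "\<lambda>_. 1" f \<eta>] by simp

lemma avg_filled: "finite W \<Longrightarrow> avg W (\<lambda>\<eta>. of_bool (\<forall>w\<in>W. \<eta> w)) = (\<lambda>_. p ^ card W)"
proof (induction W rule: finite_induct)
  case (insert z W)
  have "avg (insert z W) (\<lambda>\<eta>. of_bool (\<forall>w\<in>insert z W. \<eta> w)) =
      resample z (avg W (\<lambda>\<eta>. of_bool (\<eta> z) * of_bool (\<forall>w\<in>W. \<eta> w)))"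
    using insert by (simp add: avg_insert of_bool_conj)
  also have "avg W (\<lambda>\<eta>. of_bool (\<eta> z) * of_bool (\<forall>w\<in>W. \<eta> w)) =
      (\<lambda>\<eta>. of_bool (\<eta> z) * p ^ card W)"
    using insert by (subst avg_mult_left) (auto intro!: indep_of_spin)
  finally show ?case using insert by (simp add: resample_def)
qed auto

text \<open>The configuration \<open>\<eta>\<close> itself has Bernoulli probability at least this
  power on \<open>A\<close>. This is the passage from mean-square to pointwise bounds, with its loss
  exponential in the volume.\<close>

lemma avg_lower_bound:
  assumes "finite A" "\<And>\<eta>. 0 \<le> f \<eta>"
  shows "(min p (1 - p)) ^ card A * f \<eta> \<le> avg A f \<eta>"
  using assms(1)
proof (induction A arbitrary: \<eta> rule: finite_induct)
  case (insert z A)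
  define c where "c = min p (1 - p)"
  have c: "0 < c" using p_pos p_less_1 by (simp add: c_def)
  have "c * avg A f \<eta> \<le> resample z (avg A f) \<eta>"
  proof (cases "\<eta> z")
    case True
    then have "\<eta>(z := True) = \<eta>" by (simp add: fun_upd_idem)
    moreover have "c * avg A f \<eta> \<le> p * avg A f \<eta>"
      using insert assms by (intro mult_right_mono avg_nonneg) (auto simp: c_def)
    ultimately show ?thesis using insert assms p_less_1
      by (simp add: resample_def add_increasing2 avg_nonneg)
  next
    case False
    then have "\<eta>(z := False) = \<eta>" by (simp add: fun_upd_idem)
    moreover have "c * avg A f \<eta> \<le> (1 - p) * avg A f \<eta>"
      using insert assms by (intro mult_right_mono avg_nonneg) (auto simp: c_def)
    ultimately show ?thesis using insert assms p_pos
      by (simp add: resample_def add_increasing avg_nonneg)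
  qed
  moreover have "c * (c ^ card A * f \<eta>) \<le> c * avg A f \<eta>"
    using insert c by (intro mult_left_mono) (auto simp: c_def)
  ultimately show ?case using insert by (simp add: avg_insert c_def)
qed auto

end

section \<open>Spectral gap of the East chain along a path\<close>

locale bernoulli_path = bernoulli_spins +
  fixes z :: "nat \<Rightarrow> 'a" and n :: nat and A :: "'a set" and f :: "('a \<Rightarrow> bool) \<Rightarrow> real"
    and \<zeta> :: "'a \<Rightarrow> bool"
  assumes finite_A: "finite A" and z_in_A: "\<And>i. 0 < i \<Longrightarrow> i \<le> n \<Longrightarrow> z i \<in> A"
    and inj_z: "inj_on z {0..n}"
begin

definition hole :: "nat \<Rightarrow> ('a \<Rightarrow> bool) \<Rightarrow> real" where
  "hole i = (\<lambda>\<eta>. of_bool (\<not> \<eta> (z i)))"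

text \<open>Averaging out \<open>z 1\<close>, \<open>z 2\<close>, ... successively gives a reversed
  martingale, whose weighted squared differences are the values of \<open>increment\<close>. The
  site \<open>z 0\<close> is never averaged out: its hole is frozen.\<close>

primrec front :: "nat \<Rightarrow> ('a \<Rightarrow> bool) \<Rightarrow> real" where
  "front 0 = f"
| "front (Suc j) = resample (z (Suc j)) (front j)"

definition increment :: "nat \<Rightarrow> real" where
  "increment j = avg A (\<lambda>\<eta>. hole 0 \<eta> * (fluct (z (Suc j)) (front j) \<eta>)\<^sup>2) \<zeta>"

text \<open>Only the diagonal terms \<open>hole_energy k k\<close>, where the hole is adjacent to
  the refreshed site, belong to the Dirichlet form of the East chain. The others have to be reduced
  to them.\<close>

definition hole_energy :: "nat \<Rightarrow> nat \<Rightarrow> real" where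
  "hole_energy i j = avg A (\<lambda>\<eta>. hole i \<eta> * (fluct (z (Suc j)) f \<eta>)\<^sup>2) \<zeta>"

lemma hole_nonneg [simp]: "0 \<le> hole i \<eta>" and hole_le_1: "hole i \<eta> \<le> 1"
  by (auto simp: hole_def)

lemma z_eq_iff: "i \<le> n \<Longrightarrow> j \<le> n \<Longrightarrow> z i = z j \<longleftrightarrow> i = j"
  using inj_z by (auto simp: inj_on_def)

lemma indep_of_hole_z: "i \<le> n \<Longrightarrow> j \<le> n \<Longrightarrow> i \<noteq> j \<Longrightarrow> indep_of (z j) (hole i)"
  unfolding hole_def by (rule indep_of_hole) (simp add: z_eq_iff)

lemma increment_nonneg: "0 \<le> increment j" and hole_energy_nonneg: "0 \<le> hole_energy i j"
  unfolding increment_def hole_energy_def using finite_A by (auto intro!: avg_nonneg)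

text \<open>Orthogonality of martingale differences; the weight \<open>hole 0\<close> survives
  because none of the averaged sites is \<open>z 0\<close>.\<close>

lemma sum_increments:
  assumes "m \<le> n"
  shows "avg A (\<lambda>\<eta>. hole 0 \<eta> * (f \<eta>)\<^sup>2) \<zeta> =
    avg A (\<lambda>\<eta>. hole 0 \<eta> * (front m \<eta>)\<^sup>2) \<zeta> + (\<Sum>j<m. increment j)"
  using assms
proof (induction m)
  case (Suc m)
  have "avg A (\<lambda>\<eta>. hole 0 \<eta> * (front m \<eta>)\<^sup>2) \<zeta> =
      avg A (\<lambda>\<eta>. hole 0 \<eta> * (front (Suc m) \<eta>)\<^sup>2) \<zeta> + increment m"
    unfolding increment_def front.simps
    using Suc.prems by (intro avg_pythagoras finite_A z_in_A indep_of_hole_z) auto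
  with Suc show ?case by simp
qed simp

text \<open>Resampling an earlier site commutes with the fluctuation at \<open>z (Suc j)\<close> and
  contracts in mean square as long as the weight does not read that site.\<close>

lemma front_fluct_contraction:
  assumes "a \<le> n" "j < n" "a \<le> j" "\<And>\<eta>. 0 \<le> g \<eta>" "\<And>i. 0 < i \<Longrightarrow> i \<le> a \<Longrightarrow> indep_of (z i) g"
  shows "avg A (\<lambda>\<eta>. g \<eta> * (fluct (z (Suc j)) (front a) \<eta>)\<^sup>2) \<zeta> \<le>
    avg A (\<lambda>\<eta>. g \<eta> * (fluct (z (Suc j)) f \<eta>)\<^sup>2) \<zeta>"
  using assms
proof (induction a)
  case (Suc a)
  have "avg A (\<lambda>\<eta>. g \<eta> * (fluct (z (Suc j)) (front (Suc a)) \<eta>)\<^sup>2) \<zeta> =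
      avg A (\<lambda>\<eta>. g \<eta> * (resample (z (Suc a)) (fluct (z (Suc j)) (front a)) \<eta>)\<^sup>2) \<zeta>"
    by (simp add: resample_fluct_commute)
  also have "\<dots> \<le> avg A (\<lambda>\<eta>. g \<eta> * (fluct (z (Suc j)) (front a) \<eta>)\<^sup>2) \<zeta>"
    using Suc.prems by (intro avg_resample_contraction finite_A z_in_A) auto
  finally show ?case using Suc by fastforce
qed simp

lemma front_window:
  "a \<le> j \<Longrightarrow> front j = avg (z ` {a<..j}) (front a)"
proof (induction j)
  case (Suc j)
  show ?case
  proof (cases "a = Suc j")
    case False
    with Suc have "{a<..Suc j} = insert (Suc j) {a<..j}" by auto
    with Suc False show ?thesis by (simp add: avg_insert)
  qed simp
qed simp

text \<open>One step of transporting a hole along the path: the spin at \<open>i + 1\<close> is resampled to produce a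
  hole there, at the price of a factor \<open>1/(1-p)\<close>.\<close>

lemma hole_energy_step:
  assumes "i < j" "j < n"
  shows "hole_energy i j \<le> (1 + 2 / (1 - p)) * (hole_energy (Suc i) j + hole_energy i i)"
proof -
  define g where "g = fluct (z (Suc j)) f"
  define y where "y = z (Suc i)"
  define q where "q = 1 - p"
  have q: "0 < q" using p_less_1 by (simp add: q_def)
  have yA: "y \<in> A" and ind: "indep_of y (hole i)" and ind': "indep_of (z (Suc j)) (hole i)"
    using assms by (auto simp: y_def intro: z_in_A indep_of_hole_z)
  have jA: "z (Suc j) \<in> A" using assms z_in_A by auto
  have split: "hole_energy i j = avg A (\<lambda>\<eta>. hole i \<eta> * (resample y g \<eta>)\<^sup>2) \<zeta> +
      avg A (\<lambda>\<eta>. hole i \<eta> * (fluct y g \<eta>)\<^sup>2) \<zeta>"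
    unfolding hole_energy_def g_def[symmetric] by (rule avg_pythagoras[OF finite_A yA ind])
  have flu: "avg A (\<lambda>\<eta>. hole i \<eta> * (fluct y g \<eta>)\<^sup>2) \<zeta> \<le> hole_energy i i"
    unfolding hole_energy_def y_def[symmetric] g_def fluct_commute[of y]
    by (rule avg_fluct_contraction[OF finite_A jA ind']) simp
  have next_hole: "resample y (hole (Suc i)) = (\<lambda>_. q)"
    by (simp add: resample_def hole_def y_def q_def)
  have "avg A (\<lambda>\<eta>. hole i \<eta> * (resample y g \<eta>)\<^sup>2) \<zeta> =
      1 / q * avg A (resample y (\<lambda>\<eta>. (hole i \<eta> * (resample y g \<eta>)\<^sup>2) * hole (Suc i) \<eta>)) \<zeta>"
    unfolding resample_mult_left[OF indep_of_mult[OF ind indep_of_power[OF indep_of_resample_self]]] next_hole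
    using q by (simp add: mult.commute[of _ q] avg_scale[OF finite_A])
  also have "\<dots> = 1 / q * avg A (\<lambda>\<eta>. (hole i \<eta> * (resample y g \<eta>)\<^sup>2) * hole (Suc i) \<eta>) \<zeta>"
    using yA by (simp add: avg_resample finite_A)
  also have "\<dots> \<le> 1 / q * (2 * (hole_energy (Suc i) j + hole_energy i i))"
  proof -
    have "avg A (\<lambda>\<eta>. (hole i \<eta> * (resample y g \<eta>)\<^sup>2) * hole (Suc i) \<eta>) \<zeta> \<le>
        avg A (\<lambda>\<eta>. 2 * (hole (Suc i) \<eta> * (g \<eta>)\<^sup>2 + hole i \<eta> * (fluct y g \<eta>)\<^sup>2)) \<zeta>"
    proof (intro avg_mono finite_A)
      fix \<eta>
      have "(resample y g \<eta>)\<^sup>2 = (g \<eta> - fluct y g \<eta>)\<^sup>2" by (simp add: fluct_def)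
      also have "\<dots> \<le> 2 * ((g \<eta>)\<^sup>2 + (fluct y g \<eta>)\<^sup>2)"
        using sum_squares_ge_zero[of "g \<eta> + fluct y g \<eta>" 0] by (simp add: power2_eq_square algebra_simps)
      finally have *: "(resample y g \<eta>)\<^sup>2 \<le> 2 * ((g \<eta>)\<^sup>2 + (fluct y g \<eta>)\<^sup>2)" .
      show "(hole i \<eta> * (resample y g \<eta>)\<^sup>2) * hole (Suc i) \<eta> \<le>
          2 * (hole (Suc i) \<eta> * (g \<eta>)\<^sup>2 + hole i \<eta> * (fluct y g \<eta>)\<^sup>2)"
        using * by (auto simp: hole_def)
    qed
    also have "\<dots> = 2 * (hole_energy (Suc i) j + avg A (\<lambda>\<eta>. hole i \<eta> * (fluct y g \<eta>)\<^sup>2) \<zeta>)"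
      unfolding avg_scale[OF finite_A] avg_add[OF finite_A] by (simp add: hole_energy_def g_def)
    finally show ?thesis using flu q by (intro mult_left_mono) auto
  qed
  finally have "hole_energy i j \<le> 2 / q * (hole_energy (Suc i) j + hole_energy i i) + hole_energy i i"
    using split flu by simp
  also have "\<dots> \<le> (1 + 2 / q) * (hole_energy (Suc i) j + hole_energy i i)"
    using hole_energy_nonneg[of "Suc i" j] by (simp add: algebra_simps)
  finally show ?thesis by (simp add: q_def)
qed

text \<open>The hole is moved one site at a time until it is adjacent to \<open>z (Suc j)\<close>.
  The cost is exponential in the distance, which is why holes are only ever sought in a window of
  bounded length.\<close>

lemma hole_energy_chain:
  assumes "i \<le> j" "j < n"
  shows "hole_energy i j \<le> (1 + 2 / (1 - p)) ^ (j - i) * (\<Sum>k=i..j. hole_energy k k)"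
  using assms
proof (induction "j - i" arbitrary: i)
  case (Suc k)
  define \<theta> where "\<theta> = 1 + 2 / (1 - p)"
  have \<theta>: "1 \<le> \<theta>" using p_less_1 by (simp add: \<theta>_def)
  from Suc have ij: "i < j" by simp
  have k: "k = j - Suc i" "j - i = Suc k" using Suc.hyps by auto
  have "hole_energy i j \<le> \<theta> * (hole_energy (Suc i) j + hole_energy i i)"
    using hole_energy_step[of i j] ij Suc by (simp add: \<theta>_def)
  also have "\<dots> \<le> \<theta> * (\<theta> ^ k * (\<Sum>k=Suc i..j. hole_energy k k) + \<theta> ^ k * hole_energy i i)"
  proof (intro mult_left_mono add_mono)
    show "hole_energy (Suc i) j \<le> \<theta> ^ k * (\<Sum>k=Suc i..j. hole_energy k k)"
      using Suc.hyps(1)[of "Suc i"] ij Suc.prems k by (simp add: \<theta>_def)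
    show "hole_energy i i \<le> \<theta> ^ k * hole_energy i i"
      using mult_right_mono[OF one_le_power[OF \<theta>, of k] hole_energy_nonneg[of i i]] by simp
  qed (use \<theta> in simp)
  also have "\<dots> = \<theta> ^ Suc k * (\<Sum>k=i..j. hole_energy k k)"
    using ij by (simp add: sum.atLeast_Suc_atMost algebra_simps)
  finally show ?case by (simp add: k \<theta>_def)
qed simp

lemma hole_energy_window:
  assumes "i \<le> j" "j < n" "j \<le> i + l"
  shows "hole_energy i j \<le> (1 + 2 / (1 - p)) ^ l * (\<Sum>k | k \<le> j \<and> j \<le> k + l. hole_energy k k)"
proof -
  have "hole_energy i j \<le> (1 + 2 / (1 - p)) ^ (j - i) * (\<Sum>k=i..j. hole_energy k k)"
    by (rule hole_energy_chain) fact+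
  also have "\<dots> \<le> (1 + 2 / (1 - p)) ^ l * (\<Sum>k | k \<le> j \<and> j \<le> k + l. hole_energy k k)"
    using assms p_less_1
    by (intro mult_mono power_increasing sum_mono2 sum_nonneg) (auto simp: hole_energy_nonneg)
  finally show ?thesis .
qed

text \<open>The fluctuation at \<open>j + 1\<close>, averaged over the sites before it, is compared with its restriction to
  the event that the last \<open>l\<close> of these sites contain a hole; the error is a covariance over the
  window, hence controlled by the increments there.\<close>

lemma increment_window:
  assumes j: "j < n" and l: "0 < l" and lj: "l \<le> j"
  shows "(1 - p ^ l)\<^sup>2 * increment j \<le>
    2 * (\<Sum>i\<in>{j - l<..j}. hole_energy i j) + 2 * p ^ l * (\<Sum>i\<in>{j - l..<j}. increment i)"
proof -
  define a where "a = j - l"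
  define W where "W = z ` {a<..j}"
  define \<delta> where "\<delta> = p ^ l"
  define y where "y = z (Suc j)"
  define \<Psi> where "\<Psi> = fluct y (front a)"
  define F where "F = (\<lambda>\<eta>. of_bool (\<forall>w\<in>W. \<eta> w) :: real)"
  define H where "H = (\<lambda>\<eta>. 1 - F \<eta>)"
  have aj: "a < j" "a \<le> j" using l lj by (auto simp: a_def)
  have fin: "finite W" by (simp add: W_def)
  have WA: "W \<subseteq> A" using j z_in_A by (auto simp: W_def)
  have yA: "y \<in> A" using j z_in_A by (simp add: y_def)
  have card: "card W = l"
    using inj_z j l lj by (subst W_def, subst card_image) (auto simp: a_def intro: inj_on_subset)
  have \<delta>: "0 \<le> \<delta>" "\<delta> \<le> 1"
    using p_pos p_less_1 by (auto simp: \<delta>_def power_le_one)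
  have avgF: "avg W F = (\<lambda>_. \<delta>)" unfolding F_def avg_filled[OF fin] by (simp add: card \<delta>_def)
  have avgPsi: "avg W \<Psi> = fluct y (front j)"
  proof -
    have "avg W \<Psi> = fluct y (avg W (front a))"
      unfolding \<Psi>_def fluct_def avg_diff[OF fin] avg_resample_commute[OF fin] ..
    also have "avg W (front a) = front j" using aj front_window[of a j] by (simp add: W_def)
    finally show ?thesis .
  qed
  have F2: "F \<eta> ^ 2 = F \<eta>" and H2: "H \<eta> ^ 2 = H \<eta>" for \<eta> by (auto simp: F_def H_def)
  have H01: "0 \<le> H \<eta>" for \<eta> by (auto simp: F_def H_def)

  have main: "(1 - \<delta>)\<^sup>2 * (fluct y (front j) \<eta>)\<^sup>2 \<le> 2 * avg W (\<lambda>\<eta>. H \<eta> * (\<Psi> \<eta>)\<^sup>2) \<eta> +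
      2 * \<delta> * (avg W (\<lambda>\<eta>. (\<Psi> \<eta>)\<^sup>2) \<eta> - (avg W \<Psi> \<eta>)\<^sup>2)" for \<eta>
  proof -
    define u where "u = avg W (\<lambda>\<eta>. H \<eta> * \<Psi> \<eta>) \<eta>"
    define w where "w = avg W (\<lambda>\<eta>. (F \<eta> - \<delta>) * \<Psi> \<eta>) \<eta>"
    define c where "c = avg W \<Psi> \<eta>"
    \<comment> \<open>As \<open>H = 1 - F\<close>, the window average splits into a part carried by
      a hole in the window and the covariance of \<open>F\<close> with
      \<open>\<Psi>\<close>.\<close>
    have "(\<lambda>\<eta>. (1 - \<delta>) * \<Psi> \<eta>) = (\<lambda>\<eta>. H \<eta> * \<Psi> \<eta> + (F \<eta> - \<delta>) * \<Psi> \<eta>)"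
      by (auto simp: H_def algebra_simps)
    from arg_cong[OF this, of "\<lambda>g. avg W g \<eta>"] have uw: "(1 - \<delta>) * c = u + w"
      by (simp only: u_def w_def c_def avg_add[OF fin] avg_scale[OF fin])
    have u: "u\<^sup>2 \<le> avg W (\<lambda>\<eta>. H \<eta> * (\<Psi> \<eta>)\<^sup>2) \<eta>"
      unfolding u_def using avg_power2_le[OF fin, of "\<lambda>\<eta>. H \<eta> * \<Psi> \<eta>" \<eta>]
      by (simp add: power_mult_distrib H2)
    have Fd: "avg W (\<lambda>\<eta>. (F \<eta> - \<delta>)\<^sup>2) \<eta> = \<delta> * (1 - \<delta>)"
    proof -
      have "(\<lambda>\<eta>. (F \<eta> - \<delta>)\<^sup>2) = (\<lambda>\<eta>. (1 - 2 * \<delta>) * F \<eta> + \<delta>\<^sup>2)"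
        using F2 by (auto simp: power2_eq_square algebra_simps)
      then show ?thesis
        by (simp add: avg_add avg_scale fin avgF) (simp add: power2_eq_square algebra_simps)
    qed
    have Fd0: "avg W (\<lambda>\<eta>. F \<eta> - \<delta>) \<eta> = 0"
      by (simp add: avg_diff fin avgF)
    \<comment> \<open>\<open>F - \<delta>\<close> has window mean zero, so \<open>\<Psi>\<close> may
      be centred at \<open>c\<close>; Cauchy-Schwarz then leaves two variances, that of
      \<open>F\<close> being at most \<open>\<delta>\<close>.\<close>
    have "(\<lambda>\<eta>. (F \<eta> - \<delta>) * \<Psi> \<eta>) = (\<lambda>\<eta>. (F \<eta> - \<delta>) * (\<Psi> \<eta> - c) + c * (F \<eta> - \<delta>))"
      by (auto simp: algebra_simps)
    then have "w = avg W (\<lambda>\<eta>. (F \<eta> - \<delta>) * (\<Psi> \<eta> - c)) \<eta>"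
      unfolding w_def by (simp only: avg_add[OF fin] avg_scale[OF fin] Fd0 mult_zero_right add_0_right)
    then have "w\<^sup>2 \<le> \<delta> * (1 - \<delta>) * avg W (\<lambda>\<eta>. (\<Psi> \<eta> - c)\<^sup>2) \<eta>"
      using avg_Cauchy_Schwarz[OF fin, of "\<lambda>\<eta>. F \<eta> - \<delta>" "\<lambda>\<eta>. \<Psi> \<eta> - c" \<eta>] by (simp add: Fd)
    also have "\<dots> \<le> \<delta> * 1 * avg W (\<lambda>\<eta>. (\<Psi> \<eta> - c)\<^sup>2) \<eta>"
      using \<delta> fin by (intro mult_right_mono mult_left_mono avg_nonneg) auto
    also have "(\<lambda>\<eta>. (\<Psi> \<eta> - c)\<^sup>2) = (\<lambda>\<eta>. ((\<Psi> \<eta>)\<^sup>2 - (2 * c) * \<Psi> \<eta>) + c\<^sup>2)"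
      by (auto simp: power2_eq_square algebra_simps)
    also have "avg W \<dots> \<eta> = avg W (\<lambda>\<eta>. (\<Psi> \<eta>)\<^sup>2) \<eta> - c\<^sup>2"
      by (simp only: avg_add[OF fin] avg_diff[OF fin] avg_scale[OF fin] avg_const[OF fin])
        (simp add: c_def power2_eq_square)
    finally have w: "w\<^sup>2 \<le> \<delta> * (avg W (\<lambda>\<eta>. (\<Psi> \<eta>)\<^sup>2) \<eta> - c\<^sup>2)" by simp
    have "(u + w)\<^sup>2 \<le> 2 * u\<^sup>2 + 2 * w\<^sup>2"
      using zero_le_power2[of "u - w"] by (simp add: power2_eq_square algebra_simps)
    then have "((1 - \<delta>) * c)\<^sup>2 \<le> 2 * u\<^sup>2 + 2 * w\<^sup>2" by (simp add: uw)
    with u w show ?thesis by (simp add: c_def power_mult_distrib flip: avgPsi)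
  qed

  have indW: "indep_of w (hole 0)" if "w \<in> W" for w
    using that j by (auto simp: W_def intro!: indep_of_hole_z)
  have avgW: "avg A (avg W g) = avg A g" for g :: "('a \<Rightarrow> bool) \<Rightarrow> real"
    using avg_union[OF finite_A fin, of g] WA by (simp add: Un_absorb2)
  have pull: "hole 0 \<eta> * avg W g \<eta> = avg W (\<lambda>\<eta>. hole 0 \<eta> * g \<eta>) \<eta>" for g \<eta>
    by (subst avg_mult_left[OF fin indW]) auto
  have "(1 - \<delta>)\<^sup>2 * increment j = avg A (\<lambda>\<eta>. hole 0 \<eta> * ((1 - \<delta>)\<^sup>2 * (fluct y (front j) \<eta>)\<^sup>2)) \<zeta>"
    unfolding increment_def y_def
    by (simp only: mult.left_commute[of "hole 0 _"] avg_scale[OF finite_A])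
  also have "\<dots> \<le> avg A (\<lambda>\<eta>. hole 0 \<eta> * (2 * avg W (\<lambda>\<eta>. H \<eta> * (\<Psi> \<eta>)\<^sup>2) \<eta> +
      2 * \<delta> * (avg W (\<lambda>\<eta>. (\<Psi> \<eta>)\<^sup>2) \<eta> - (avg W \<Psi> \<eta>)\<^sup>2))) \<zeta>"
    by (intro avg_mono finite_A mult_left_mono main) simp
  also have "(\<lambda>\<eta>. hole 0 \<eta> * (2 * avg W (\<lambda>\<eta>. H \<eta> * (\<Psi> \<eta>)\<^sup>2) \<eta> +
      2 * \<delta> * (avg W (\<lambda>\<eta>. (\<Psi> \<eta>)\<^sup>2) \<eta> - (avg W \<Psi> \<eta>)\<^sup>2))) =
     (\<lambda>\<eta>. 2 * avg W (\<lambda>\<eta>. hole 0 \<eta> * (H \<eta> * (\<Psi> \<eta>)\<^sup>2)) \<eta> +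
      (2 * \<delta>) * (avg W (\<lambda>\<eta>. hole 0 \<eta> * (\<Psi> \<eta>)\<^sup>2) \<eta> - hole 0 \<eta> * (fluct y (front j) \<eta>)\<^sup>2))"
    unfolding avgPsi pull[symmetric] by (auto simp: algebra_simps)
  also have "avg A \<dots> \<zeta> = 2 * avg A (\<lambda>\<eta>. hole 0 \<eta> * (H \<eta> * (\<Psi> \<eta>)\<^sup>2)) \<zeta> + (2 * \<delta>) *
     (avg A (\<lambda>\<eta>. hole 0 \<eta> * (\<Psi> \<eta>)\<^sup>2) \<zeta> - avg A (\<lambda>\<eta>. hole 0 \<eta> * (fluct y (front j) \<eta>)\<^sup>2) \<zeta>)"
    by (simp only: avg_add[OF finite_A] avg_diff[OF finite_A] avg_scale[OF finite_A] avgW)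
  also have "avg A (\<lambda>\<eta>. hole 0 \<eta> * (H \<eta> * (\<Psi> \<eta>)\<^sup>2)) \<zeta> \<le> (\<Sum>i\<in>{a<..j}. hole_energy i j)"
  proof -
    have ind: "indep_of (z i) (\<lambda>\<eta>. hole 0 \<eta> * H \<eta>)" if "0 < i" "i \<le> a" for i
      unfolding H_def F_def using that aj j
      by (intro indep_of_mult indep_of_diff indep_of_const indep_of_filled indep_of_hole_z)
        (auto simp: W_def z_eq_iff)
    \<comment> \<open>The average over the sites up to \<open>a\<close> is removed by contraction,
      which is allowed because the weight reads only \<open>z 0\<close> and the window.\<close>
    have "avg A (\<lambda>\<eta>. hole 0 \<eta> * (H \<eta> * (\<Psi> \<eta>)\<^sup>2)) \<zeta> \<le>
        avg A (\<lambda>\<eta>. (hole 0 \<eta> * H \<eta>) * (fluct y f \<eta>)\<^sup>2) \<zeta>"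
      using front_fluct_contraction[of a j "\<lambda>\<eta>. hole 0 \<eta> * H \<eta>"] aj j ind H01
      by (simp add: \<Psi>_def y_def mult.assoc)
    also have "\<dots> \<le> avg A (\<lambda>\<eta>. \<Sum>i\<in>{a<..j}. hole i \<eta> * (fluct y f \<eta>)\<^sup>2) \<zeta>"
    proof (intro avg_mono finite_A)
      fix \<eta>
      have "hole 0 \<eta> * H \<eta> \<le> (\<Sum>i\<in>{a<..j}. hole i \<eta>)"
      proof (cases "\<forall>w\<in>W. \<eta> w")
        case True
        then show ?thesis by (auto simp: H_def F_def intro!: sum_nonneg)
      next
        case False
        then obtain i where i: "i \<in> {a<..j}" "\<not> \<eta> (z i)" by (auto simp: W_def)
        have "hole 0 \<eta> * H \<eta> \<le> hole i \<eta>" using i by (auto simp: H_def F_def hole_def)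
        also have "\<dots> \<le> (\<Sum>i\<in>{a<..j}. hole i \<eta>)" using i by (intro member_le_sum) auto
        finally show ?thesis .
      qed
      then show "hole 0 \<eta> * H \<eta> * (fluct y f \<eta>)\<^sup>2 \<le> (\<Sum>i\<in>{a<..j}. hole i \<eta> * (fluct y f \<eta>)\<^sup>2)"
        by (simp add: mult_right_mono flip: sum_distrib_right)
    qed
    also have "\<dots> = (\<Sum>i\<in>{a<..j}. hole_energy i j)"
      by (simp add: avg_sum[OF finite_A] hole_energy_def y_def)
    finally show ?thesis .
  qed
  also have "avg A (\<lambda>\<eta>. hole 0 \<eta> * (\<Psi> \<eta>)\<^sup>2) \<zeta> - avg A (\<lambda>\<eta>. hole 0 \<eta> * (fluct y (front j) \<eta>)\<^sup>2) \<zeta>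
      \<le> (\<Sum>i\<in>{a..<j}. increment i)"
  proof -
    \<comment> \<open>Averaging one more site \<open>z (Suc b)\<close> loses the mean square of a
      fluctuation there, and applying \<open>fluct y\<close> on top only decreases it below
      \<open>increment b\<close>.\<close>
    have "avg A (\<lambda>\<eta>. hole 0 \<eta> * (fluct y (front a) \<eta>)\<^sup>2) \<zeta> -
        avg A (\<lambda>\<eta>. hole 0 \<eta> * (fluct y (front b) \<eta>)\<^sup>2) \<zeta> \<le> (\<Sum>i\<in>{a..<b}. increment i)"
      if "a \<le> b" "b \<le> j" for b
      using that
    proof (induction b rule: dec_induct)
      case (step b)
      have "avg A (\<lambda>\<eta>. hole 0 \<eta> * (fluct y (front b) \<eta>)\<^sup>2) \<zeta> =
          avg A (\<lambda>\<eta>. hole 0 \<eta> * (resample (z (Suc b)) (fluct y (front b)) \<eta>)\<^sup>2) \<zeta> +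
          avg A (\<lambda>\<eta>. hole 0 \<eta> * (fluct (z (Suc b)) (fluct y (front b)) \<eta>)\<^sup>2) \<zeta>"
        using step j by (intro avg_pythagoras finite_A z_in_A indep_of_hole_z) auto
      also have "avg A (\<lambda>\<eta>. hole 0 \<eta> * (fluct (z (Suc b)) (fluct y (front b)) \<eta>)\<^sup>2) \<zeta> \<le> increment b"
        unfolding increment_def fluct_commute[of "z (Suc b)" y]
        using j by (intro avg_fluct_contraction finite_A yA) (auto simp: y_def intro: indep_of_hole_z)
      finally show ?case using step by (simp add: resample_fluct_commute)
    qed simp
    from this[of j] aj show ?thesis by (simp add: \<Psi>_def)
  qed
  finally show ?thesis using \<delta> by (simp add: a_def \<delta>_def mult_left_mono)
qed

lemma increment_bound:
  assumes j: "j < n" and l: "0 < l"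
  shows "(1 - p ^ l)\<^sup>2 * increment j \<le>
    2 * real l * (1 + 2 / (1 - p)) ^ l * (\<Sum>k | k \<le> j \<and> j \<le> k + l. hole_energy k k) +
    2 * p ^ l * (\<Sum>i | i < j \<and> j \<le> i + l. increment i)"
proof (cases "l \<le> j")
  case True
  have "(\<Sum>i\<in>{j - l<..j}. hole_energy i j) \<le> (\<Sum>i\<in>{j - l<..j}. (1 + 2 / (1 - p)) ^ l *
      (\<Sum>k | k \<le> j \<and> j \<le> k + l. hole_energy k k))"
    using j by (intro sum_mono hole_energy_window) auto
  also have "\<dots> = real l * (1 + 2 / (1 - p)) ^ l * (\<Sum>k | k \<le> j \<and> j \<le> k + l. hole_energy k k)"
    using True by simp
  finally have "2 * (\<Sum>i\<in>{j - l<..j}. hole_energy i j) \<le>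
      2 * real l * (1 + 2 / (1 - p)) ^ l * (\<Sum>k | k \<le> j \<and> j \<le> k + l. hole_energy k k)" by simp
  moreover have "{j - l..<j} = {i. i < j \<and> j \<le> i + l}" using True by auto
  ultimately show ?thesis using increment_window[OF j l True] by simp
next
  case False
  have "increment j \<le> hole_energy 0 j"
    unfolding increment_def hole_energy_def
    using j by (intro front_fluct_contraction indep_of_hole_z) auto
  also have "\<dots> \<le> (1 + 2 / (1 - p)) ^ l * (\<Sum>k | k \<le> j \<and> j \<le> k + l. hole_energy k k)"
    using False j by (intro hole_energy_window) auto
  finally have 1: "increment j \<le> (1 + 2 / (1 - p)) ^ l * (\<Sum>k | k \<le> j \<and> j \<le> k + l. hole_energy k k)"
    (is "_ \<le> ?X") .
  have "(1 - p ^ l)\<^sup>2 * increment j \<le> 1 * increment j"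
    using p_pos p_less_1 increment_nonneg by (intro mult_right_mono power_le_one) (auto simp: power_le_one)
  also have "\<dots> \<le> 2 * real l * ?X"
  proof -
    have "1 * ?X \<le> 2 * real l * ?X"
      using 1 l increment_nonneg[of j] by (intro mult_right_mono) auto
    with 1 show ?thesis by simp
  qed
  also have "\<dots> \<le> 2 * real l * ?X + 2 * p ^ l * (\<Sum>i | i < j \<and> j \<le> i + l. increment i)"
    using p_pos by (auto intro!: mult_nonneg_nonneg sum_nonneg increment_nonneg)
  finally show ?thesis by (simp add: mult_ac)
qed

text \<open>The constant is free of \<open>n\<close>. After summing \<open>increment_bound\<close>
  over \<open>j\<close>, each increment on the right is counted at most \<open>l\<close> times with
  factor \<open>2 * p ^ l\<close>, and \<open>small\<close> lets the left side absorb it. Centring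
  at the endpoint turns the second moment into the sum of the increments.\<close>

lemma path_gap:
  assumes l: "0 < l" and small: "1 / 2 \<le> (1 - p ^ l)\<^sup>2 - 2 * real l * p ^ l"
    and centred: "0 < n" "resample (z n) f = (\<lambda>_. 0)"
  shows "avg A (\<lambda>\<eta>. hole 0 \<eta> * (f \<eta>)\<^sup>2) \<zeta> \<le>
    4 * real l * real (l + 1) * (1 + 2 / (1 - p)) ^ l * (\<Sum>k<n. hole_energy k k)"
proof -
  \<comment> \<open>Double counting: each \<open>h k\<close> is charged for at most \<open>r\<close>
    values of \<open>j\<close>.\<close>
  have double: "(\<Sum>j<n. \<Sum>k | k < n \<and> R j k. h k) \<le> real r * (\<Sum>k<n. h k)"
    if "\<And>k. 0 \<le> h k" "\<And>k. finite {j. R j k} \<and> card {j. R j k} \<le> r" for R :: "nat \<Rightarrow> nat \<Rightarrow> bool" and h r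
  proof -
    have "(\<Sum>j<n. \<Sum>k | k < n \<and> R j k. h k) = (\<Sum>k<n. \<Sum>j | j < n \<and> R j k. h k)"
      using sum.swap_restrict[of "{..<n}" "{..<n}" "\<lambda>j k. h k" R] by simp
    also have "\<dots> = (\<Sum>k<n. real (card {j. j < n \<and> R j k}) * h k)" by simp
    also have "\<dots> \<le> (\<Sum>k<n. real r * h k)"
    proof (intro sum_mono mult_right_mono)
      fix k
      have "card {j. j < n \<and> R j k} \<le> card {j. R j k}"
        using that(2)[of k] by (intro card_mono) auto
      then show "real (card {j. j < n \<and> R j k}) \<le> real r" using that(2)[of k] by simp
    qed (use that in auto)
    finally show ?thesis by (simp add: sum_distrib_left)
  qed
  define V where "V = (\<Sum>j<n. increment j)"
  define S where "S = (\<Sum>k<n. hole_energy k k)"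
  define T where "T = (1 + 2 / (1 - p)) ^ l"
  have T: "0 \<le> T" using p_less_1 by (simp add: T_def)
  have "(\<Sum>j<n. \<Sum>k | k < n \<and> k \<le> j \<and> j \<le> k + l. hole_energy k k) \<le> real (l + 1) * S"
    unfolding S_def
  proof (rule double)
    fix k
    have "{j. k \<le> j \<and> j \<le> k + l} = {k..k + l}" by auto
    then show "finite {j. k \<le> j \<and> j \<le> k + l} \<and> card {j. k \<le> j \<and> j \<le> k + l} \<le> l + 1" by simp
  qed (simp add: hole_energy_nonneg)
  moreover have "{k. k < n \<and> k \<le> j \<and> j \<le> k + l} = {k. k \<le> j \<and> j \<le> k + l}" if "j < n" for j
    using that by auto
  ultimately have 1: "(\<Sum>j<n. \<Sum>k | k \<le> j \<and> j \<le> k + l. hole_energy k k) \<le> real (l + 1) * S"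
    by simp
  have "(\<Sum>j<n. \<Sum>k | k < n \<and> k < j \<and> j \<le> k + l. increment k) \<le> real l * V"
    unfolding V_def
  proof (rule double)
    fix k
    have "{j. k < j \<and> j \<le> k + l} = {k<..k + l}" by auto
    then show "finite {j. k < j \<and> j \<le> k + l} \<and> card {j. k < j \<and> j \<le> k + l} \<le> l" by simp
  qed (simp add: increment_nonneg)
  moreover have "{k. k < n \<and> k < j \<and> j \<le> k + l} = {k. k < j \<and> j \<le> k + l}" if "j < n" for j
    using that by auto
  ultimately have 2: "(\<Sum>j<n. \<Sum>k | k < j \<and> j \<le> k + l. increment k) \<le> real l * V"
    by simp
  have "(1 - p ^ l)\<^sup>2 * V \<le> (\<Sum>j<n. 2 * real l * T * (\<Sum>k | k \<le> j \<and> j \<le> k + l. hole_energy k k) +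
      2 * p ^ l * (\<Sum>k | k < j \<and> j \<le> k + l. increment k))"
    unfolding V_def sum_distrib_left T_def sum.distrib
    using sum_mono[of "{..<n}", OF increment_bound[OF _ l]] by (simp add: sum_distrib_left sum.distrib)
  also have "\<dots> = 2 * real l * T * (\<Sum>j<n. \<Sum>k | k \<le> j \<and> j \<le> k + l. hole_energy k k) +
      2 * p ^ l * (\<Sum>j<n. \<Sum>k | k < j \<and> j \<le> k + l. increment k)"
    by (simp add: sum.distrib sum_distrib_left)
  also have "\<dots> \<le> 2 * real l * T * (real (l + 1) * S) + 2 * p ^ l * (real l * V)"
    using 1 2 T p_pos by (intro add_mono mult_left_mono) auto
  finally have "((1 - p ^ l)\<^sup>2 - 2 * real l * p ^ l) * V \<le> 2 * real l * T * real (l + 1) * S"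
    by (simp add: algebra_simps)
  moreover have "1 / 2 * V \<le> ((1 - p ^ l)\<^sup>2 - 2 * real l * p ^ l) * V"
    using small by (intro mult_right_mono) (auto simp: V_def intro!: sum_nonneg increment_nonneg)
  ultimately have "1 / 2 * V \<le> 2 * real l * T * real (l + 1) * S" by (rule order.trans[rotated])
  then have "V \<le> 4 * real l * real (l + 1) * T * S" by (simp add: mult_ac)
  \<comment> \<open>Resampling at \<open>z n\<close> annihilates \<open>f\<close> and commutes with
    all earlier resamplings, so nothing is left once the whole path has been averaged.\<close>
  moreover have "front n = (\<lambda>_. 0)"
  proof -
    have "resample (z n) (front k) = (\<lambda>_. 0)" for k
      by (induction k) (simp_all add: centred resample_commute[of "z n"])
    from this[of "n - 1"] \<open>0 < n\<close> show ?thesis by (cases n) simp_all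
  qed
  then have "avg A (\<lambda>\<eta>. hole 0 \<eta> * (f \<eta>)\<^sup>2) \<zeta> = V"
    using sum_increments[of n] finite_A by (simp add: V_def)
  ultimately show ?thesis by (simp add: S_def T_def)
qed

end

section \<open>Oriented paths in boxes and the gap in a box\<close>

context bernoulli_spins
begin

text \<open>The window length depends on \<open>p\<close> alone, and so does the gap constant
  derived from it.\<close>

lemma window_length_exists:
  "\<exists>l>0. 1 / 2 \<le> (1 - p ^ l)\<^sup>2 - 2 * real l * p ^ l"
proof -
  have "(\<lambda>l. (1 - p ^ l)\<^sup>2 - 2 * (real l * p ^ l)) \<longlonglongrightarrow> (1 - 0)\<^sup>2 - 2 * 0"
    using p_pos p_less_1 by (intro tendsto_intros LIMSEQ_power_zero powser_times_n_limit_0) auto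
  then have "\<forall>\<^sub>F l in sequentially. 1 / 2 < (1 - p ^ l)\<^sup>2 - 2 * (real l * p ^ l)"
    by (rule order_tendstoD) simp
  then have "\<forall>\<^sub>F l in sequentially. 0 < l \<and> 1 / 2 < (1 - p ^ l)\<^sup>2 - 2 * (real l * p ^ l)"
    using eventually_gt_at_top[of "0::nat"] by eventually_elim simp
  then obtain l where "0 < l" "1 / 2 < (1 - p ^ l)\<^sup>2 - 2 * (real l * p ^ l)"
    using eventually_happens'[OF sequentially_bot] by blast
  then show ?thesis by (intro exI[of _ l]) (simp add: mult.assoc)
qed

lemma indep_of_constraint:
  assumes "\<And>i. w \<noteq> z - axis i 1"
  shows "indep_of w (constraint z)"
proof -
  have *: "(\<eta>(w := v)) (z - axis i 1) = \<eta> (z - axis i 1)" for \<eta> v i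
    by (rule fun_upd_other[OF assms[symmetric]])
  show ?thesis
    unfolding indep_of_def constraint_def by (intro allI) (subst *, rule refl)
qed

lemma minus_axis_le: "z - axis i 1 \<le> (z :: int ^ 'd::finite)"
  by (simp add: less_eq_vec_def axis_def)

lemma axis_1_neq_0: "axis i 1 \<noteq> (0 :: int ^ 'd::finite)"
  by (simp add: vec_eq_iff axis_def)

lemma indep_of_constraint_not_le:
  assumes "\<not> w \<le> z \<or> w = z"
  shows "indep_of w (constraint z)"
  using assms minus_axis_le[of z] axis_1_neq_0 by (intro indep_of_constraint) auto

text \<open>If the constraint at \<open>z\<close> read a site \<open>w\<close> of the box, then
  \<open>a \<le> w \<le> z \<le> x\<close> would put \<open>z\<close> into the box.\<close>

lemma indep_of_constraint_outside_box:
  fixes w x z a :: "int ^ 'd::finite"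
  assumes "w \<in> {a..x}" "z \<le> x" "z \<notin> {a..x}"
  shows "indep_of w (constraint z)"
  using assms minus_axis_le[of z] by (intro indep_of_constraint) (auto intro: order.trans)

lemma constraint_nonneg [simp]: "0 \<le> constraint z \<eta>" and constraint_le_1: "constraint z \<eta> \<le> 1"
  by (auto simp: constraint_def)

lemma
  fixes a b :: "int ^ 'd::finite"
  shows finite_box: "finite {a..b}"
    and card_box_le: "card {a..b} \<le> (\<Prod>i\<in>UNIV. nat (b $ i - a $ i + 1))"
proof -
  let ?P = "PiE UNIV (\<lambda>i. {a $ i..b $ i})"
  have inj: "inj_on (\<lambda>v. ($) v) {a..b}" by (auto simp: inj_on_def vec_eq_iff)
  have sub: "(\<lambda>v. ($) v) ` {a..b} \<subseteq> ?P" by (auto simp: less_eq_vec_def)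
  have fin: "finite ?P" by (intro finite_PiE) auto
  show "finite {a..b}" using inj_on_finite[OF inj sub fin] .
  have "card {a..b} \<le> card ?P" by (rule card_inj_on_le[OF inj sub fin])
  then show "card {a..b} \<le> (\<Prod>i\<in>UNIV. nat (b $ i - a $ i + 1))"
    by (simp add: card_PiE algebra_simps)
qed

lemma card_box_le_power:
  fixes a b :: "int ^ 'd::finite"
  assumes "\<And>i. b $ i - a $ i + 1 \<le> int m"
  shows "card {a..b} \<le> m ^ CARD('d)"
proof -
  have "(\<Prod>i\<in>(UNIV :: 'd set). nat (b $ i - a $ i + 1)) \<le> (\<Prod>i\<in>(UNIV :: 'd set). m)"
    using assms by (intro prod_mono) (auto simp: nat_le_iff)
  with card_box_le[of a b] show ?thesis by simp
qed

lemma sum_axis: "(\<Sum>j\<in>UNIV. (v + axis i 1) $ j) = (\<Sum>j\<in>UNIV. v $ j) + (1 :: int)"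
  for v :: "int ^ 'd::finite"
  by (simp add: sum.distrib axis_def)

text \<open>Ascent along any coordinate in which \<open>y\<close> is still below \<open>x\<close>,
  by induction on the total coordinate difference. The coordinate sum grows by one per step, whence
  injectivity.\<close>

lemma oriented_path_exists:
  fixes y x :: "int ^ 'd::finite"
  assumes "y \<le> x"
  shows "\<exists>n z. z 0 = y \<and> z n = x \<and> (\<forall>k\<le>n. z k \<in> {y..x}) \<and>
    (\<forall>k<n. \<exists>i. z (Suc k) = z k + axis i 1) \<and> inj_on z {0..n}"
proof -
  have "\<exists>n z. z 0 = y \<and> z n = x \<and> (\<forall>k\<le>n. z k \<in> {y..x}) \<and>
      (\<forall>k<n. \<exists>i. z (Suc k) = z k + axis i 1)"
    using assms
  proof (induction "nat (\<Sum>i\<in>UNIV. x $ i - y $ i)" arbitrary: y rule: less_induct)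
    case less
    show ?case
    proof (cases "y = x")
      case True
      then show ?thesis by (intro exI[of _ 0] exI[of _ "\<lambda>_. x"]) simp
    next
      case False
      then obtain i where i: "y $ i < x $ i"
        using less.prems by (auto simp: less_eq_vec_def vec_eq_iff less_le)
      define y' where "y' = y + axis i 1"
      have y'x: "y' \<le> x" using i less.prems by (auto simp: y'_def less_eq_vec_def axis_def)
      have yy': "y \<le> y'" by (auto simp: y'_def less_eq_vec_def axis_def)
      have "(\<Sum>j\<in>UNIV. x $ j - y' $ j) = (\<Sum>j\<in>UNIV. x $ j - y $ j) - 1"
        unfolding sum_subtractf y'_def sum_axis by simp
      moreover have "0 \<le> (\<Sum>j\<in>UNIV. x $ j - y' $ j)"
        using y'x by (intro sum_nonneg) (auto simp: less_eq_vec_def)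
      ultimately have "nat (\<Sum>j\<in>UNIV. x $ j - y' $ j) < nat (\<Sum>j\<in>UNIV. x $ j - y $ j)" by simp
      from less.hyps[OF this y'x] obtain n z where z: "z 0 = y'" "z n = x"
        "\<forall>k\<le>n. z k \<in> {y'..x}" "\<forall>k<n. \<exists>i. z (Suc k) = z k + axis i 1" by blast
      show ?thesis
      proof (intro exI[of _ "Suc n"] exI[of _ "case_nat y z"] conjI allI impI)
        fix k assume "k \<le> Suc n"
        then show "case_nat y z k \<in> {y..x}"
          using z(3) yy' less.prems by (cases k) (auto intro: order.trans)
      next
        fix k assume "k < Suc n"
        then show "\<exists>i. case_nat y z (Suc k) = case_nat y z k + axis i 1"
          using z by (cases k) (auto simp: y'_def)
      qed (use z in auto)
    qed
  qed
  then obtain n z where z: "z 0 = y" "z n = x" "\<forall>k\<le>n. z k \<in> {y..x}"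
    "\<forall>k<n. \<exists>i. z (Suc k) = z k + axis i 1" by blast
  have "(\<Sum>j\<in>UNIV. z k $ j) = (\<Sum>j\<in>UNIV. y $ j) + int k" if "k \<le> n" for k
    using that
  proof (induction k)
    case (Suc k)
    then obtain i where "z (Suc k) = z k + axis i 1" using z(4) by (auto simp: Suc_le_eq)
    then have "(\<Sum>j\<in>UNIV. z (Suc k) $ j) = (\<Sum>j\<in>UNIV. z k $ j) + 1" by (simp only: sum_axis)
    with Suc show ?case by simp
  qed (simp add: z(1))
  note height = this
  have "inj_on z {0..n}"
  proof (rule inj_onI)
    fix k l assume kl: "k \<in> {0..n}" "l \<in> {0..n}" and eq: "z k = z l"
    have "(\<Sum>j\<in>UNIV. y $ j) + int k = (\<Sum>j\<in>UNIV. y $ j) + int l"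
      using height[of k] height[of l] kl unfolding eq by simp
    then show "k = l" by simp
  qed
  with z show ?thesis by (intro exI[of _ n] exI[of _ z] conjI)
qed

text \<open>Unless \<open>{a..x} - {x}\<close> is filled, it has a hole, which is joined to \<open>x\<close> by an oriented path inside
  the box; the factor \<open>card {a..x}\<close> counts the possible positions of the hole.\<close>

lemma box_gap:
  "\<exists>C\<ge>1. \<forall>a x f \<zeta>. a \<le> x \<longrightarrow> resample x f = (\<lambda>_. 0) \<longrightarrow>
    avg {a..x} (\<lambda>\<eta>. (f \<eta>)\<^sup>2) \<zeta> \<le> C * real (card {a..x}) *
      ((\<Sum>z\<in>{a..x}. avg {a..x} (\<lambda>\<eta>. constraint z \<eta> * (fluct z f \<eta>)\<^sup>2) \<zeta>) +
       avg {a..x} (\<lambda>\<eta>. of_bool (\<forall>w\<in>{a..x} - {x}. \<eta> w) * (f \<eta>)\<^sup>2) \<zeta>)"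
proof -
  obtain l where l: "0 < l" "1 / 2 \<le> (1 - p ^ l)\<^sup>2 - 2 * real l * p ^ l"
    using window_length_exists by blast
  define C where "C = 4 * real l * real (l + 1) * (1 + 2 / (1 - p)) ^ l"
  have C: "1 \<le> C"
  proof -
    have "1 * 1 * 1 \<le> (4 * real l) * real (l + 1) * (1 + 2 / (1 - p)) ^ l"
      using l p_less_1 by (intro mult_mono one_le_power) auto
    then show ?thesis by (simp add: C_def)
  qed
  show ?thesis
  proof (intro exI[of _ C] conjI allI impI C)
    fix a x :: "int ^ 'd" and f \<zeta>
    assume ax: "a \<le> x" and f0: "resample x f = (\<lambda>_. 0)"
    define B where "B = {a..x}"
    define S where "S = (\<Sum>z\<in>B. avg B (\<lambda>\<eta>. constraint z \<eta> * (fluct z f \<eta>)\<^sup>2) \<zeta>)"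
    define T where "T = avg B (\<lambda>\<eta>. of_bool (\<forall>w\<in>B - {x}. \<eta> w) * (f \<eta>)\<^sup>2) \<zeta>"
    have finB: "finite B" by (simp add: B_def finite_box)
    have xB: "x \<in> B" using ax by (simp add: B_def)
    have S: "0 \<le> S" and T: "0 \<le> T"
      unfolding S_def T_def using finB by (auto intro!: sum_nonneg avg_nonneg)
    have path: "avg B (\<lambda>\<eta>. of_bool (\<not> \<eta> y) * (f \<eta>)\<^sup>2) \<zeta> \<le> C * S" if y: "y \<in> B - {x}" for y
    proof -
      have "y \<le> x" using y by (simp add: B_def)
      from oriented_path_exists[OF this] obtain n z where z: "z 0 = y" "z n = x"
        "\<forall>k\<le>n. z k \<in> {y..x}" "\<forall>k<n. \<exists>i. z (Suc k) = z k + axis i 1" "inj_on z {0..n}"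
        by (elim exE conjE)
      have zB: "z k \<in> B" if "k \<le> n" for k using z(3) that y by (auto simp: B_def)
      have n: "0 < n" using z(1,2) y by (cases n) auto
      interpret bernoulli_path p z n B f \<zeta>
        using finB zB z(5) by unfold_locales
      have "avg B (\<lambda>\<eta>. of_bool (\<not> \<eta> y) * (f \<eta>)\<^sup>2) \<zeta> \<le> C * (\<Sum>k<n. hole_energy k k)"
        using path_gap[OF l n] f0 z(1,2) by (simp add: C_def hole_def)
      \<comment> \<open>A hole at \<open>z k\<close> satisfies the constraint at
        \<open>z (Suc k)\<close>, one axis step above it. Since the path is injective, each site of
        the box is charged at most once.\<close>
      also have "(\<Sum>k<n. hole_energy k k) \<le>
          (\<Sum>k<n. avg B (\<lambda>\<eta>. constraint (z (Suc k)) \<eta> * (fluct (z (Suc k)) f \<eta>)\<^sup>2) \<zeta>)"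
        unfolding hole_energy_def
      proof (intro sum_mono avg_mono finB mult_right_mono)
        fix k \<eta> assume "k \<in> {..<n}"
        then obtain i where i: "z (Suc k) = z k + axis i 1" using z(4) by auto
        then show "hole k \<eta> \<le> constraint (z (Suc k)) \<eta>"
        proof (cases "\<eta> (z k)")
          case False
          then have "constraint (z (Suc k)) \<eta> = 1"
            unfolding constraint_def i by (intro if_P exI[of _ i]) simp
          then show ?thesis by (simp add: hole_le_1)
        qed (simp add: hole_def)
      qed simp
      also have "\<dots> = (\<Sum>w\<in>z ` Suc ` {..<n}. avg B (\<lambda>\<eta>. constraint w \<eta> * (fluct w f \<eta>)\<^sup>2) \<zeta>)"
      proof -
        have "inj_on (\<lambda>k. z (Suc k)) {..<n}"
          using inj_onD[OF z(5)] by (intro inj_onI) fastforce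
        then show ?thesis by (simp add: image_image sum.reindex)
      qed
      also have "\<dots> \<le> S"
        unfolding S_def using zB finB by (intro sum_mono2) (auto intro!: avg_nonneg)
      finally show ?thesis using C by simp
    qed
    have "avg B (\<lambda>\<eta>. (f \<eta>)\<^sup>2) \<zeta> \<le> avg B (\<lambda>\<eta>. of_bool (\<forall>w\<in>B - {x}. \<eta> w) * (f \<eta>)\<^sup>2 +
        (\<Sum>y\<in>B - {x}. of_bool (\<not> \<eta> y) * (f \<eta>)\<^sup>2)) \<zeta>"
    proof (intro avg_mono finB)
      fix \<eta>
      have "1 \<le> of_bool (\<forall>w\<in>B - {x}. \<eta> w) + (\<Sum>y\<in>B - {x}. of_bool (\<not> \<eta> y) :: real)"
      proof (cases "\<forall>w\<in>B - {x}. \<eta> w")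
        case True
        then show ?thesis by (auto intro!: sum_nonneg)
      next
        case False
        then obtain y where "y \<in> B - {x}" "\<not> \<eta> y" by blast
        then have "of_bool (\<not> \<eta> y) \<le> (\<Sum>y\<in>B - {x}. of_bool (\<not> \<eta> y) :: real)"
          using finB by (intro member_le_sum) auto
        with False \<open>\<not> \<eta> y\<close> show ?thesis by simp
      qed
      from mult_right_mono[OF this, of "(f \<eta>)\<^sup>2"]
      show "(f \<eta>)\<^sup>2 \<le> of_bool (\<forall>w\<in>B - {x}. \<eta> w) * (f \<eta>)\<^sup>2 + (\<Sum>y\<in>B - {x}. of_bool (\<not> \<eta> y) * (f \<eta>)\<^sup>2)"
        by (simp add: distrib_right sum_distrib_right)
    qed
    also have "\<dots> = T + (\<Sum>y\<in>B - {x}. avg B (\<lambda>\<eta>. of_bool (\<not> \<eta> y) * (f \<eta>)\<^sup>2) \<zeta>)"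
      by (simp only: avg_add[OF finB] avg_sum[OF finB] T_def)
    also have "\<dots> \<le> T + (\<Sum>y\<in>B - {x}. C * S)"
      by (intro add_left_mono sum_mono path)
    also have "\<dots> \<le> T + C * real (card B) * S"
      using C S card_mono[OF finB Diff_subset, of "{x}"] by (auto intro!: mult_right_mono simp: mult.left_commute[of _ C])
    also have "\<dots> \<le> C * real (card B) * (S + T)"
    proof -
      have "1 * 1 \<le> C * real (card B)"
        using C xB finB by (intro mult_mono) (auto simp: Suc_le_eq card_gt_0_iff)
      from mult_right_mono[OF this T] show ?thesis by (simp add: distrib_left)
    qed
    finally show "avg {a..x} (\<lambda>\<eta>. (f \<eta>)\<^sup>2) \<zeta> \<le> C * real (card {a..x}) *
      ((\<Sum>z\<in>{a..x}. avg {a..x} (\<lambda>\<eta>. constraint z \<eta> * (fluct z f \<eta>)\<^sup>2) \<zeta>) +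
       avg {a..x} (\<lambda>\<eta>. of_bool (\<forall>w\<in>{a..x} - {x}. \<eta> w) * (f \<eta>)\<^sup>2) \<zeta>)"
      by (simp add: B_def S_def T_def)
  qed
qed

section \<open>Euler steps of the killed dynamics\<close>

text \<open>Generator in heat-bath form: a legal ring at \<open>z\<close> replaces \<open>f\<close>
  by \<open>resample z f\<close>. Spins outside \<open>\<Lambda>\<close> are frozen, and
  \<open>b\<close> acts as a Feynman-Kac potential.\<close>

definition drift :: "(int ^ 'd::finite) set \<Rightarrow> ('d config \<Rightarrow> real) \<Rightarrow> ('d config \<Rightarrow> real) \<Rightarrow> 'd config \<Rightarrow> real" where
  "drift \<Lambda> b f = (\<lambda>\<eta>. (\<Sum>z\<in>\<Lambda>. constraint z \<eta> * (resample z f \<eta> - f \<eta>)) - b \<eta> * f \<eta>)"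

text \<open>An Euler step of length \<open>s\<close> of the dynamics restricted to \<open>\<Lambda>\<close>, killed at rate \<open>b\<close>.\<close>

definition step :: "real \<Rightarrow> (int ^ 'd::finite) set \<Rightarrow> ('d config \<Rightarrow> real) \<Rightarrow> ('d config \<Rightarrow> real) \<Rightarrow> 'd config \<Rightarrow> real" where
  "step s \<Lambda> b f = (\<lambda>\<eta>. f \<eta> + s * drift \<Lambda> b f \<eta>)"

definition spin_fluct :: "int ^ 'd::finite \<Rightarrow> 'd config \<Rightarrow> real" where
  "spin_fluct x = (\<lambda>\<eta>. of_bool (\<eta> x) - p)"

lemma abs_spin_fluct_le_1: "\<bar>spin_fluct x \<eta>\<bar> \<le> 1"
  using p_pos p_less_1 by (simp add: spin_fluct_def)

lemma resample_spin_fluct: "resample x (spin_fluct x) = (\<lambda>_. 0)"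
  by (auto simp: resample_def spin_fluct_def algebra_simps)

lemma indep_of_spin_fluct: "z \<noteq> x \<Longrightarrow> indep_of z (spin_fluct x)"
  unfolding spin_fluct_def by (intro indep_of_intros indep_of_spin)

text \<open>The total rate of legal rings and killing is at most \<open>card \<Lambda> + 1\<close>,
  so the step size condition keeps the weight of the current value nonnegative.\<close>

definition admissible :: "real \<Rightarrow> (int ^ 'd::finite) set \<Rightarrow> ('d config \<Rightarrow> real) \<Rightarrow> bool" where
  "admissible s \<Lambda> b \<longleftrightarrow> finite \<Lambda> \<and> 0 \<le> s \<and> s * (real (card \<Lambda>) + 1) \<le> 1 \<and> (\<forall>\<eta>. 0 \<le> b \<eta> \<and> b \<eta> \<le> 1)"

text \<open>Displays a step as a combination with nonnegative weights of total mass
  \<open>1 - s * b \<eta>\<close>; monotonicity, the bounds on suprema and the Jensen inequality all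
  rest on this form.\<close>

lemma step_convex:
  "step s \<Lambda> b f \<eta> = (1 - s * ((\<Sum>z\<in>\<Lambda>. constraint z \<eta>) + b \<eta>)) * f \<eta> +
     s * (\<Sum>z\<in>\<Lambda>. constraint z \<eta> * resample z f \<eta>)"
  by (simp add: step_def drift_def right_diff_distrib sum_subtractf algebra_simps flip: sum_distrib_left)

lemma step_weight_nonneg:
  assumes "admissible s \<Lambda> b"
  shows "0 \<le> 1 - s * ((\<Sum>z\<in>\<Lambda>. constraint z \<eta>) + b \<eta>)"
proof -
  have "(\<Sum>z\<in>\<Lambda>. constraint z \<eta>) \<le> (\<Sum>z\<in>\<Lambda>. 1)" by (intro sum_mono constraint_le_1)
  then have "s * ((\<Sum>z\<in>\<Lambda>. constraint z \<eta>) + b \<eta>) \<le> s * (real (card \<Lambda>) + 1)"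
    using assms by (intro mult_left_mono add_mono) (auto simp: admissible_def)
  also have "\<dots> \<le> 1" using assms by (simp add: admissible_def)
  finally show ?thesis by simp
qed

lemma step_mono:
  assumes "admissible s \<Lambda> b" "\<And>\<eta>. f \<eta> \<le> g \<eta>"
  shows "step s \<Lambda> b f \<eta> \<le> step s \<Lambda> b g \<eta>"
  unfolding step_convex using assms step_weight_nonneg[OF assms(1), of \<eta>]
  by (intro add_mono mult_left_mono sum_mono resample_mono) (auto simp: admissible_def)

lemma step_const: "step s \<Lambda> b (\<lambda>_. c) \<eta> = (1 - s * b \<eta>) * c"
  by (simp add: step_def drift_def algebra_simps)

lemma step_le_const:
  assumes "admissible s \<Lambda> b" "\<And>\<eta>. f \<eta> \<le> c"
  shows "step s \<Lambda> b f \<eta> \<le> (1 - s * b \<eta>) * c"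
  using step_mono[OF assms(1), of f "\<lambda>_. c" \<eta>] assms(2) by (simp add: step_const)

lemma step_add: "step s \<Lambda> b (\<lambda>\<eta>. f \<eta> + g \<eta>) = (\<lambda>\<eta>. step s \<Lambda> b f \<eta> + step s \<Lambda> b g \<eta>)"
  and step_diff: "step s \<Lambda> b (\<lambda>\<eta>. f \<eta> - g \<eta>) = (\<lambda>\<eta>. step s \<Lambda> b f \<eta> - step s \<Lambda> b g \<eta>)"
  and step_scale: "step s \<Lambda> b (\<lambda>\<eta>. c * f \<eta>) = (\<lambda>\<eta>. c * step s \<Lambda> b f \<eta>)"
  by (simp_all add: step_convex fun_eq_iff resample_add resample_diff resample_scale
      distrib_left right_diff_distrib sum.distrib sum_subtractf mult.left_commute[of _ c]
      flip: sum_distrib_left)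

lemma step_abs_le:
  assumes "admissible s \<Lambda> b" "\<And>\<eta>. \<bar>f \<eta>\<bar> \<le> c"
  shows "\<bar>step s \<Lambda> b f \<eta>\<bar> \<le> c"
proof -
  have c: "0 \<le> c" using assms(2)[of \<eta>] by linarith
  have sb: "0 \<le> s * b \<eta>" using assms(1) by (simp add: admissible_def)
  have "step s \<Lambda> b f \<eta> \<le> (1 - s * b \<eta>) * c"
    using assms by (intro step_le_const) (auto simp: abs_le_iff)
  moreover have "step s \<Lambda> b (\<lambda>\<eta>. (- 1) * f \<eta>) \<eta> \<le> (1 - s * b \<eta>) * c"
    using assms by (intro step_le_const) (auto simp: abs_le_iff)
  moreover have "(1 - s * b \<eta>) * c \<le> c" using c sb by (simp add: left_diff_distrib)
  ultimately show ?thesis unfolding step_scale by linarith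
qed

lemma iterate_mono:
  assumes "admissible s \<Lambda> b" "\<And>\<eta>. f \<eta> \<le> g \<eta>"
  shows "(step s \<Lambda> b ^^ n) f \<eta> \<le> (step s \<Lambda> b ^^ n) g \<eta>"
  by (induction n arbitrary: \<eta>) (simp_all add: assms step_mono)

lemma iterate_abs_le:
  assumes "admissible s \<Lambda> b" "\<And>\<eta>. \<bar>f \<eta>\<bar> \<le> c"
  shows "\<bar>(step s \<Lambda> b ^^ n) f \<eta>\<bar> \<le> c"
  by (induction n arbitrary: \<eta>) (simp_all add: assms step_abs_le)

lemma iterate_add: "(step s \<Lambda> b ^^ n) (\<lambda>\<eta>. f \<eta> + g \<eta>) = (\<lambda>\<eta>. (step s \<Lambda> b ^^ n) f \<eta> + (step s \<Lambda> b ^^ n) g \<eta>)"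
  and iterate_diff: "(step s \<Lambda> b ^^ n) (\<lambda>\<eta>. f \<eta> - g \<eta>) = (\<lambda>\<eta>. (step s \<Lambda> b ^^ n) f \<eta> - (step s \<Lambda> b ^^ n) g \<eta>)"
  and iterate_scale: "(step s \<Lambda> b ^^ n) (\<lambda>\<eta>. c * f \<eta>) = (\<lambda>\<eta>. c * (step s \<Lambda> b ^^ n) f \<eta>)"
  by (induction n) (simp_all add: step_add step_diff step_scale)

lemma step_killed: "step s \<Lambda> b f = (\<lambda>\<eta>. step s \<Lambda> (\<lambda>_. 0) f \<eta> - s * (b \<eta> * f \<eta>))"
  by (auto simp: step_def drift_def algebra_simps)

lemma admissible_unkilled: "admissible s \<Lambda> b \<Longrightarrow> admissible s \<Lambda> (\<lambda>_. 0)"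
  by (simp add: admissible_def)

text \<open>Orientation: rings at sites above \<open>y\<close> leave \<open>f\<close> unchanged, and
  the constraint at any other site cannot read a site above \<open>y\<close>.\<close>

lemma indep_of_step:
  assumes b: "indep_of w b" and f: "\<And>z. y \<le> z \<Longrightarrow> indep_of z f" and w: "y \<le> w"
  shows "indep_of w (step s \<Lambda> b f)"
proof -
  have "indep_of w (\<lambda>\<eta>. constraint z \<eta> * (resample z f \<eta> - f \<eta>))" for z
  proof (cases "y \<le> z")
    case True
    then show ?thesis using f by (simp add: resample_indep)
  next
    case False
    then have "\<not> w \<le> z" using w order.trans by blast
    then show ?thesis
      using f w by (intro indep_of_intros indep_of_resample indep_of_constraint_not_le) auto
  qed
  then have "indep_of w (\<lambda>\<eta>. \<Sum>z\<in>\<Lambda>. constraint z \<eta> * (resample z f \<eta> - f \<eta>))"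
    by (rule indep_of_sum)
  then show ?thesis
    unfolding step_def drift_def
    by (intro indep_of_add indep_of_diff indep_of_mult indep_of_const b f w)
qed

text \<open>The spin at \<open>y\<close> relaxes at rate \<open>constraint y\<close> and does not influence the spins that are not
  above \<open>y\<close>.\<close>

lemma step_spin_fluct:
  assumes "finite \<Lambda>" "y \<in> \<Lambda>" and f: "\<And>z. y \<le> z \<Longrightarrow> indep_of z f"
  shows "step s \<Lambda> (\<lambda>_. 0) (\<lambda>\<eta>. spin_fluct y \<eta> * f \<eta>) =
    (\<lambda>\<eta>. spin_fluct y \<eta> * step s \<Lambda> (constraint y) f \<eta>)"
proof
  fix \<eta>
  have "constraint z \<eta> * (resample z (\<lambda>\<eta>. spin_fluct y \<eta> * f \<eta>) \<eta> - spin_fluct y \<eta> * f \<eta>) =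
      spin_fluct y \<eta> * (constraint z \<eta> * (resample z f \<eta> - f \<eta>)) -
      (if z = y then spin_fluct y \<eta> * (constraint y \<eta> * f \<eta>) else 0)" for z
  proof (cases "z = y")
    case True
    have "resample y (\<lambda>\<eta>. f \<eta> * spin_fluct y \<eta>) = (\<lambda>\<eta>. 0)"
      using f by (simp add: resample_mult_left resample_spin_fluct)
    then show ?thesis using True f by (simp add: resample_indep mult.commute)
  next
    case False
    then have "resample z (\<lambda>\<eta>. spin_fluct y \<eta> * f \<eta>) = (\<lambda>\<eta>. spin_fluct y \<eta> * resample z f \<eta>)"
      by (intro resample_mult_left indep_of_spin_fluct)
    then show ?thesis using False by (simp add: right_diff_distrib mult.left_commute)
  qed
  then have "(\<Sum>z\<in>\<Lambda>. constraint z \<eta> * (resample z (\<lambda>\<eta>. spin_fluct y \<eta> * f \<eta>) \<eta> - spin_fluct y \<eta> * f \<eta>)) =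
      spin_fluct y \<eta> * (\<Sum>z\<in>\<Lambda>. constraint z \<eta> * (resample z f \<eta> - f \<eta>)) -
      spin_fluct y \<eta> * (constraint y \<eta> * f \<eta>)"
    using assms(1,2) by (simp only: sum_subtractf sum.delta if_True flip: sum_distrib_left)
  then show "step s \<Lambda> (\<lambda>_. 0) (\<lambda>\<eta>. spin_fluct y \<eta> * f \<eta>) \<eta> = spin_fluct y \<eta> * step s \<Lambda> (constraint y) f \<eta>"
    unfolding step_def drift_def by (simp only:) (simp add: distrib_left right_diff_distrib mult.left_commute[of s])
qed

text \<open>The constraint at \<open>y\<close> looks strictly below \<open>y\<close>, so killed
  steps preserve independence of the spins above \<open>y\<close> and the one-step identity can be
  iterated.\<close>

lemma iterate_spin_fluct:
  assumes "finite \<Lambda>" "y \<in> \<Lambda>" and f: "\<And>z. y \<le> z \<Longrightarrow> indep_of z f"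
  shows "(step s \<Lambda> (\<lambda>_. 0) ^^ n) (\<lambda>\<eta>. spin_fluct y \<eta> * f \<eta>) =
      (\<lambda>\<eta>. spin_fluct y \<eta> * (step s \<Lambda> (constraint y) ^^ n) f \<eta>)"
proof -
  have ind: "\<forall>z\<ge>y. indep_of z ((step s \<Lambda> (constraint y) ^^ n) f)" for n
  proof (induction n)
    case (Suc n)
    have "indep_of z (constraint y)" if "y \<le> z" for z
      using that by (intro indep_of_constraint_not_le) auto
    with Suc show ?case by (auto intro!: indep_of_step[where y = y])
  qed (use f in auto)
  show ?thesis
    using ind by (induction n) (simp_all add: step_spin_fluct[OF assms(1,2)])
qed

section \<open>Finite volume: filling a cone, mean-square decay, pointwise bound\<close>

definition lattice_cone :: "int ^ 'd::finite \<Rightarrow> nat \<Rightarrow> (int ^ 'd) set" where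
  "lattice_cone y M = {w. w \<le> y \<and> (\<Sum>i\<in>UNIV. y $ i - w $ i) \<le> int M}"

definition filled :: "(int ^ 'd::finite) set \<Rightarrow> 'd config \<Rightarrow> real" where
  "filled A = (\<lambda>\<eta>. of_bool (\<forall>w\<in>A. \<eta> w))"

lemma filled_antimono: "A \<subseteq> B \<Longrightarrow> filled B \<eta> \<le> filled A \<eta>"
  by (auto simp: filled_def)

text \<open>The recursive structure behind the induction on depth: a hole just below
  \<open>y\<close> is the apex of a cone with one layer less that avoids \<open>y\<close>.\<close>

lemma lattice_cone_minus_axis: "lattice_cone (y - axis i 1) M \<subseteq> lattice_cone y (Suc M) - {y}"
proof
  fix w assume w: "w \<in> lattice_cone (y - axis i 1) M"
  have "(\<Sum>j\<in>UNIV. (y - axis i 1) $ j - w $ j) = (\<Sum>j\<in>UNIV. y $ j - w $ j) - 1"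
    using sum_axis[of "y - axis i 1" i] by (simp add: sum_subtractf)
  moreover have "w \<le> y" using w minus_axis_le[of y i] by (auto simp: lattice_cone_def)
  moreover have "w \<noteq> y"
  proof
    assume "w = y"
    then have "y \<le> y - axis i 1" using w by (simp add: lattice_cone_def)
    then have "y $ i \<le> (y - axis i 1) $ i" unfolding less_eq_vec_def by blast
    then show False by (simp add: axis_def)
  qed
  ultimately show "w \<in> lattice_cone y (Suc M) - {y}" using w by (auto simp: lattice_cone_def)
qed

text \<open>If the site \<open>y\<close> is initially empty, filling the cone below \<open>y\<close> costs a factor \<open>p\<close> per layer:
  before the spin at \<open>y\<close> is first refreshed there must be a hole just below \<open>y\<close>.\<close>

lemma iterate_filled_lattice_cone:
  assumes "admissible s \<Lambda> (\<lambda>_. 0)" "lattice_cone y M \<subseteq> \<Lambda>" "\<not> \<eta> y"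
  shows "(step s \<Lambda> (\<lambda>_. 0) ^^ n) (filled (lattice_cone y M)) \<eta> \<le> p ^ Suc M"
  using assms(2,3)
proof (induction M arbitrary: y \<eta> n rule: less_induct)
  case (less M)
  define F where "F = filled (lattice_cone y M - {y})"
  define K where "K = step s \<Lambda> (\<lambda>_. 0)"
  define Q where "Q = step s \<Lambda> (constraint y)"
  have fin: "finite \<Lambda>" and s: "0 \<le> s" using assms(1) by (auto simp: admissible_def)
  have y: "y \<in> lattice_cone y M" by (simp add: lattice_cone_def)
  then have y\<Lambda>: "y \<in> \<Lambda>" using less.prems by blast
  have admQ: "admissible s \<Lambda> (constraint y)"
    using assms(1) by (auto simp: admissible_def constraint_le_1)
  have F01: "0 \<le> F \<zeta>" "F \<zeta> \<le> 1" for \<zeta> by (auto simp: F_def filled_def)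
  have indF: "indep_of z F" if "y \<le> z" for z
    unfolding F_def filled_def using that by (intro indep_of_filled) (auto simp: lattice_cone_def)
  \<comment> \<open>The spin at \<open>y\<close> is its mean \<open>p\<close> plus its centred part,
    and \<open>F\<close> does not read it.\<close>
  have split: "filled (lattice_cone y M) = (\<lambda>\<eta>. p * F \<eta> + spin_fluct y \<eta> * F \<eta>)"
    using y by (auto simp: F_def filled_def spin_fluct_def fun_eq_iff)
  \<comment> \<open>A satisfied constraint provides a hole just below \<open>y\<close>, to which the
    induction hypothesis with one layer less applies; for \<open>M = 0\<close> the trivial bound 1
    suffices.\<close>
  have below: "(K ^^ k) F \<zeta> \<le> p ^ M" if "constraint y \<zeta> = 1" for k \<zeta>
  proof (cases M)
    case 0
    have "\<bar>(K ^^ k) F \<zeta>\<bar> \<le> 1"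
      unfolding K_def using F01 by (intro iterate_abs_le assms(1)) simp
    with 0 show ?thesis by simp
  next
    case (Suc M')
    from that obtain i where i: "\<not> \<zeta> (y - axis i 1)"
      by (auto simp: constraint_def split: if_splits)
    have sub: "lattice_cone (y - axis i 1) M' \<subseteq> lattice_cone y M - {y}"
      using lattice_cone_minus_axis[of y i M'] by (simp add: Suc)
    have "(K ^^ k) F \<zeta> \<le> (K ^^ k) (filled (lattice_cone (y - axis i 1) M')) \<zeta>"
      unfolding K_def F_def by (intro iterate_mono assms(1) filled_antimono sub)
    also have "\<dots> \<le> p ^ Suc M'"
      unfolding K_def using sub less.prems i by (intro less.IH) (auto simp: Suc)
    finally show ?thesis by (simp add: Suc)
  qed
  \<comment> \<open>Duhamel comparison of the dynamics with and without killing at the first refresh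
    of \<open>y\<close>. The bound does not grow with \<open>k\<close>: the weights
    \<open>1 - s * constraint y\<close> and \<open>s * constraint y\<close> of the old error and the
    new contribution add up to one.\<close>
  have lag: "(K ^^ k) F \<zeta> - (Q ^^ k) F \<zeta> \<le> p ^ M" for k \<zeta>
  proof (induction k arbitrary: \<zeta>)
    case 0
    then show ?case using p_pos by simp
  next
    case (Suc k)
    define R where "R = (\<lambda>\<eta>. (K ^^ k) F \<eta> - (Q ^^ k) F \<eta>)"
    have "Q R = (\<lambda>\<eta>. Q ((K ^^ k) F) \<eta> - Q ((Q ^^ k) F) \<eta>)"
      unfolding R_def Q_def by (rule step_diff)
    moreover have "Q ((K ^^ k) F) = (\<lambda>\<eta>. K ((K ^^ k) F) \<eta> - s * (constraint y \<eta> * (K ^^ k) F \<eta>))"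
      unfolding Q_def K_def by (rule step_killed)
    ultimately have "(K ^^ Suc k) F \<zeta> - (Q ^^ Suc k) F \<zeta> = Q R \<zeta> + s * (constraint y \<zeta> * (K ^^ k) F \<zeta>)"
      by (simp add: fun_eq_iff)
    also have "Q R \<zeta> \<le> (1 - s * constraint y \<zeta>) * p ^ M"
      unfolding Q_def using Suc by (intro step_le_const admQ) (simp add: R_def)
    also have "constraint y \<zeta> * (K ^^ k) F \<zeta> \<le> constraint y \<zeta> * p ^ M"
      using below[of \<zeta> k] by (auto simp: constraint_def split: if_splits)
    finally show ?case using s by (simp add: mult_left_mono left_diff_distrib mult.assoc)
  qed
  have "(K ^^ n) (filled (lattice_cone y M)) \<eta> = p * (K ^^ n) F \<eta> + spin_fluct y \<eta> * (Q ^^ n) F \<eta>"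
    unfolding split K_def Q_def iterate_add iterate_scale
    by (simp add: iterate_spin_fluct[OF fin y\<Lambda> indF])
  \<comment> \<open>The hole at \<open>y\<close> makes \<open>spin_fluct y \<eta> = - p\<close>, so
    the two terms combine into the difference just estimated, with the extra factor
    \<open>p\<close>.\<close>
  also have "\<dots> = p * ((K ^^ n) F \<eta> - (Q ^^ n) F \<eta>)"
    using less.prems by (simp add: spin_fluct_def algebra_simps)
  also have "\<dots> \<le> p * p ^ M"
    using lag p_pos by (intro mult_left_mono) auto
  finally show ?case by (simp add: K_def)
qed

text \<open>The sites of \<open>\<Lambda>\<close> outside the box are harmless: their constraints do not depend on the spins in
  the box, so they act as a Markov dynamics on the spins outside, which does not increase suprema.\<close>

lemma step_L2_contraction:
  fixes \<Lambda> :: "(int ^ 'd::finite) set"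
  assumes adm: "admissible s \<Lambda> (\<lambda>_. 0)" and \<Lambda>: "\<Lambda> \<subseteq> {..x}" "{a..x} \<subseteq> \<Lambda>"
    and ax: "a \<le> x" and lam: "0 \<le> lam" "lam \<le> 1"
    and gap: "\<And>\<zeta>. lam * avg {a..x} (\<lambda>\<eta>. (f \<eta>)\<^sup>2) \<zeta> \<le>
      (\<Sum>z\<in>{a..x}. avg {a..x} (\<lambda>\<eta>. constraint z \<eta> * (fluct z f \<eta>)\<^sup>2) \<zeta>) +
       avg {a..x} (\<lambda>\<eta>. filled ({a..x} - {x}) \<eta> * (f \<eta>)\<^sup>2) \<zeta>"
    and c: "\<And>\<zeta>. avg {a..x} (\<lambda>\<eta>. (f \<eta>)\<^sup>2) \<zeta> \<le> c"
  shows "avg {a..x} (\<lambda>\<eta>. (step s \<Lambda> (filled ({a..x} - {x})) f \<eta>)\<^sup>2) \<zeta> \<le> (1 - s * lam) * c"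
proof -
  define B where "B = {a..x}"
  define b where "b = filled (B - {x})"
  define \<phi> where "\<phi> = avg B (\<lambda>\<eta>. (f \<eta>)\<^sup>2)"
  have finB: "finite B" by (simp add: B_def finite_box)
  have fin\<Lambda>: "finite \<Lambda>" and s: "0 \<le> s" using adm by (auto simp: admissible_def)
  have admb: "admissible s \<Lambda> b" using adm by (auto simp: admissible_def b_def filled_def)
  have xB: "x \<in> B" using ax by (simp add: B_def)
  \<comment> \<open>Expand the weighted variance around \<open>m\<close>. The weights have mass
    \<open>1 - s * b \<eta>\<close> rather than one, which leaves a nonnegative surplus
    \<open>s * b \<eta>\<close> times the square of \<open>m\<close>.\<close>
  have Jensen: "(step s \<Lambda> b f \<eta>)\<^sup>2 \<le> (f \<eta>)\<^sup>2 +
      s * ((\<Sum>z\<in>\<Lambda>. constraint z \<eta> * (resample z f \<eta>)\<^sup>2 - constraint z \<eta> * (f \<eta>)\<^sup>2) - b \<eta> * (f \<eta>)\<^sup>2)" for \<eta>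
  proof -
    define \<alpha> where "\<alpha> = 1 - s * ((\<Sum>z\<in>\<Lambda>. constraint z \<eta>) + b \<eta>)"
    define m where "m = step s \<Lambda> b f \<eta>"
    have \<alpha>: "0 \<le> \<alpha>" unfolding \<alpha>_def by (rule step_weight_nonneg[OF admb])
    have m: "m = \<alpha> * f \<eta> + s * (\<Sum>z\<in>\<Lambda>. constraint z \<eta> * resample z f \<eta>)"
      unfolding m_def \<alpha>_def by (rule step_convex)
    have "0 \<le> \<alpha> * (f \<eta> - m)\<^sup>2 + s * (\<Sum>z\<in>\<Lambda>. constraint z \<eta> * (resample z f \<eta> - m)\<^sup>2)"
      using \<alpha> s by (intro add_nonneg_nonneg mult_nonneg_nonneg sum_nonneg) auto
    also have "\<dots> = \<alpha> * (f \<eta>)\<^sup>2 + s * (\<Sum>z\<in>\<Lambda>. constraint z \<eta> * (resample z f \<eta>)\<^sup>2)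
        - 2 * m * (\<alpha> * f \<eta> + s * (\<Sum>z\<in>\<Lambda>. constraint z \<eta> * resample z f \<eta>))
        + m\<^sup>2 * (\<alpha> + s * (\<Sum>z\<in>\<Lambda>. constraint z \<eta>))"
      by (simp add: power2_diff distrib_left right_diff_distrib sum.distrib sum_subtractf
          sum_distrib_left algebra_simps)
    also have "\<alpha> + s * (\<Sum>z\<in>\<Lambda>. constraint z \<eta>) = 1 - s * b \<eta>"
      by (simp add: \<alpha>_def algebra_simps)
    finally have "m\<^sup>2 + s * b \<eta> * m\<^sup>2 \<le> \<alpha> * (f \<eta>)\<^sup>2 + s * (\<Sum>z\<in>\<Lambda>. constraint z \<eta> * (resample z f \<eta>)\<^sup>2)"
      unfolding m[symmetric] by (simp add: power2_eq_square algebra_simps)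
    moreover have "0 \<le> s * b \<eta> * m\<^sup>2" using s admb by (simp add: admissible_def)
    ultimately have "m\<^sup>2 \<le> \<alpha> * (f \<eta>)\<^sup>2 + s * (\<Sum>z\<in>\<Lambda>. constraint z \<eta> * (resample z f \<eta>)\<^sup>2)" by linarith
    also have "\<dots> = (f \<eta>)\<^sup>2 +
      s * ((\<Sum>z\<in>\<Lambda>. constraint z \<eta> * (resample z f \<eta>)\<^sup>2 - constraint z \<eta> * (f \<eta>)\<^sup>2) - b \<eta> * (f \<eta>)\<^sup>2)"
      by (simp add: \<alpha>_def sum_subtractf algebra_simps flip: sum_distrib_right)
    finally show ?thesis by (simp add: m_def)
  qed
  have "avg B (\<lambda>\<eta>. (step s \<Lambda> b f \<eta>)\<^sup>2) \<zeta> \<le> avg B (\<lambda>\<eta>. (f \<eta>)\<^sup>2 +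
      s * ((\<Sum>z\<in>\<Lambda>. constraint z \<eta> * (resample z f \<eta>)\<^sup>2 - constraint z \<eta> * (f \<eta>)\<^sup>2) - b \<eta> * (f \<eta>)\<^sup>2)) \<zeta>"
    by (intro avg_mono finB Jensen)
  also have "\<dots> = \<phi> \<zeta> + s * ((\<Sum>z\<in>\<Lambda>. avg B (\<lambda>\<eta>. constraint z \<eta> * (resample z f \<eta>)\<^sup>2 - constraint z \<eta> * (f \<eta>)\<^sup>2) \<zeta>)
      - avg B (\<lambda>\<eta>. b \<eta> * (f \<eta>)\<^sup>2) \<zeta>)"
    by (simp only: avg_add[OF finB] avg_scale[OF finB] avg_diff[OF finB] avg_sum[OF finB] \<phi>_def)
  also have "(\<Sum>z\<in>\<Lambda>. avg B (\<lambda>\<eta>. constraint z \<eta> * (resample z f \<eta>)\<^sup>2 - constraint z \<eta> * (f \<eta>)\<^sup>2) \<zeta>) =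
      (\<Sum>z\<in>B. avg B (\<lambda>\<eta>. constraint z \<eta> * (resample z f \<eta>)\<^sup>2 - constraint z \<eta> * (f \<eta>)\<^sup>2) \<zeta>) +
      (\<Sum>z\<in>\<Lambda> - B. avg B (\<lambda>\<eta>. constraint z \<eta> * (resample z f \<eta>)\<^sup>2 - constraint z \<eta> * (f \<eta>)\<^sup>2) \<zeta>)"
    using sum.subset_diff[OF \<Lambda>(2) fin\<Lambda>] by (simp add: B_def add.commute)
  \<comment> \<open>Inside the box the loss is exactly the Dirichlet form, because the constraint at
    \<open>z\<close> does not read \<open>z\<close>.\<close>
  also have "(\<Sum>z\<in>B. avg B (\<lambda>\<eta>. constraint z \<eta> * (resample z f \<eta>)\<^sup>2 - constraint z \<eta> * (f \<eta>)\<^sup>2) \<zeta>) =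
      (\<Sum>z\<in>B. - avg B (\<lambda>\<eta>. constraint z \<eta> * (fluct z f \<eta>)\<^sup>2) \<zeta>)"
  proof (intro sum.cong refl)
    fix z assume z: "z \<in> B"
    have "indep_of z (constraint z)" by (rule indep_of_constraint_not_le) simp
    from avg_pythagoras[OF finB z this, of f \<zeta>]
    show "avg B (\<lambda>\<eta>. constraint z \<eta> * (resample z f \<eta>)\<^sup>2 - constraint z \<eta> * (f \<eta>)\<^sup>2) \<zeta> =
        - avg B (\<lambda>\<eta>. constraint z \<eta> * (fluct z f \<eta>)\<^sup>2) \<zeta>"
      unfolding avg_diff[OF finB] by simp
  qed
  also have "(\<Sum>z\<in>\<Lambda> - B. avg B (\<lambda>\<eta>. constraint z \<eta> * (resample z f \<eta>)\<^sup>2 - constraint z \<eta> * (f \<eta>)\<^sup>2) \<zeta>) \<le>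
      (\<Sum>z\<in>\<Lambda> - B. constraint z \<zeta> * (c - \<phi> \<zeta>))"
  proof (intro sum_mono)
    fix z assume z: "z \<in> \<Lambda> - B"
    have ind: "indep_of w (constraint z)" if "w \<in> B" for w
      using that z \<Lambda> by (intro indep_of_constraint_outside_box[of w a x]) (auto simp: B_def)
    have "avg B (\<lambda>\<eta>. constraint z \<eta> * (resample z f \<eta>)\<^sup>2) \<zeta> \<le>
        avg B (\<lambda>\<eta>. constraint z \<eta> * resample z (\<lambda>\<eta>. (f \<eta>)\<^sup>2) \<eta>) \<zeta>"
    proof (intro avg_mono finB mult_left_mono)
      fix \<eta>
      show "(resample z f \<eta>)\<^sup>2 \<le> resample z (\<lambda>\<eta>. (f \<eta>)\<^sup>2) \<eta>"
        using resample_pythagoras_1[of z f \<eta>] resample_nonneg[of "\<lambda>\<eta>. (fluct z f \<eta>)\<^sup>2" z \<eta>] by simp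
    qed simp
    also have "\<dots> = constraint z \<zeta> * resample z \<phi> \<zeta>"
      by (simp only: avg_mult_left[OF finB ind] avg_resample_commute[OF finB] \<phi>_def)
    also have "resample z \<phi> \<zeta> \<le> c"
      using c by (intro resample_le_const) (simp add: \<phi>_def B_def)
    finally have "avg B (\<lambda>\<eta>. constraint z \<eta> * (resample z f \<eta>)\<^sup>2) \<zeta> \<le> constraint z \<zeta> * c"
      by (simp add: mult_left_mono)
    moreover have "avg B (\<lambda>\<eta>. constraint z \<eta> * (f \<eta>)\<^sup>2) \<zeta> = constraint z \<zeta> * \<phi> \<zeta>"
      by (simp only: avg_mult_left[OF finB ind] \<phi>_def)
    ultimately show "avg B (\<lambda>\<eta>. constraint z \<eta> * (resample z f \<eta>)\<^sup>2 - constraint z \<eta> * (f \<eta>)\<^sup>2) \<zeta> \<le>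
        constraint z \<zeta> * (c - \<phi> \<zeta>)"
      unfolding avg_diff[OF finB] by (simp add: right_diff_distrib)
  qed
  also have "(\<Sum>z\<in>\<Lambda> - B. constraint z \<zeta> * (c - \<phi> \<zeta>)) = (\<Sum>z\<in>\<Lambda> - B. constraint z \<zeta>) * (c - \<phi> \<zeta>)"
    by (simp add: sum_distrib_right)
  also have "\<dots> \<le> real (card (\<Lambda> - B)) * (c - \<phi> \<zeta>)"
  proof (intro mult_right_mono)
    have "(\<Sum>z\<in>\<Lambda> - B. constraint z \<zeta>) \<le> (\<Sum>z\<in>\<Lambda> - B. 1)" by (intro sum_mono constraint_le_1)
    then show "(\<Sum>z\<in>\<Lambda> - B. constraint z \<zeta>) \<le> real (card (\<Lambda> - B))" by simp
    show "0 \<le> c - \<phi> \<zeta>" using c[of \<zeta>] by (simp add: \<phi>_def B_def)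
  qed
  also have "(\<Sum>z\<in>B. - avg B (\<lambda>\<eta>. constraint z \<eta> * (fluct z f \<eta>)\<^sup>2) \<zeta>) + real (card (\<Lambda> - B)) * (c - \<phi> \<zeta>)
      - avg B (\<lambda>\<eta>. b \<eta> * (f \<eta>)\<^sup>2) \<zeta> \<le> real (card (\<Lambda> - B)) * (c - \<phi> \<zeta>) - lam * \<phi> \<zeta>"
    using gap[of \<zeta>] by (simp add: b_def B_def \<phi>_def sum_negf)
  also have "\<phi> \<zeta> + s * (real (card (\<Lambda> - B)) * (c - \<phi> \<zeta>) - lam * \<phi> \<zeta>) =
      (1 - s * (lam + real (card (\<Lambda> - B)))) * \<phi> \<zeta> + s * real (card (\<Lambda> - B)) * c"
    by (simp add: algebra_simps)
  \<comment> \<open>The coefficient of \<open>\<phi> \<zeta>\<close> is nonnegative by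
    \<open>lam \<le> 1\<close> and admissibility, so \<open>\<phi> \<zeta>\<close> may be replaced
    by its bound \<open>c\<close>; the terms from outside the box then cancel.\<close>
  also have "\<dots> \<le> (1 - s * (lam + real (card (\<Lambda> - B)))) * c + s * real (card (\<Lambda> - B)) * c"
  proof (intro add_right_mono mult_left_mono)
    show "\<phi> \<zeta> \<le> c" using c by (simp add: \<phi>_def B_def)
    have "s * (lam + real (card (\<Lambda> - B))) \<le> s * (1 + real (card \<Lambda>))"
      using lam s by (intro mult_left_mono add_mono) (auto intro: card_mono fin\<Lambda>)
    also have "\<dots> \<le> 1" using adm by (simp add: admissible_def add.commute)
    finally show "0 \<le> 1 - s * (lam + real (card (\<Lambda> - B)))" by simp
  qed
  also have "\<dots> = (1 - s * lam) * c" by (simp add: algebra_simps)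
  finally show ?thesis using s by (simp add: b_def B_def mult_left_mono)
qed

text \<open>Preserves the centring demanded by \<open>box_gap\<close>: constraints at sites not
  above \<open>x\<close>, and the constraint at \<open>x\<close> itself, do not read the spin at
  \<open>x\<close>, so resampling \<open>x\<close> passes through every term.\<close>

lemma resample_step:
  assumes "\<Lambda> \<subseteq> {..x}" "indep_of x b" "resample x f = (\<lambda>_. 0)"
  shows "resample x (step s \<Lambda> b f) = (\<lambda>_. 0)"
proof -
  have "resample x (\<lambda>\<eta>. constraint z \<eta> * (resample z f \<eta> - f \<eta>)) = (\<lambda>_. 0)" if "z \<in> \<Lambda>" for z
  proof -
    have "indep_of x (constraint z)"
      using that assms(1) by (intro indep_of_constraint_not_le) auto
    then show ?thesis
      by (simp add: resample_mult_left resample_diff resample_commute[of x z] assms(3))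
  qed
  moreover have "resample x (\<lambda>\<eta>. b \<eta> * f \<eta>) = (\<lambda>_. 0)"
    by (simp add: resample_mult_left assms)
  ultimately show ?thesis
    by (simp add: step_def drift_def resample_add resample_scale resample_diff resample_sum assms(3))
qed

text \<open>Duhamel: unkilled steps are exchanged for killed ones one at a time, each exchange
  costing \<open>s\<close> times the killing rate expected at that time. Only the starting point
  \<open>\<eta>\<close> matters, which is where a hole will be available.\<close>

lemma iterate_killed_difference:
  assumes adm: "admissible s \<Lambda> b" and f: "\<And>\<eta>. \<bar>f \<eta>\<bar> \<le> 1"
    and \<epsilon>: "\<And>k. (step s \<Lambda> (\<lambda>_. 0) ^^ k) b \<eta> \<le> \<epsilon>"
  shows "\<bar>(step s \<Lambda> (\<lambda>_. 0) ^^ n) f \<eta> - (step s \<Lambda> b ^^ n) f \<eta>\<bar> \<le> s * real n * \<epsilon>"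
proof -
  define K where "K = step s \<Lambda> (\<lambda>_. 0)"
  have adm0: "admissible s \<Lambda> (\<lambda>_. 0)" by (rule admissible_unkilled[OF adm])
  have s: "0 \<le> s" using adm by (simp add: admissible_def)
  \<comment> \<open>The induction needs an arbitrary number \<open>m\<close> of unkilled steps
    applied outside.\<close>
  have "\<bar>(K ^^ (m + n)) f \<eta> - (K ^^ m) ((step s \<Lambda> b ^^ n) f) \<eta>\<bar> \<le> s * real n * \<epsilon>" for m
  proof (induction n arbitrary: m)
    case (Suc n)
    define g where "g = (step s \<Lambda> b ^^ n) f"
    have g: "\<bar>g \<zeta>\<bar> \<le> 1" for \<zeta> unfolding g_def by (rule iterate_abs_le[OF adm f])
    have "(K ^^ m) ((step s \<Lambda> b ^^ Suc n) f) = (K ^^ m) (\<lambda>\<eta>. K g \<eta> - s * (b \<eta> * g \<eta>))"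
      unfolding K_def g_def by (simp add: step_killed[of s \<Lambda> b])
    also have "\<dots> = (\<lambda>\<eta>. (K ^^ m) (K g) \<eta> - s * (K ^^ m) (\<lambda>\<eta>. b \<eta> * g \<eta>) \<eta>)"
      unfolding K_def iterate_diff iterate_scale ..
    finally have 1: "(K ^^ m) ((step s \<Lambda> b ^^ Suc n) f) \<eta> =
        (K ^^ Suc m) g \<eta> - s * (K ^^ m) (\<lambda>\<eta>. b \<eta> * g \<eta>) \<eta>"
      by (simp add: funpow_swap1)
    have bg: "b \<zeta> * g \<zeta> \<le> b \<zeta>" "(- 1) * (b \<zeta> * g \<zeta>) \<le> b \<zeta>" for \<zeta>
      using g[of \<zeta>] adm mult_left_mono[of "g \<zeta>" 1 "b \<zeta>"] mult_left_mono[of "- 1" "g \<zeta>" "b \<zeta>"]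
      by (auto simp: admissible_def abs_le_iff)
    have "(K ^^ m) (\<lambda>\<eta>. b \<eta> * g \<eta>) \<eta> \<le> (K ^^ m) b \<eta>"
      unfolding K_def by (intro iterate_mono adm0 bg)
    moreover have "(K ^^ m) (\<lambda>\<eta>. (- 1) * (b \<eta> * g \<eta>)) \<eta> \<le> (K ^^ m) b \<eta>"
      unfolding K_def by (intro iterate_mono adm0 bg)
    ultimately have "\<bar>(K ^^ m) (\<lambda>\<eta>. b \<eta> * g \<eta>) \<eta>\<bar> \<le> \<epsilon>"
      using \<epsilon>[of m] unfolding K_def iterate_scale by linarith
    then have "\<bar>s * (K ^^ m) (\<lambda>\<eta>. b \<eta> * g \<eta>) \<eta>\<bar> \<le> s * \<epsilon>"
      using s by (simp add: abs_mult mult_left_mono)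
    moreover have "\<bar>(K ^^ (Suc m + n)) f \<eta> - (K ^^ Suc m) g \<eta>\<bar> \<le> s * real n * \<epsilon>"
      unfolding g_def by (rule Suc.IH)
    ultimately show ?case unfolding 1 by (simp add: algebra_simps abs_le_iff)
  qed simp
  from this[of 0] show ?thesis by (simp add: K_def)
qed

text \<open>The first term is the decay of the killed evolution, made pointwise; the second undoes
  the killing, at cost \<open>p ^ Suc M\<close> per unit time thanks to the hole at
  \<open>y\<close>. The size of \<open>\<Lambda>\<close> does not enter, so the volume can later be
  sent to infinity.\<close>

lemma finite_volume_bound:
  "\<exists>C\<ge>1. \<forall>a x (\<Lambda> :: (int ^ 'd::finite) set) s n y M \<eta>.
    admissible s \<Lambda> (\<lambda>_. 0) \<longrightarrow> \<Lambda> \<subseteq> {..x} \<longrightarrow> {a..x} \<subseteq> \<Lambda> \<longrightarrow>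
    lattice_cone y M \<subseteq> {a..x} - {x} \<longrightarrow> \<not> \<eta> y \<longrightarrow>
    \<bar>(step s \<Lambda> (\<lambda>_. 0) ^^ n) (spin_fluct x) \<eta>\<bar> \<le>
      sqrt ((1 - s / (C * real (card {a..x}))) ^ n / (min p (1 - p)) ^ card {a..x}) + s * real n * p ^ Suc M"
proof -
  obtain C where C: "C \<ge> 1" and gap: "\<forall>a (x :: int ^ 'd) f \<zeta>. a \<le> x \<longrightarrow> resample x f = (\<lambda>_. 0) \<longrightarrow>
    avg {a..x} (\<lambda>\<eta>. (f \<eta>)\<^sup>2) \<zeta> \<le> C * real (card {a..x}) *
      ((\<Sum>z\<in>{a..x}. avg {a..x} (\<lambda>\<eta>. constraint z \<eta> * (fluct z f \<eta>)\<^sup>2) \<zeta>) +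
       avg {a..x} (\<lambda>\<eta>. of_bool (\<forall>w\<in>{a..x} - {x}. \<eta> w) * (f \<eta>)\<^sup>2) \<zeta>)"
    using box_gap by (elim exE conjE)
  show ?thesis
  proof (intro exI[of _ C] conjI C allI impI)
    fix a x :: "int ^ 'd" and \<Lambda> :: "(int ^ 'd) set" and s :: real and n :: nat and y :: "int ^ 'd"
      and M :: nat and \<eta> :: "'d config"
    assume adm: "admissible s \<Lambda> (\<lambda>_. 0)" and \<Lambda>: "\<Lambda> \<subseteq> {..x}" "{a..x} \<subseteq> \<Lambda>"
      and cone: "lattice_cone y M \<subseteq> {a..x} - {x}" and y: "\<not> \<eta> y"
    define B where "B = {a..x}"
    define b where "b = filled (B - {x})"
    define lam where "lam = 1 / (C * real (card B))"
    define h where "h n = (step s \<Lambda> b ^^ n) (spin_fluct x)" for n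
    define \<mu> where "\<mu> = (min p (1 - p)) ^ card B"
    have \<mu>: "0 < \<mu>" using p_pos p_less_1 by (simp add: \<mu>_def)
    have "y \<in> lattice_cone y M" by (simp add: lattice_cone_def)
    with cone have ax: "a \<le> x" by (auto intro: order.trans)
    have finB: "finite B" by (simp add: B_def finite_box)
    have "x \<in> B" using ax by (simp add: B_def)
    with finB have "1 \<le> card B" by (simp add: Suc_le_eq card_gt_0_iff) blast
    then have "1 * 1 \<le> C * real (card B)" using C by (intro mult_mono) auto
    then have CB: "1 \<le> C * real (card B)" by simp
    have cancel: "lam * (C * real (card {a..x}) * r) = r" for r
      using \<open>1 \<le> card B\<close> C by (auto simp: lam_def B_def)
    from CB have lam: "0 \<le> lam" "lam \<le> 1" by (auto simp: lam_def)
    have admb: "admissible s \<Lambda> b" using adm by (auto simp: admissible_def b_def filled_def)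
    have s: "0 \<le> s" using adm by (simp add: admissible_def)
    have indb: "indep_of x b" unfolding b_def filled_def by (rule indep_of_filled) simp
    have h0: "resample x (h n) = (\<lambda>_. 0)" for n
      unfolding h_def by (induction n) (simp_all add: resample_spin_fluct resample_step[OF \<Lambda>(1) indb])
    have L2: "avg B (\<lambda>\<eta>. (h n \<eta>)\<^sup>2) \<zeta> \<le> (1 - s * lam) ^ n" for n \<zeta>
    proof (induction n arbitrary: \<zeta>)
      case 0
      have "(spin_fluct x \<eta>)\<^sup>2 \<le> 1" for \<eta>
        using abs_spin_fluct_le_1[of x \<eta>] by (simp add: abs_square_le_1)
      then have "avg B (\<lambda>\<eta>. (spin_fluct x \<eta>)\<^sup>2) \<zeta> \<le> avg B (\<lambda>_. 1) \<zeta>" by (intro avg_mono finB)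
      then show ?case using finB by (simp add: h_def)
    next
      case (Suc n)
      have "avg B (\<lambda>\<eta>. (step s \<Lambda> b (h n) \<eta>)\<^sup>2) \<zeta> \<le> (1 - s * lam) * (1 - s * lam) ^ n"
        unfolding B_def b_def
      proof (rule step_L2_contraction[OF adm \<Lambda> ax lam])
        fix \<zeta>
        show "avg {a..x} (\<lambda>\<eta>. (h n \<eta>)\<^sup>2) \<zeta> \<le> (1 - s * lam) ^ n"
          using Suc by (simp add: B_def)
        have "lam * avg {a..x} (\<lambda>\<eta>. (h n \<eta>)\<^sup>2) \<zeta> \<le> lam * (C * real (card {a..x}) *
            ((\<Sum>z\<in>{a..x}. avg {a..x} (\<lambda>\<eta>. constraint z \<eta> * (fluct z (h n) \<eta>)\<^sup>2) \<zeta>) +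
            avg {a..x} (\<lambda>\<eta>. filled ({a..x} - {x}) \<eta> * (h n \<eta>)\<^sup>2) \<zeta>))"
          using gap[rule_format, OF ax h0[of n], of \<zeta>] lam(1) unfolding filled_def by (rule mult_left_mono)
        then show "lam * avg {a..x} (\<lambda>\<eta>. (h n \<eta>)\<^sup>2) \<zeta> \<le>
            (\<Sum>z\<in>{a..x}. avg {a..x} (\<lambda>\<eta>. constraint z \<eta> * (fluct z (h n) \<eta>)\<^sup>2) \<zeta>) +
            avg {a..x} (\<lambda>\<eta>. filled ({a..x} - {x}) \<eta> * (h n \<eta>)\<^sup>2) \<zeta>"
          unfolding cancel .
      qed
      then show ?case by (simp add: h_def)
    qed
    \<comment> \<open>Here the mean-square bound, uniform in the outside spins, becomes a bound at
      the given configuration.\<close>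
    have "\<mu> * (h n \<eta>)\<^sup>2 \<le> avg B (\<lambda>\<eta>. (h n \<eta>)\<^sup>2) \<eta>"
      unfolding \<mu>_def using avg_lower_bound[OF finB, of "\<lambda>\<eta>. (h n \<eta>)\<^sup>2" \<eta>] by simp
    also have "\<dots> \<le> (1 - s * lam) ^ n" by (rule L2)
    finally have "(h n \<eta>)\<^sup>2 \<le> (1 - s * lam) ^ n / \<mu>" using \<mu> by (simp add: field_simps)
    then have 1: "\<bar>h n \<eta>\<bar> \<le> sqrt ((1 - s * lam) ^ n / \<mu>)" by (simp add: real_le_rsqrt)
    have "\<bar>(step s \<Lambda> (\<lambda>_. 0) ^^ n) (spin_fluct x) \<eta> - h n \<eta>\<bar> \<le> s * real n * p ^ Suc M"
      unfolding h_def
    proof (rule iterate_killed_difference[OF admb abs_spin_fluct_le_1])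
      fix k
      \<comment> \<open>Killing requires all of \<open>B - {x}\<close> to be filled, in particular
        the cone below the initial hole.\<close>
      have "(step s \<Lambda> (\<lambda>_. 0) ^^ k) b \<eta> \<le> (step s \<Lambda> (\<lambda>_. 0) ^^ k) (filled (lattice_cone y M)) \<eta>"
        unfolding b_def B_def by (intro iterate_mono adm filled_antimono cone)
      also have "\<dots> \<le> p ^ Suc M"
        using cone \<Lambda> y by (intro iterate_filled_lattice_cone adm) auto
      finally show "(step s \<Lambda> (\<lambda>_. 0) ^^ k) b \<eta> \<le> p ^ Suc M" .
    qed
    with 1 show "\<bar>(step s \<Lambda> (\<lambda>_. 0) ^^ n) (spin_fluct x) \<eta>\<bar> \<le>
      sqrt ((1 - s / (C * real (card {a..x}))) ^ n / (min p (1 - p)) ^ card {a..x}) + s * real n * p ^ Suc M"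
      by (simp add: \<mu>_def B_def lam_def)
  qed
qed

end

section \<open>Markov semigroups and functions of finitely many spins\<close>

lemma apply_bcontfun_sum: "apply_bcontfun (\<Sum>i\<in>I. F i) \<eta> = (\<Sum>i\<in>I. apply_bcontfun (F i) \<eta>)"
  by (induction I rule: infinite_finite_induct) simp_all

text \<open>Positivity applied to \<open>c - F\<close> and \<open>c + F\<close>, with constants
  preserved.\<close>

lemma markov_semigroup_abs_le:
  assumes P: "markov_semigroup P" and t: "0 \<le> t" and F: "\<And>\<eta>. \<bar>apply_bcontfun F \<eta>\<bar> \<le> c"
  shows "\<bar>apply_bcontfun (P t F) \<eta>\<bar> \<le> c"
proof -
  have lin: "linear (P t)" and one: "P t (const_bcontfun 1) = const_bcontfun 1"
    and pos: "\<And>f. (\<forall>\<eta>. 0 \<le> apply_bcontfun f \<eta>) \<Longrightarrow> (\<forall>\<eta>. 0 \<le> apply_bcontfun (P t f) \<eta>)"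
    using P t by (auto simp: markov_semigroup_def)
  have "0 \<le> apply_bcontfun (P t (c *\<^sub>R const_bcontfun 1 - F)) \<eta>"
    using F by (intro pos[rule_format]) (simp add: abs_le_iff)
  moreover have "0 \<le> apply_bcontfun (P t (c *\<^sub>R const_bcontfun 1 + F)) \<eta>"
  proof (intro pos[rule_format])
    fix \<zeta>
    show "0 \<le> apply_bcontfun (c *\<^sub>R const_bcontfun 1 + F) \<zeta>"
      using F[of \<zeta>] by (simp add: abs_le_iff)
  qed
  ultimately show ?thesis
    by (simp add: linear_diff[OF lin] linear_add[OF lin] linear_scale[OF lin] one)
qed

text \<open>Stability: the semigroup contracts suprema, so one-step errors add up without
  amplification.\<close>

lemma markov_semigroup_telescope:
  assumes P: "markov_semigroup P" and s: "0 \<le> s"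
    and F: "\<And>k. k < n \<Longrightarrow> \<forall>\<eta>. \<bar>apply_bcontfun (P s (F k)) \<eta> - apply_bcontfun (F (Suc k)) \<eta>\<bar> \<le> \<delta>"
  shows "\<bar>apply_bcontfun (P (real n * s) (F 0)) \<eta> - apply_bcontfun (F n) \<eta>\<bar> \<le> real n * \<delta>"
  using F
proof (induction n arbitrary: \<eta>)
  case 0
  then show ?case using P by (simp add: markov_semigroup_def)
next
  case (Suc n)
  have lin: "linear (P s)" using P s by (auto simp: markov_semigroup_def)
  have "P (s + real n * s) (F 0) = P s (P (real n * s) (F 0))"
    using P s by (auto simp: markov_semigroup_def)
  then have "P (real (Suc n) * s) (F 0) - F (Suc n) =
      P s (P (real n * s) (F 0) - F n) + (P s (F n) - F (Suc n))"
    by (simp add: linear_diff[OF lin] distrib_right add.commute)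
  then have "apply_bcontfun (P (real (Suc n) * s) (F 0)) \<eta> - apply_bcontfun (F (Suc n)) \<eta> =
      apply_bcontfun (P s (P (real n * s) (F 0) - F n)) \<eta> + (apply_bcontfun (P s (F n)) \<eta> - apply_bcontfun (F (Suc n)) \<eta>)"
    by (metis minus_bcontfun.rep_eq plus_bcontfun.rep_eq)
  moreover have "\<bar>apply_bcontfun (P s (P (real n * s) (F 0) - F n)) \<eta>\<bar> \<le> real n * \<delta>"
    using Suc by (intro markov_semigroup_abs_le[OF P s]) simp
  moreover have "\<bar>apply_bcontfun (P s (F n)) \<eta> - apply_bcontfun (F (Suc n)) \<eta>\<bar> \<le> \<delta>"
    using Suc.prems by simp
  ultimately show ?case by (simp add: algebra_simps)
qed

definition depends_on :: "'a set \<Rightarrow> (('a \<Rightarrow> bool) \<Rightarrow> real) \<Rightarrow> bool" where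
  "depends_on D f \<longleftrightarrow> (\<forall>\<eta> \<eta>'. (\<forall>x\<in>D. \<eta> x = \<eta>' x) \<longrightarrow> f \<eta> = f \<eta>')"

lemma depends_onD: "depends_on D f \<Longrightarrow> (\<And>x. x \<in> D \<Longrightarrow> \<eta> x = \<eta>' x) \<Longrightarrow> f \<eta> = f \<eta>'"
  by (simp add: depends_on_def)

lemma depends_on_finite: "depends_on D f \<Longrightarrow> finite D \<Longrightarrow> depends_on_finitely_many f"
  for f :: "('d::finite) config \<Rightarrow> real"
  unfolding depends_on_finitely_many_def depends_on_def by blast

lemma depends_on_indep: "depends_on D f \<Longrightarrow> z \<notin> D \<Longrightarrow> indep_of z f"
  unfolding indep_of_def by (intro allI, erule depends_onD) auto

text \<open>Indicator of a single configuration on \<open>D\<close>, coded by a set \<open>T\<close>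
  through its filled sites in \<open>D\<close>. For finite \<open>D\<close> those with
  \<open>T\<close> in \<open>Pow D\<close> span the functions of the spins in
  \<open>D\<close>.\<close>

definition pattern :: "'a set \<Rightarrow> 'a set \<Rightarrow> ('a \<Rightarrow> bool) \<Rightarrow> real" where
  "pattern D T \<eta> = of_bool (\<forall>x\<in>D. \<eta> x \<longleftrightarrow> x \<in> T)"

lemma depends_on_pattern: "depends_on D (pattern D T)"
  unfolding depends_on_def pattern_def by (intro allI impI arg_cong[where f = of_bool]) auto

lemma pattern_expansion:
  assumes "finite D" "depends_on D f"
  shows "f \<eta> = (\<Sum>T\<in>Pow D. f (\<lambda>x. x \<in> T) * pattern D T \<eta>)"
proof -
  define S where "S = {x\<in>D. \<eta> x}"
  have "(\<Sum>T\<in>Pow D. f (\<lambda>x. x \<in> T) * pattern D T \<eta>) = (\<Sum>T\<in>{S}. f (\<lambda>x. x \<in> T) * pattern D T \<eta>)"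
    using assms(1) by (intro sum.mono_neutral_right) (auto simp: S_def pattern_def)
  also have "\<dots> = f (\<lambda>x. x \<in> S)" by (auto simp: S_def pattern_def)
  also have "\<dots> = f \<eta>" by (rule depends_onD[OF assms(2)]) (simp add: S_def)
  finally show ?thesis ..
qed

lemma pattern_bcontfun:
  assumes "finite D"
  shows "pattern D T \<in> bcontfun"
proof (rule bcontfun_normI)
  have "pattern D T = (\<lambda>\<eta>. \<Prod>x\<in>D. of_bool (\<eta> x \<longleftrightarrow> x \<in> T))"
    using assms by (auto simp: pattern_def fun_eq_iff intro!: prod_zero)
  moreover have "continuous_on UNIV (\<lambda>\<eta>. \<Prod>x\<in>D. of_bool (\<eta> x \<longleftrightarrow> x \<in> T) :: real)"
  proof (intro continuous_on_prod)
    fix x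
    show "continuous_on UNIV (\<lambda>\<eta> :: 'a \<Rightarrow> bool. of_bool (\<eta> x \<longleftrightarrow> x \<in> T) :: real)"
    proof (rule continuous_on_compose2[of UNIV "\<lambda>b. of_bool (b \<longleftrightarrow> x \<in> T)"])
      show "continuous_on UNIV (\<lambda>b. of_bool (b \<longleftrightarrow> x \<in> T) :: real)"
        by (simp add: continuous_on_open_vimage open_discrete)
    qed auto
  qed
  ultimately show "continuous_on UNIV (pattern D T)" by simp
qed (auto simp: pattern_def)

definition bcont_pattern :: "'a set \<Rightarrow> 'a set \<Rightarrow> ('a \<Rightarrow> bool) \<Rightarrow>\<^sub>C real" where
  "bcont_pattern D T = Bcontfun (pattern D T)"

lemma apply_bcont_pattern: "finite D \<Longrightarrow> apply_bcontfun (bcont_pattern D T) = pattern D T"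
  by (simp add: bcont_pattern_def Bcontfun_inverse pattern_bcontfun)

lemma local_bcontfun_expansion:
  assumes "finite D" "depends_on D (apply_bcontfun F)"
  shows "F = (\<Sum>T\<in>Pow D. apply_bcontfun F (\<lambda>x. x \<in> T) *\<^sub>R bcont_pattern D T)"
  by (rule bcontfun_eqI)
    (simp add: apply_bcontfun_sum apply_bcont_pattern assms(1) flip: pattern_expansion[OF assms])

lemma local_bcontfun_exists:
  assumes "finite D" "depends_on D f"
  shows "\<exists>F. apply_bcontfun F = f"
proof
  show "apply_bcontfun (\<Sum>T\<in>Pow D. f (\<lambda>x. x \<in> T) *\<^sub>R bcont_pattern D T) = f"
    by (rule ext)
      (simp add: apply_bcontfun_sum apply_bcont_pattern assms(1) flip: pattern_expansion[OF assms])
qed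

context bernoulli_spins
begin

text \<open>The flip rate times the change under a flip is the heat-bath difference
  \<open>resample z f - f\<close>, and it vanishes at sites outside \<open>D\<close>.\<close>

lemma east_generator_local:
  assumes "finite D" "depends_on D f"
  shows "east_generator (1 - p) f \<eta> = drift D (\<lambda>_. 0) f \<eta>"
proof -
  have *: "(of_bool (\<eta> z) * (1 - p) + (1 - of_bool (\<eta> z)) * (1 - (1 - p))) * (f (flip z \<eta>) - f \<eta>) =
      resample z f \<eta> - f \<eta>" for z
  proof (cases "\<eta> z")
    case True
    then have "\<eta>(z := True) = \<eta>" by (simp add: fun_upd_idem)
    with True show ?thesis by (simp add: flip_def resample_def algebra_simps)
  next
    case False
    then have "\<eta>(z := False) = \<eta>" by (simp add: fun_upd_idem)
    with False show ?thesis by (simp add: flip_def resample_def algebra_simps)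
  qed
  have "east_generator (1 - p) f \<eta> = (\<Sum>\<^sub>\<infinity>z. constraint z \<eta> * (resample z f \<eta> - f \<eta>))"
    unfolding east_generator_def mult.assoc * ..
  also have "\<dots> = (\<Sum>\<^sub>\<infinity>z\<in>D. constraint z \<eta> * (resample z f \<eta> - f \<eta>))"
    using depends_on_indep[OF assms(2)] by (intro infsum_cong_neutral) (auto simp: resample_indep)
  finally show ?thesis using assms(1) by (simp add: drift_def)
qed

lemma drift_sum:
  "drift D b (\<lambda>\<eta>. \<Sum>i\<in>I. c i * f i \<eta>) \<eta> = (\<Sum>i\<in>I. c i * drift D b (f i) \<eta>)"
proof (induction I rule: infinite_finite_induct)
  case (insert i I)
  have "drift D b (\<lambda>\<eta>. c i * f i \<eta> + g \<eta>) \<eta> = c i * drift D b (f i) \<eta> + drift D b g \<eta>" for g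
    by (simp add: drift_def resample_add resample_scale sum.distrib sum_subtractf sum_distrib_left
        algebra_simps)
  with insert show ?case by simp
qed (simp_all add: drift_def)

text \<open>Functions of the spins in \<open>D\<close> form a finite-dimensional space, so the generator approximates
  the semigroup uniformly on its unit ball.\<close>

lemma semigroup_small_time:
  fixes P :: "real \<Rightarrow> ('d::finite config \<Rightarrow>\<^sub>C real) \<Rightarrow> ('d config \<Rightarrow>\<^sub>C real)"
  assumes P: "east_semigroup (1 - p) P" and D: "finite D" and \<epsilon>: "0 < \<epsilon>"
  shows "\<forall>\<^sub>F s in at_right 0. \<forall>F. depends_on D (apply_bcontfun F) \<longrightarrow> (\<forall>\<eta>. \<bar>apply_bcontfun F \<eta>\<bar> \<le> 1) \<longrightarrow>
    (\<forall>\<eta>. \<bar>apply_bcontfun (P s F) \<eta> - apply_bcontfun F \<eta> - s * drift D (\<lambda>_. 0) (apply_bcontfun F) \<eta>\<bar> \<le> \<epsilon> * s)"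
proof -
  \<comment> \<open>Number of basis functions: the expansion coefficients are at most 1 in modulus,
    so an error \<open>\<epsilon> / N\<close> for each pattern gives \<open>\<epsilon>\<close> in
    total.\<close>
  define N where "N = real (card (Pow D))"
  have N: "0 < N" using D by (simp add: N_def card_Pow)
  define \<Phi> where "\<Phi> = bcont_pattern D"
  have \<Phi>: "apply_bcontfun (\<Phi> T) = pattern D T" for T by (simp add: \<Phi>_def apply_bcont_pattern D)
  have mk: "markov_semigroup P" using P by (simp add: east_semigroup_def)
  have "\<exists>G. apply_bcontfun G = drift D (\<lambda>_. 0) (pattern D T) \<and> has_generator_value P (\<Phi> T) G" for T
  proof -
    have "depends_on_finitely_many (apply_bcontfun (\<Phi> T))"
      unfolding \<Phi> by (rule depends_on_finite[OF depends_on_pattern D])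
    then obtain G where "apply_bcontfun G = east_generator (1 - p) (apply_bcontfun (\<Phi> T))"
      "has_generator_value P (\<Phi> T) G" using P unfolding east_semigroup_def by blast
    then show ?thesis
      using east_generator_local[OF D depends_on_pattern] by (intro exI[of _ G]) (auto simp: \<Phi>)
  qed
  then obtain G where G: "\<And>T. apply_bcontfun (G T) = drift D (\<lambda>_. 0) (pattern D T)"
    "\<And>T. has_generator_value P (\<Phi> T) (G T)" by metis
  have "\<forall>\<^sub>F s in at_right 0. \<forall>T\<in>Pow D. dist ((P s (\<Phi> T) - \<Phi> T) /\<^sub>R s) (G T) < \<epsilon> / N"
    using D G(2) N \<epsilon> unfolding has_generator_value_def
    by (intro eventually_ball_finite ballI tendstoD) auto
  moreover have "\<forall>\<^sub>F s in at_right (0::real). 0 < s" by (rule eventually_at_right_less)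
  ultimately show ?thesis
  proof eventually_elim
    case (elim s)
    have lin: "linear (P s)" using mk elim by (auto simp: markov_semigroup_def)
    have one: "\<bar>apply_bcontfun (P s (\<Phi> T)) \<eta> - pattern D T \<eta> - s * drift D (\<lambda>_. 0) (pattern D T) \<eta>\<bar> \<le> \<epsilon> / N * s"
      if "T \<in> Pow D" for T \<eta>
    proof -
      have "dist (apply_bcontfun ((P s (\<Phi> T) - \<Phi> T) /\<^sub>R s) \<eta>) (apply_bcontfun (G T) \<eta>) \<le> \<epsilon> / N"
        using elim that by (intro order.trans[OF dist_bounded less_imp_le]) auto
      then have "\<bar>(apply_bcontfun (P s (\<Phi> T)) \<eta> - pattern D T \<eta>) / s - drift D (\<lambda>_. 0) (pattern D T) \<eta>\<bar> * s \<le> \<epsilon> / N * s"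
        using elim by (intro mult_right_mono) (auto simp: dist_real_def \<Phi> G divide_inverse mult.commute)
      also have "\<bar>(apply_bcontfun (P s (\<Phi> T)) \<eta> - pattern D T \<eta>) / s - drift D (\<lambda>_. 0) (pattern D T) \<eta>\<bar> * s =
          \<bar>((apply_bcontfun (P s (\<Phi> T)) \<eta> - pattern D T \<eta>) / s - drift D (\<lambda>_. 0) (pattern D T) \<eta>) * s\<bar>"
        using elim by (simp add: abs_mult)
      also have "((apply_bcontfun (P s (\<Phi> T)) \<eta> - pattern D T \<eta>) / s - drift D (\<lambda>_. 0) (pattern D T) \<eta>) * s =
          apply_bcontfun (P s (\<Phi> T)) \<eta> - pattern D T \<eta> - s * drift D (\<lambda>_. 0) (pattern D T) \<eta>"
        using elim by (simp add: field_simps)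
      finally show ?thesis .
    qed
    show ?case
    proof (intro allI impI)
      fix F \<eta> assume F: "depends_on D (apply_bcontfun F)" "\<forall>\<eta>. \<bar>apply_bcontfun F \<eta>\<bar> \<le> 1"
      define c where "c T = apply_bcontfun F (\<lambda>x. x \<in> T)" for T
      have c: "\<bar>c T\<bar> \<le> 1" for T using F by (simp add: c_def)
      have F1: "F = (\<Sum>T\<in>Pow D. c T *\<^sub>R \<Phi> T)"
        unfolding c_def \<Phi>_def by (rule local_bcontfun_expansion[OF D F(1)])
      have F2: "apply_bcontfun F = (\<lambda>\<eta>. \<Sum>T\<in>Pow D. c T * pattern D T \<eta>)"
        unfolding c_def using pattern_expansion[OF D F(1)] by (intro ext)
      have "apply_bcontfun (P s F) \<eta> = (\<Sum>T\<in>Pow D. c T * apply_bcontfun (P s (\<Phi> T)) \<eta>)"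
        by (subst F1) (simp add: linear_sum[OF lin] linear_scale[OF lin] apply_bcontfun_sum)
      then have "apply_bcontfun (P s F) \<eta> - apply_bcontfun F \<eta> - s * drift D (\<lambda>_. 0) (apply_bcontfun F) \<eta> =
          (\<Sum>T\<in>Pow D. c T * (apply_bcontfun (P s (\<Phi> T)) \<eta> - pattern D T \<eta> - s * drift D (\<lambda>_. 0) (pattern D T) \<eta>))"
        unfolding F2 drift_sum
        by (simp add: right_diff_distrib sum_subtractf sum_distrib_left mult.left_commute[of s])
      also have "\<bar>\<dots>\<bar> \<le> (\<Sum>T\<in>Pow D. 1 * (\<epsilon> / N * s))"
        using c one by (intro order.trans[OF sum_abs] sum_mono) (simp only: abs_mult, intro mult_mono, auto)
      also have "\<dots> = \<epsilon> * s" using N by (simp add: N_def)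
      finally show "\<bar>apply_bcontfun (P s F) \<eta> - apply_bcontfun F \<eta> - s * drift D (\<lambda>_. 0) (apply_bcontfun F) \<eta>\<bar> \<le> \<epsilon> * s" .
    qed
  qed
qed

section \<open>Finite speed of propagation and Euler approximation\<close>

text \<open>For \<open>z \<le> x\<close> this is 2 to the minus the l1 distance, so
  \<open>influence_le\<close> expresses exponentially small influence of remote spins.\<close>

definition site_weight :: "int ^ 'd::finite \<Rightarrow> int ^ 'd \<Rightarrow> real" where
  "site_weight x z = 2 powi (\<Sum>i\<in>UNIV. z $ i - x $ i)"

lemma site_weight_pos: "0 < site_weight x z"
  by (simp add: site_weight_def)

lemma site_weight_axis: "site_weight x (z + axis i 1) = 2 * site_weight x z"
proof -
  have "(\<Sum>j\<in>UNIV. (z + axis i 1) $ j - x $ j) = (\<Sum>j\<in>UNIV. z $ j - x $ j) + 1"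
    unfolding sum_subtractf sum_axis by simp
  then show ?thesis unfolding site_weight_def by (simp add: power_int_add)
qed

definition influence_le :: "real \<Rightarrow> int ^ 'd::finite \<Rightarrow> ('d config \<Rightarrow> real) \<Rightarrow> bool" where
  "influence_le c x f \<longleftrightarrow> (\<forall>z \<eta> u v. \<bar>f (\<eta>(z := u)) - f (\<eta>(z := v))\<bar> \<le> c * site_weight x z)"

lemma abs_mixture_le:
  assumes "\<bar>a\<bar> \<le> m" "\<bar>b\<bar> \<le> m"
  shows "\<bar>p * a + (1 - p) * b\<bar> \<le> m"
proof -
  have "\<bar>p * a + (1 - p) * b\<bar> \<le> p * \<bar>a\<bar> + (1 - p) * \<bar>b\<bar>"
    using p_pos p_less_1 by (intro order.trans[OF abs_triangle_ineq]) (simp add: abs_mult)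
  also have "\<dots> \<le> p * m + (1 - p) * m"
    using p_pos p_less_1 assms by (intro add_mono mult_left_mono) auto
  finally show ?thesis by (simp add: algebra_simps)
qed

lemma influence_resample:
  assumes "influence_le c x f"
  shows "\<bar>resample z f \<eta> - f \<eta>\<bar> \<le> c * site_weight x z"
proof -
  have "resample z f \<eta> - f \<eta> = p * (f (\<eta>(z := True)) - f (\<eta>(z := \<eta> z))) +
      (1 - p) * (f (\<eta>(z := False)) - f (\<eta>(z := \<eta> z)))"
    by (simp add: resample_def algebra_simps)
  then show ?thesis
    using assms by (simp only: influence_le_def abs_mixture_le)
qed

text \<open>Finite speed of propagation. The weight doubles at each upper neighbour, and changing a spin
  affects the constraints of the \<open>d\<close> upper neighbours only, so one step enlarges the constant by at
  most the factor \<open>1 + 2ds\<close>.\<close>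

lemma influence_step:
  fixes x :: "int ^ 'd::finite"
  assumes adm: "admissible s \<Lambda> (\<lambda>_. 0)" and c: "0 \<le> c" and f: "influence_le c x f"
  shows "influence_le (c * (1 + 2 * real CARD('d) * s)) x (step s \<Lambda> (\<lambda>_. 0) f)"
  unfolding influence_le_def
proof (intro allI)
  fix z :: "int ^ 'd" and \<eta> :: "'d config" and u v :: bool
  define \<eta>1 where "\<eta>1 = \<eta>(z := u)"
  define \<eta>2 where "\<eta>2 = \<eta>(z := v)"
  define m where "m = c * site_weight x z"
  have fin: "finite \<Lambda>" and s: "0 \<le> s" using adm by (auto simp: admissible_def)
  have m: "0 \<le> m" using c site_weight_pos[of x z] by (simp add: m_def)
  define \<alpha> where "\<alpha> = 1 - s * (\<Sum>w\<in>\<Lambda>. constraint w \<eta>1)"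
  have \<alpha>: "0 \<le> \<alpha>" using step_weight_nonneg[OF adm, of \<eta>1] by (simp add: \<alpha>_def)
  \<comment> \<open>Three sources of change: the function itself, its resampled values with the
    rates of \<open>\<eta>1\<close>, and the rates. Only the last enlarges the constant.\<close>
  have "step s \<Lambda> (\<lambda>_. 0) f \<eta>1 - step s \<Lambda> (\<lambda>_. 0) f \<eta>2 = \<alpha> * (f \<eta>1 - f \<eta>2) +
      s * (\<Sum>w\<in>\<Lambda>. constraint w \<eta>1 * (resample w f \<eta>1 - resample w f \<eta>2)) +
      s * (\<Sum>w\<in>\<Lambda>. (constraint w \<eta>1 - constraint w \<eta>2) * (resample w f \<eta>2 - f \<eta>2))"
    by (simp add: step_def drift_def \<alpha>_def sum_subtractf sum.distrib sum_distrib_left sum_distrib_right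
        algebra_simps)
  moreover have "\<bar>\<alpha> * (f \<eta>1 - f \<eta>2)\<bar> \<le> \<alpha> * m"
    using \<alpha> f by (simp add: abs_mult influence_le_def m_def \<eta>1_def \<eta>2_def mult_left_mono)
  moreover have "\<bar>s * (\<Sum>w\<in>\<Lambda>. constraint w \<eta>1 * (resample w f \<eta>1 - resample w f \<eta>2))\<bar> \<le>
      s * (\<Sum>w\<in>\<Lambda>. constraint w \<eta>1 * m)"
  proof -
    have *: "\<bar>resample w f \<eta>1 - resample w f \<eta>2\<bar> \<le> m" for w
    proof (cases "w = z")
      case True
      then show ?thesis using m by (simp add: resample_def \<eta>1_def \<eta>2_def)
    next
      case False
      have "resample w f \<eta>1 - resample w f \<eta>2 =
          p * (f ((\<eta>(w := True))(z := u)) - f ((\<eta>(w := True))(z := v))) +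
          (1 - p) * (f ((\<eta>(w := False))(z := u)) - f ((\<eta>(w := False))(z := v)))"
        using False by (simp add: resample_def \<eta>1_def \<eta>2_def fun_upd_twist[of z w] algebra_simps)
      then show ?thesis using f by (simp only: influence_le_def m_def abs_mixture_le)
    qed
    have "\<bar>\<Sum>w\<in>\<Lambda>. constraint w \<eta>1 * (resample w f \<eta>1 - resample w f \<eta>2)\<bar> \<le> (\<Sum>w\<in>\<Lambda>. constraint w \<eta>1 * m)"
      using * by (intro order.trans[OF sum_abs] sum_mono) (simp add: abs_mult mult_left_mono)
    then show ?thesis using s by (simp add: abs_mult mult_left_mono)
  qed
  moreover have "\<bar>s * (\<Sum>w\<in>\<Lambda>. (constraint w \<eta>1 - constraint w \<eta>2) * (resample w f \<eta>2 - f \<eta>2))\<bar> \<le>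
      s * (real CARD('d) * (2 * m))"
  proof -
    define U where "U = range (\<lambda>i. z + axis i 1)"
    have finU: "finite U" by (simp add: U_def)
    have same: "constraint w \<eta>1 = constraint w \<eta>2" if "w \<notin> U" for w
    proof -
      have "z \<noteq> w - axis i 1" for i
      proof
        assume "z = w - axis i 1"
        then have "w = z + axis i 1" by simp
        with that show False by (auto simp: U_def)
      qed
      then have "indep_of z (constraint w)" by (rule indep_of_constraint)
      then show ?thesis by (simp add: indep_of_def \<eta>1_def \<eta>2_def)
    qed
    have bound: "\<bar>(constraint w \<eta>1 - constraint w \<eta>2) * (resample w f \<eta>2 - f \<eta>2)\<bar> \<le> 1 * (2 * m)"
      if "w \<in> U" for w
    proof -
      have "c * site_weight x w = 2 * m"
        using that by (auto simp: U_def m_def site_weight_axis)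
      then have "\<bar>resample w f \<eta>2 - f \<eta>2\<bar> \<le> 2 * m" using influence_resample[OF f, of w \<eta>2] by simp
      moreover have "\<bar>constraint w \<eta>1 - constraint w \<eta>2\<bar> \<le> 1" by (auto simp: constraint_def)
      ultimately show ?thesis unfolding abs_mult by (intro mult_mono) auto
    qed
    have "\<bar>\<Sum>w\<in>\<Lambda>. (constraint w \<eta>1 - constraint w \<eta>2) * (resample w f \<eta>2 - f \<eta>2)\<bar> =
        \<bar>\<Sum>w\<in>\<Lambda> \<inter> U. (constraint w \<eta>1 - constraint w \<eta>2) * (resample w f \<eta>2 - f \<eta>2)\<bar>"
      using fin same by (intro arg_cong[where f = abs] sum.mono_neutral_right) auto
    also have "\<dots> \<le> (\<Sum>w\<in>\<Lambda> \<inter> U. 1 * (2 * m))"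
      by (intro order.trans[OF sum_abs] sum_mono bound) auto
    also have "\<dots> = real (card (\<Lambda> \<inter> U)) * (2 * m)" by simp
    also have "\<dots> \<le> real CARD('d) * (2 * m)"
    proof (intro mult_right_mono)
      have "card (\<Lambda> \<inter> U) \<le> card U" by (intro card_mono finU) auto
      also have "\<dots> \<le> CARD('d)" unfolding U_def by (rule card_image_le) simp
      finally show "real (card (\<Lambda> \<inter> U)) \<le> real CARD('d)" by simp
    qed (use m in simp)
    finally show ?thesis using s by (simp add: abs_mult mult_left_mono)
  qed
  \<comment> \<open>The first two contributions have total weight one, as \<open>\<alpha>\<close>
    was chosen with the same rates.\<close>
  moreover have "\<alpha> * m + s * (\<Sum>w\<in>\<Lambda>. constraint w \<eta>1 * m) + s * (real CARD('d) * (2 * m)) =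
      c * (1 + 2 * real CARD('d) * s) * site_weight x z"
    by (simp add: \<alpha>_def m_def algebra_simps flip: sum_distrib_left sum_distrib_right)
  ultimately show "\<bar>step s \<Lambda> (\<lambda>_. 0) f (\<eta>(z := u)) - step s \<Lambda> (\<lambda>_. 0) f (\<eta>(z := v))\<bar> \<le>
      c * (1 + 2 * real CARD('d) * s) * site_weight x z"
    unfolding \<eta>1_def[symmetric] \<eta>2_def[symmetric] by linarith
qed

lemma influence_iterate:
  fixes x :: "int ^ 'd::finite"
  assumes adm: "admissible s \<Lambda> (\<lambda>_. 0)"
  shows "influence_le ((1 + 2 * real CARD('d) * s) ^ k) x ((step s \<Lambda> (\<lambda>_. 0) ^^ k) (spin_fluct x))"
proof (induction k)
  case 0
  have "site_weight x x = 1" by (simp add: site_weight_def)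
  then show ?case
    using site_weight_pos[of x] by (auto simp: influence_le_def spin_fluct_def less_imp_le)
next
  case (Suc k)
  have "0 \<le> (1 + 2 * real CARD('d) * s) ^ k" using adm by (simp add: admissible_def)
  from influence_step[OF adm this Suc] show ?case by (simp add: mult.commute)
qed

lemma depends_on_step:
  fixes f :: "'d::finite config \<Rightarrow> real"
  assumes "depends_on D f" "\<And>z. z \<in> \<Lambda> \<Longrightarrow> depends_on D (constraint z)"
  shows "depends_on D (step s \<Lambda> (\<lambda>_. 0) f)"
  unfolding depends_on_def
proof (intro allI impI)
  fix \<eta> \<eta>' :: "'d config" assume eq: "\<forall>x\<in>D. \<eta> x = \<eta>' x"
  have "f \<eta> = f \<eta>'" using eq by (intro depends_onD[OF assms(1)]) auto
  moreover have "resample z f \<eta> = resample z f \<eta>'" for z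
  proof -
    have "f (\<eta>(z := v)) = f (\<eta>'(z := v))" for v
      using eq by (intro depends_onD[OF assms(1)]) auto
    then show ?thesis by (simp add: resample_def)
  qed
  moreover have "constraint z \<eta> = constraint z \<eta>'" if "z \<in> \<Lambda>" for z
    using eq by (intro depends_onD[OF assms(2)[OF that]]) auto
  ultimately show "step s \<Lambda> (\<lambda>_. 0) f \<eta> = step s \<Lambda> (\<lambda>_. 0) f \<eta>'"
    by (simp add: step_def drift_def)
qed

lemma power_over_exponential_tendsto:
  assumes "0 < d"
  shows "(\<lambda>R. c * real ((R + 2) ^ d) / 2 ^ (R + 1)) \<longlonglongrightarrow> 0"
proof -
  \<comment> \<open>With this \<open>r\<close>, the sequence is a constant times the
    \<open>d\<close>-th power of \<open>n * r ^ n\<close>, shifted by two.\<close>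
  define r where "r = root d (1 / 2)"
  have r: "0 < r" "r < 1" "r ^ d = 1 / 2" using assms by (auto simp: r_def)
  have "(\<lambda>n. 2 * c * (real n * r ^ n) ^ d) \<longlonglongrightarrow> 2 * c * 0 ^ d"
    using r by (intro tendsto_intros powser_times_n_limit_0) auto
  from LIMSEQ_ignore_initial_segment[OF this, of 2]
  have "(\<lambda>n. 2 * c * (real (n + 2) * r ^ (n + 2)) ^ d) \<longlonglongrightarrow> 2 * c * 0 ^ d" .
  moreover have "2 * c * (real (n + 2) * r ^ (n + 2)) ^ d = c * real ((n + 2) ^ d) / 2 ^ (n + 1)" for n
  proof -
    have "(r ^ (n + 2)) ^ d = (1 / 2) ^ (n + 2)"
      by (simp only: r(3)[symmetric] flip: power_mult) (simp only: mult.commute)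
    then show ?thesis by (simp add: power_mult_distrib power_one_over)
  qed
  ultimately show ?thesis using assms by (simp add: zero_power)
qed

text \<open>Order of choices: \<open>R\<close> first, making the truncation error small uniformly in
  the number of steps, then \<open>n\<close> large for that fixed volume, making the discretisation
  error small. \<open>R0\<close> allows asking for a volume that contains a given box.\<close>

lemma semigroup_approx:
  fixes P :: "real \<Rightarrow> ('d::finite config \<Rightarrow>\<^sub>C real) \<Rightarrow> ('d config \<Rightarrow>\<^sub>C real)"
  assumes P: "east_semigroup (1 - p) P" and t: "0 < t" and \<epsilon>: "0 < \<epsilon>"
    and G: "apply_bcontfun G = spin_fluct x"
  shows "\<exists>R\<ge>R0. \<forall>\<^sub>F n in sequentially. 0 < n \<and> admissible (t / real n) {x - vec (int R)..x} (\<lambda>_. 0) \<and>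
    (\<forall>\<eta>. \<bar>apply_bcontfun (P t G) \<eta> -
      (step (t / real n) {x - vec (int R)..x} (\<lambda>_. 0) ^^ n) (spin_fluct x) \<eta>\<bar> \<le> \<epsilon>)"
proof -
  define d where "d = CARD('d)"
  define E where "E = exp (2 * real d * t)"
  have "(\<lambda>R. (t * E) * real ((R + 2) ^ d) / 2 ^ (R + 1)) \<longlonglongrightarrow> 0"
    by (rule power_over_exponential_tendsto) (simp add: d_def)
  then have "\<forall>\<^sub>F R in sequentially. (t * E) * real ((R + 2) ^ d) / 2 ^ (R + 1) < \<epsilon> / 2"
    using \<epsilon> by (intro order_tendstoD(2)) auto
  then have "\<forall>\<^sub>F R in sequentially. (t * E) * real ((R + 2) ^ d) / 2 ^ (R + 1) < \<epsilon> / 2 \<and> R0 \<le> R"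
    using eventually_ge_at_top[of R0] by (rule eventually_conj)
  then obtain R where R: "(t * E) * real ((R + 2) ^ d) / 2 ^ (R + 1) < \<epsilon> / 2" "R0 \<le> R"
    using eventually_happens'[OF sequentially_bot] by blast
  define \<Lambda> where "\<Lambda> = {x - vec (int R)..x}"
  \<comment> \<open>One layer more than \<open>\<Lambda>\<close>, because constraints at the lower
    boundary of \<open>\<Lambda>\<close> read the spins just outside it; all Euler iterates are
    functions of the spins in \<open>D\<close>.\<close>
  define D where "D = {x - vec (int (R + 1))..x}"
  have fin: "finite \<Lambda>" "finite D" by (simp_all add: \<Lambda>_def D_def finite_box)
  have \<Lambda>D: "\<Lambda> \<subseteq> D" by (auto simp: \<Lambda>_def D_def less_eq_vec_def)
  have cardD: "card D \<le> (R + 2) ^ d"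
    unfolding D_def d_def by (rule card_box_le_power) simp
  have xD: "x \<in> D" by (simp add: D_def less_eq_vec_def)
  have conD: "depends_on D (constraint z)" if z: "z \<in> \<Lambda>" for z
  proof -
    have mem: "z - axis i 1 \<in> D" for i
    proof -
      have "x $ j - int (R + 1) \<le> (z - axis i 1) $ j" for j
      proof -
        have "x $ j - int R \<le> z $ j" using z by (simp add: \<Lambda>_def less_eq_vec_def)
        then show ?thesis by (auto simp: axis_def)
      qed
      moreover have "z - axis i 1 \<le> x" using z minus_axis_le[of z i] by (auto simp: \<Lambda>_def)
      ultimately show ?thesis by (simp add: D_def less_eq_vec_def)
    qed
    show ?thesis
      unfolding depends_on_def
    proof (intro allI impI)
      fix \<eta> \<eta>' :: "'d config" assume "\<forall>x\<in>D. \<eta> x = \<eta>' x"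
      then have "\<eta> (z - axis i 1) = \<eta>' (z - axis i 1)" for i using mem by blast
      then show "constraint z \<eta> = constraint z \<eta>'" by (simp only: constraint_def)
    qed
  qed
  have lim: "filterlim (\<lambda>n. t / real n) (at_right 0) sequentially"
  proof (rule filterlim_at_withinI)
    show "(\<lambda>n. t / real n) \<longlonglongrightarrow> 0" by (rule lim_const_over_n)
    show "\<forall>\<^sub>F n in sequentially. t / real n \<in> {0<..} - {0}"
      using eventually_gt_at_top[of "0::nat"] by eventually_elim (use t in simp)
  qed
  have "\<forall>\<^sub>F s in at_right 0. \<forall>F. depends_on D (apply_bcontfun F) \<longrightarrow> (\<forall>\<eta>. \<bar>apply_bcontfun F \<eta>\<bar> \<le> 1) \<longrightarrow>
      (\<forall>\<eta>. \<bar>apply_bcontfun (P s F) \<eta> - apply_bcontfun F \<eta> - s * drift D (\<lambda>_. 0) (apply_bcontfun F) \<eta>\<bar> \<le> \<epsilon> / (2 * t) * s)"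
    using \<epsilon> t by (intro semigroup_small_time P fin) auto
  from eventually_compose_filterlim[OF this lim]
  have small: "\<forall>\<^sub>F n in sequentially. \<forall>F. depends_on D (apply_bcontfun F) \<longrightarrow> (\<forall>\<eta>. \<bar>apply_bcontfun F \<eta>\<bar> \<le> 1) \<longrightarrow>
      (\<forall>\<eta>. \<bar>apply_bcontfun (P (t / real n) F) \<eta> - apply_bcontfun F \<eta> - t / real n * drift D (\<lambda>_. 0) (apply_bcontfun F) \<eta>\<bar>
        \<le> \<epsilon> / (2 * t) * (t / real n))" .
  obtain n0 where n0: "t * (real (card \<Lambda>) + 1) \<le> real n0" using real_arch_simple by blast
  have mk: "markov_semigroup P" using P by (simp add: east_semigroup_def)
  have "\<forall>\<^sub>F n in sequentially. 0 < n \<and> admissible (t / real n) \<Lambda> (\<lambda>_. 0) \<and>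
    (\<forall>\<eta>. \<bar>apply_bcontfun (P t G) \<eta> - (step (t / real n) \<Lambda> (\<lambda>_. 0) ^^ n) (spin_fluct x) \<eta>\<bar> \<le> \<epsilon>)"
    using small eventually_ge_at_top[of n0] eventually_gt_at_top[of "0::nat"]
  proof eventually_elim
    case (elim n)
    define s where "s = t / real n"
    have s: "0 < s" "real n * s = t" using elim t by (auto simp: s_def)
    have adm: "admissible s \<Lambda> (\<lambda>_. 0)"
      using n0 elim t fin by (simp add: admissible_def s_def field_simps)
    define f where "f k = (step s \<Lambda> (\<lambda>_. 0) ^^ k) (spin_fluct x)" for k
    have dep: "depends_on D (f k)" for k
    proof (induction k)
      case 0
      show ?case using xD by (auto simp: f_def depends_on_def spin_fluct_def)
    next
      case (Suc k)
      then show ?case using depends_on_step[OF Suc conD] by (simp add: f_def)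
    qed
    have f1: "\<bar>f k \<eta>\<bar> \<le> 1" for k \<eta>
      unfolding f_def by (rule iterate_abs_le[OF adm abs_spin_fluct_le_1])
    have "\<exists>F. apply_bcontfun F = f k" for k
      using local_bcontfun_exists[OF fin(2) dep] .
    then obtain F where F: "\<And>k. apply_bcontfun (F k) = f k" by metis
    have F0: "F 0 = G" by (rule bcontfun_eqI) (simp add: F G f_def)
    \<comment> \<open>One-step error: discretisation on \<open>D\<close>, plus replacing the drift
      on \<open>D\<close> by that on \<open>\<Lambda>\<close>. Over \<open>n\<close> steps each part
      contributes at most \<open>\<epsilon> / 2\<close>.\<close>
    define \<delta> where "\<delta> = \<epsilon> / (2 * t) * s + s * (E * real ((R + 2) ^ d) / 2 ^ (R + 1))"
    have "\<bar>apply_bcontfun (P (real n * s) (F 0)) \<eta> - apply_bcontfun (F n) \<eta>\<bar> \<le> real n * \<delta>" for \<eta>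
    proof (rule markov_semigroup_telescope[OF mk less_imp_le[OF s(1)]], intro allI)
      fix k \<eta> assume "k < n"
      have "(1 + 2 * real d * s) ^ k \<le> (exp (2 * real d * s)) ^ k"
        using s by (intro power_mono exp_ge_add_one_self) auto
      also have "\<dots> = exp (2 * real d * (real k * s))"
        by (simp add: mult_ac flip: exp_of_nat_mult)
      also have "\<dots> \<le> E"
      proof -
        have "real k * s \<le> real n * s" using \<open>k < n\<close> s by (intro mult_right_mono) auto
        then show ?thesis unfolding E_def s(2) by (simp add: mult_left_mono)
      qed
      finally have growth: "(1 + 2 * real d * s) ^ k \<le> E" .
      have "drift D (\<lambda>_. 0) (f k) \<eta> - drift \<Lambda> (\<lambda>_. 0) (f k) \<eta> =
          (\<Sum>z\<in>D - \<Lambda>. constraint z \<eta> * (resample z (f k) \<eta> - f k \<eta>))"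
        using sum.subset_diff[OF \<Lambda>D fin(2), of "\<lambda>z. constraint z \<eta> * (resample z (f k) \<eta> - f k \<eta>)"]
        by (simp add: drift_def)
      also have "\<bar>\<dots>\<bar> \<le> (\<Sum>z\<in>D - \<Lambda>. E * (1 / 2 ^ (R + 1)))"
      proof (intro order.trans[OF sum_abs] sum_mono)
        fix z assume z: "z \<in> D - \<Lambda>"
        have inf: "influence_le ((1 + 2 * real d * s) ^ k) x (f k)"
          unfolding d_def f_def by (rule influence_iterate[OF adm])
        have zx: "z $ i \<le> x $ i" for i using z by (auto simp: D_def less_eq_vec_def)
        with z obtain i where i: "z $ i < x $ i - int R"
          by (auto simp: \<Lambda>_def D_def less_eq_vec_def not_le)
        \<comment> \<open>No coordinate of \<open>z\<close> exceeds that of \<open>x\<close>, and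
          coordinate \<open>i\<close> alone falls short by at least \<open>R + 1\<close>.\<close>
        have "(\<Sum>j\<in>UNIV. z $ j - x $ j) \<le> (\<Sum>j\<in>UNIV. if j = i then - int (R + 1) else 0)"
          using zx i by (intro sum_mono) auto
        then have "(\<Sum>j\<in>UNIV. z $ j - x $ j) \<le> - int (R + 1)" by simp
        then have "site_weight x z \<le> 2 powi (- int (R + 1))"
          unfolding site_weight_def by (intro power_int_increasing) auto
        also have "\<dots> = 1 / 2 ^ (R + 1)"
          by (simp only: power_int_minus power_int_of_nat inverse_eq_divide)
        finally have w: "site_weight x z \<le> 1 / 2 ^ (R + 1)" .
        have "\<bar>constraint z \<eta> * (resample z (f k) \<eta> - f k \<eta>)\<bar> \<le> 1 * \<bar>resample z (f k) \<eta> - f k \<eta>\<bar>"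
          unfolding abs_mult by (intro mult_right_mono) (auto simp: constraint_le_1)
        also have "\<dots> \<le> (1 + 2 * real d * s) ^ k * site_weight x z"
          using influence_resample[OF inf] by simp
        also have "\<dots> \<le> E * (1 / 2 ^ (R + 1))"
          using growth w site_weight_pos[of x z] by (intro mult_mono) (auto simp: E_def)
        finally show "\<bar>constraint z \<eta> * (resample z (f k) \<eta> - f k \<eta>)\<bar> \<le> E * (1 / 2 ^ (R + 1))" .
      qed
      also have "\<dots> = real (card (D - \<Lambda>)) * (E * (1 / 2 ^ (R + 1)))" by simp
      also have "\<dots> \<le> real ((R + 2) ^ d) * (E * (1 / 2 ^ (R + 1)))"
      proof (intro mult_right_mono)
        have "card (D - \<Lambda>) \<le> card D" by (intro card_mono fin) auto
        with cardD show "real (card (D - \<Lambda>)) \<le> real ((R + 2) ^ d)"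
          by (intro of_nat_mono) (rule order.trans)
      qed (simp add: E_def)
      finally have trunc: "\<bar>drift D (\<lambda>_. 0) (f k) \<eta> - drift \<Lambda> (\<lambda>_. 0) (f k) \<eta>\<bar> \<le>
          E * real ((R + 2) ^ d) / 2 ^ (R + 1)" by (simp add: mult.commute)
      have "\<bar>s * (drift D (\<lambda>_. 0) (f k) \<eta> - drift \<Lambda> (\<lambda>_. 0) (f k) \<eta>)\<bar> \<le>
          s * (E * real ((R + 2) ^ d) / 2 ^ (R + 1))"
        using trunc s(1) by (simp only: abs_mult abs_of_pos) (intro mult_left_mono, auto)
      moreover have "\<bar>apply_bcontfun (P s (F k)) \<eta> - f k \<eta> - s * drift D (\<lambda>_. 0) (f k) \<eta>\<bar> \<le> \<epsilon> / (2 * t) * s"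
        using elim(1)[rule_format, of "F k" \<eta>] dep f1 by (simp add: F s_def)
      moreover have "f (Suc k) \<eta> = f k \<eta> + s * drift \<Lambda> (\<lambda>_. 0) (f k) \<eta>"
        by (simp add: f_def step_def)
      ultimately show "\<bar>apply_bcontfun (P s (F k)) \<eta> - apply_bcontfun (F (Suc k)) \<eta>\<bar> \<le> \<delta>"
        unfolding F \<delta>_def right_diff_distrib by linarith
    qed
    moreover have "real n * \<delta> \<le> \<epsilon>"
    proof -
      have "real n * \<delta> = \<epsilon> / (2 * t) * (real n * s) + (real n * s) * (E * real ((R + 2) ^ d) / 2 ^ (R + 1))"
        by (simp add: \<delta>_def distrib_left mult_ac)
      also have "\<dots> = \<epsilon> / 2 + (t * E) * real ((R + 2) ^ d) / 2 ^ (R + 1)"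
        unfolding s(2) using t by simp
      also have "\<dots> < \<epsilon> / 2 + \<epsilon> / 2" by (rule add_strict_left_mono[OF R(1)])
      finally show ?thesis by simp
    qed
    ultimately have "\<bar>apply_bcontfun (P t G) \<eta> - f n \<eta>\<bar> \<le> \<epsilon>" for \<eta>
      using order.trans by (fastforce simp: F F0 s(2))
    then show ?case using elim adm by (simp add: f_def s_def)
  qed
  with R(2) show ?thesis unfolding \<Lambda>_def by blast
qed

text \<open>The finite-volume bound passes to the limit since it depends on the step size only
  through \<open>s * n = t\<close> and a power of \<open>1 - s / N\<close>, which is at most
  \<open>exp (- t / N)\<close>.\<close>

lemma semigroup_bound:
  "\<exists>C\<ge>1. \<forall>(P :: real \<Rightarrow> ('d::finite config \<Rightarrow>\<^sub>C real) \<Rightarrow> ('d config \<Rightarrow>\<^sub>C real)) t a x y M \<eta> G.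
    east_semigroup (1 - p) P \<longrightarrow> 0 < t \<longrightarrow> lattice_cone y M \<subseteq> {a..x} - {x} \<longrightarrow> \<not> \<eta> y \<longrightarrow>
    apply_bcontfun G = spin_fluct x \<longrightarrow>
    \<bar>apply_bcontfun (P t G) \<eta>\<bar> \<le>
      sqrt (exp (- t / (C * real (card {a..x}))) / (min p (1 - p)) ^ card {a..x}) + t * p ^ Suc M"
proof -
  obtain C where C: "C \<ge> 1" and fv: "\<forall>a x (\<Lambda> :: (int ^ 'd) set) s n y M \<eta>.
    admissible s \<Lambda> (\<lambda>_. 0) \<longrightarrow> \<Lambda> \<subseteq> {..x} \<longrightarrow> {a..x} \<subseteq> \<Lambda> \<longrightarrow>
    lattice_cone y M \<subseteq> {a..x} - {x} \<longrightarrow> \<not> \<eta> y \<longrightarrow>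
    \<bar>(step s \<Lambda> (\<lambda>_. 0) ^^ n) (spin_fluct x) \<eta>\<bar> \<le>
      sqrt ((1 - s / (C * real (card {a..x}))) ^ n / (min p (1 - p)) ^ card {a..x}) + s * real n * p ^ Suc M"
    using finite_volume_bound by (elim exE conjE)
  show ?thesis
  proof (intro exI[of _ C] conjI C allI impI)
    fix P :: "real \<Rightarrow> ('d config \<Rightarrow>\<^sub>C real) \<Rightarrow> ('d config \<Rightarrow>\<^sub>C real)" and t :: real
      and a x y :: "int ^ 'd" and M :: nat and \<eta> :: "'d config" and G
    assume P: "east_semigroup (1 - p) P" and t: "0 < t" and cone: "lattice_cone y M \<subseteq> {a..x} - {x}"
      and y: "\<not> \<eta> y" and G: "apply_bcontfun G = spin_fluct x"
    define N where "N = C * real (card {a..x})"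
    define \<mu> where "\<mu> = (min p (1 - p)) ^ card {a..x}"
    have \<mu>: "0 < \<mu>" using p_pos p_less_1 by (simp add: \<mu>_def)
    have "y \<in> lattice_cone y M" by (simp add: lattice_cone_def)
    with cone have ax: "a \<le> x" by (auto intro: order.trans)
    then have "card {a..x} \<noteq> 0" using finite_box[of a x] by simp
    then have "1 * 1 \<le> C * real (card {a..x})" using C by (intro mult_mono) auto
    then have N: "1 \<le> N" by (simp add: N_def)
    show "\<bar>apply_bcontfun (P t G) \<eta>\<bar> \<le>
      sqrt (exp (- t / (C * real (card {a..x}))) / (min p (1 - p)) ^ card {a..x}) + t * p ^ Suc M"
    proof (rule field_le_epsilon)
      fix \<epsilon> :: real assume \<epsilon>: "0 < \<epsilon>"
      \<comment> \<open>The l1 distance from \<open>a\<close> to \<open>x\<close> as lower bound for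
        \<open>R\<close> guarantees that the truncated volume contains
        \<open>{a..x}\<close>.\<close>
      from semigroup_approx[OF P t \<epsilon> G, of "nat (\<Sum>i\<in>UNIV. x $ i - a $ i)"]
      obtain R where R: "nat (\<Sum>i\<in>UNIV. x $ i - a $ i) \<le> R" and
        ev: "\<forall>\<^sub>F n in sequentially. 0 < n \<and> admissible (t / real n) {x - vec (int R)..x} (\<lambda>_. 0) \<and>
          (\<forall>\<eta>. \<bar>apply_bcontfun (P t G) \<eta> -
          (step (t / real n) {x - vec (int R)..x} (\<lambda>_. 0) ^^ n) (spin_fluct x) \<eta>\<bar> \<le> \<epsilon>)"
        by blast
      from eventually_happens'[OF sequentially_bot ev] obtain n where n: "0 < n"
        and adm: "admissible (t / real n) {x - vec (int R)..x} (\<lambda>_. 0)"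
        and approx: "\<bar>apply_bcontfun (P t G) \<eta> -
          (step (t / real n) {x - vec (int R)..x} (\<lambda>_. 0) ^^ n) (spin_fluct x) \<eta>\<bar> \<le> \<epsilon>" by blast
      define s where "s = t / real n"
      have "x $ i - int R \<le> a $ i" for i
      proof -
        have "x $ i - a $ i \<le> (\<Sum>i\<in>UNIV. x $ i - a $ i)"
          using ax by (intro member_le_sum) (auto simp: less_eq_vec_def)
        then show ?thesis using R by linarith
      qed
      then have sub: "{a..x} \<subseteq> {x - vec (int R)..x}"
        by (auto simp: less_eq_vec_def intro: order.trans)
      have "\<bar>(step s {x - vec (int R)..x} (\<lambda>_. 0) ^^ n) (spin_fluct x) \<eta>\<bar> \<le>
          sqrt ((1 - s / N) ^ n / \<mu>) + s * real n * p ^ Suc M"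
        unfolding N_def \<mu>_def
        using adm sub cone y by (intro fv[rule_format]) (auto simp: s_def)
      also have "sqrt ((1 - s / N) ^ n / \<mu>) \<le> sqrt (exp (- t / N) / \<mu>)"
      proof -
        have s: "0 \<le> s" "s \<le> 1"
        proof -
          show "0 \<le> s" using adm by (simp add: admissible_def s_def)
          have "s * 1 \<le> s * (real (card {x - vec (int R)..x}) + 1)"
            using \<open>0 \<le> s\<close> by (intro mult_left_mono) auto
          also have "\<dots> \<le> 1" using adm by (simp add: admissible_def s_def)
          finally show "s \<le> 1" by simp
        qed
        \<comment> \<open>Makes the base nonnegative, as monotonicity of powers requires.\<close>
        have "s / N \<le> 1" using s N by (simp add: divide_le_eq)
        then have "(1 - s / N) ^ n \<le> (exp (- (s / N))) ^ n"
          using exp_ge_add_one_self[of "- (s / N)"] by (intro power_mono) auto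
        also have "\<dots> = exp (- t / N)"
          using n by (simp add: s_def flip: exp_of_nat_mult)
        finally show ?thesis using \<mu> by (intro real_sqrt_le_mono divide_right_mono) auto
      qed
      also have "s * real n = t" using n by (simp add: s_def)
      finally show "\<bar>apply_bcontfun (P t G) \<eta>\<bar> \<le>
        sqrt (exp (- t / (C * real (card {a..x}))) / (min p (1 - p)) ^ card {a..x}) + t * p ^ Suc M + \<epsilon>"
        using approx unfolding s_def N_def \<mu>_def by linarith
    qed
  qed
qed

end

section \<open>Expectations under the process and the choice of the box\<close>

lemma sigma_finite_subalgebra_past:
  assumes M: "prob_space M" and X: "\<And>u. 0 \<le> u \<Longrightarrow> X u \<in> measurable M borel"
  shows "sigma_finite_subalgebra M (past M X s)"
proof -
  interpret prob_space M by (rule M)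
  let ?G = "\<Union>u\<in>{0..s}. {X u -` B \<inter> space M | B. B \<in> sets borel}"
  have sub: "?G \<subseteq> sets M" using X by (auto intro: measurable_sets)
  have pow: "?G \<subseteq> Pow (space M)" by auto
  have "subalgebra M (past M X s)"
    unfolding subalgebra_def past_def using sets.sigma_sets_subset[OF sub] pow
    by (simp add: space_measure_of_conv sets_measure_of)
  then have "finite_measure_subalgebra M (past M X s)"
    by unfold_locales
  then show ?thesis
    by (rule finite_measure_subalgebra_is_sigma_finite[OF _ ])
qed

text \<open>The Markov property at time 0, integrated by the tower property.\<close>

lemma markov_process_expectation:
  fixes P :: "real \<Rightarrow> ('a::topological_space \<Rightarrow>\<^sub>C real) \<Rightarrow> ('a \<Rightarrow>\<^sub>C real)"
  assumes proc: "markov_process P \<nu> M X" and t: "0 \<le> t"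
  shows "(\<integral>w. apply_bcontfun F (X t w) \<partial>M) = (\<integral>\<eta>. apply_bcontfun (P t F) \<eta> \<partial>\<nu>)"
proof -
  have M: "prob_space M" and X: "\<And>u. 0 \<le> u \<Longrightarrow> X u \<in> measurable M borel"
    and init: "distr M borel (X 0) = \<nu>"
    and markov: "AE w in M. real_cond_exp M (past M X 0) (\<lambda>w. apply_bcontfun F (X (0 + t) w)) w
      = apply_bcontfun (P t F) (X 0 w)"
    using proc t unfolding markov_process_def by auto
  interpret prob_space M by (rule M)
  interpret sigma_finite_subalgebra M "past M X 0"
    by (rule sigma_finite_subalgebra_past[OF M X])
  have meas: "(\<lambda>w. apply_bcontfun H (X u w)) \<in> borel_measurable M" if "0 \<le> u" for u H
    using borel_measurable_continuous_onI[OF continuous_on_apply_bcontfun] X[OF that]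
    by (rule measurable_compose_rev)
  have int: "integrable M (\<lambda>w. apply_bcontfun F (X t w))"
    using meas[OF t] norm_bounded[of F] by (intro integrable_const_bound) auto
  have "(\<integral>w. apply_bcontfun F (X t w) \<partial>M) =
      (\<integral>w. real_cond_exp M (past M X 0) (\<lambda>w. apply_bcontfun F (X t w)) w \<partial>M)"
    by (rule real_cond_exp_int(2)[OF int, symmetric])
  also have "\<dots> = (\<integral>w. apply_bcontfun (P t F) (X 0 w) \<partial>M)"
    using markov meas[of 0] by (intro integral_cong_AE borel_measurable_cond_exp2) auto
  also have "\<dots> = (\<integral>\<eta>. apply_bcontfun (P t F) \<eta> \<partial>distr M borel (X 0))"
    using X[of 0] borel_measurable_continuous_onI[OF continuous_on_apply_bcontfun]
    by (intro integral_distr[symmetric]) auto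
  finally show ?thesis by (simp add: init)
qed

text \<open>Split according to whether \<open>D\<close> contains a hole, with the trivial bound 1 if
  it does not.\<close>

lemma integral_le_off_filled_box:
  fixes \<nu> :: "('d::finite) config measure"
  assumes \<nu>: "prob_space \<nu>" "sets \<nu> = sets borel" and D: "finite D"
    and H1: "\<And>\<eta>. \<bar>apply_bcontfun H \<eta>\<bar> \<le> 1" and c: "0 \<le> c"
    and Hc: "\<And>y \<eta>. y \<in> D \<Longrightarrow> \<not> \<eta> y \<Longrightarrow> \<bar>apply_bcontfun H \<eta>\<bar> \<le> c"
  shows "\<bar>\<integral>\<eta>. apply_bcontfun H \<eta> \<partial>\<nu>\<bar> \<le> c + measure \<nu> {\<eta>. \<forall>y\<in>D. \<eta> y}"
proof -
  interpret prob_space \<nu> by (rule \<nu>)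
  have sp: "space \<nu> = UNIV" using sets_eq_imp_space_eq[OF \<nu>(2)] by simp
  have meas: "apply_bcontfun F \<in> borel_measurable \<nu>" for F :: "'d config \<Rightarrow>\<^sub>C real"
    using borel_measurable_continuous_onI[OF continuous_on_apply_bcontfun, of F]
    by (simp add: measurable_cong_sets[OF \<nu>(2) refl])
  have int: "integrable \<nu> (apply_bcontfun F)" for F :: "'d config \<Rightarrow>\<^sub>C real"
    using meas norm_bounded[of F] by (intro integrable_const_bound) auto
  \<comment> \<open>Identifying the filled event with a continuous function yields its measurability
    and integrability.\<close>
  have pat: "pattern D UNIV = indicator {\<eta>. \<forall>y\<in>D. \<eta> y}"
    by (auto simp: pattern_def indicator_def fun_eq_iff)
  have int_pat: "integrable \<nu> (indicator {\<eta>. \<forall>y\<in>D. \<eta> y} :: _ \<Rightarrow> real)"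
    using int[of "bcont_pattern D UNIV"] by (simp add: apply_bcont_pattern[OF D] pat)
  have "\<bar>\<integral>\<eta>. apply_bcontfun H \<eta> \<partial>\<nu>\<bar> \<le> (\<integral>\<eta>. \<bar>apply_bcontfun H \<eta>\<bar> \<partial>\<nu>)"
    by (rule integral_abs_bound)
  also have "\<dots> \<le> (\<integral>\<eta>. c + indicator {\<eta>. \<forall>y\<in>D. \<eta> y} \<eta> \<partial>\<nu>)"
  proof (rule integral_mono)
    fix \<eta>
    show "\<bar>apply_bcontfun H \<eta>\<bar> \<le> c + indicator {\<eta>. \<forall>y\<in>D. \<eta> y} \<eta>"
    proof (cases "\<forall>y\<in>D. \<eta> y")
      case True
      then show ?thesis using H1[of \<eta>] c by simp
    next
      case False
      then show ?thesis using Hc by auto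
    qed
  qed (use int int_pat in auto)
  also have "\<dots> = c + measure \<nu> {\<eta>. \<forall>y\<in>D. \<eta> y}"
    using int_pat prob_space by (simp add: sp)
  finally show ?thesis .
qed

context bernoulli_spins
begin

text \<open>Three error terms: decay in the box, undoing the killing, and absence of an initial hole
  near \<open>x\<close>. The trivial bound 1 is recorded as well, for times too short for a
  box.\<close>

lemma process_bound:
  "\<exists>C\<ge>1. \<forall>(\<nu> :: 'd::finite config measure) (M :: 'w measure) X m t x L.
    prob_space \<nu> \<longrightarrow> sets \<nu> = sets borel \<longrightarrow> exp_decaying_filled_boxes m \<nu> \<longrightarrow>
    east_like_process (1 - p) \<nu> M X \<longrightarrow> 0 < t \<longrightarrow> 1 \<le> L \<longrightarrow>
    \<bar>prob_space.expectation M (\<lambda>w. of_bool (X t w x)) - p\<bar> \<le> 1 \<and>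
    \<bar>prob_space.expectation M (\<lambda>w. of_bool (X t w x)) - p\<bar> \<le>
      sqrt (exp (- t / (C * real ((2 * L + 1) ^ CARD('d)))) / (min p (1 - p)) ^ ((2 * L + 1) ^ CARD('d))) +
      t * p ^ Suc L + exp (- m * real L)"
proof -
  obtain C where C: "C \<ge> 1" and sb: "\<forall>(P :: real \<Rightarrow> ('d config \<Rightarrow>\<^sub>C real) \<Rightarrow> ('d config \<Rightarrow>\<^sub>C real)) t a x y M \<eta> G.
    east_semigroup (1 - p) P \<longrightarrow> 0 < t \<longrightarrow> lattice_cone y M \<subseteq> {a..x} - {x} \<longrightarrow> \<not> \<eta> y \<longrightarrow>
    apply_bcontfun G = spin_fluct x \<longrightarrow>
    \<bar>apply_bcontfun (P t G) \<eta>\<bar> \<le>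
      sqrt (exp (- t / (C * real (card {a..x}))) / (min p (1 - p)) ^ card {a..x}) + t * p ^ Suc M"
    using semigroup_bound by (elim exE conjE)
  show ?thesis
  proof (intro exI[of _ C] conjI[OF C] allI impI)
    fix \<nu> :: "'d config measure" and M :: "'w measure" and X and m t :: real and x :: "int ^ 'd" and L :: nat
    assume \<nu>: "prob_space \<nu>" "sets \<nu> = sets borel" and box: "exp_decaying_filled_boxes m \<nu>"
      and proc: "east_like_process (1 - p) \<nu> M X" and t: "0 < t" and L: "1 \<le> L"
    obtain P where P: "east_semigroup (1 - p) P" and mp: "markov_process P \<nu> M X"
      using proc by (auto simp: east_like_process_def)
    have mk: "markov_semigroup P" using P by (simp add: east_semigroup_def)
    have M: "prob_space M" and X: "X t \<in> measurable M borel"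
      using mp t by (auto simp: markov_process_def)
    interpret M: prob_space M by (rule M)
    have "depends_on {x} (spin_fluct x)" by (auto simp: depends_on_def spin_fluct_def)
    from local_bcontfun_exists[OF _ this] obtain G where G: "apply_bcontfun G = spin_fluct x" by auto
    have G1: "\<bar>apply_bcontfun G \<eta>\<bar> \<le> 1" for \<eta> by (simp add: G abs_spin_fluct_le_1)
    have "(\<lambda>w. apply_bcontfun G (X t w)) \<in> borel_measurable M"
      using borel_measurable_continuous_onI[OF continuous_on_apply_bcontfun] X
      by (rule measurable_compose_rev)
    then have int: "integrable M (\<lambda>w. apply_bcontfun G (X t w))"
      using G1 by (intro M.integrable_const_bound) auto
    have "(\<integral>w. apply_bcontfun G (X t w) + p \<partial>M) = (\<integral>w. apply_bcontfun G (X t w) \<partial>M) + p"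
      using int by (simp add: M.prob_space)
    then have E: "M.expectation (\<lambda>w. of_bool (X t w x)) - p = (\<integral>\<eta>. apply_bcontfun (P t G) \<eta> \<partial>\<nu>)"
      using markov_process_expectation[OF mp less_imp_le[OF t], of G] by (simp add: G spin_fluct_def)
    define a where "a = x - vec (2 * int L)"
    \<comment> \<open>Holes are sought at coordinate distance between 1 and \<open>L\<close> below
      \<open>x\<close>, so that the cone of depth \<open>L\<close> below any of them stays inside
      \<open>{a..x}\<close> and avoids \<open>x\<close>.\<close>
    define D where "D = lattice_box (x - vec (int L)) L"
    define N where "N = (2 * L + 1) ^ CARD('d)"
    define \<mu> where "\<mu> = min p (1 - p)"
    have \<mu>: "0 < \<mu>" "\<mu> \<le> 1" using p_pos p_less_1 by (auto simp: \<mu>_def)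
    have ax: "a \<le> x" by (simp add: a_def less_eq_vec_def)
    have "D = {x - vec (int L)..x - vec 1}"
      by (auto simp: D_def lattice_box_def less_eq_vec_def)
    then have finD: "finite D" by (simp add: finite_box)
    define c where "c = sqrt (exp (- t / (C * real N)) / \<mu> ^ N) + t * p ^ Suc L"
    have c: "0 \<le> c" using t p_pos \<mu> by (simp add: c_def)
    have cardB: "card {a..x} \<le> N"
      unfolding N_def by (rule card_box_le_power) (simp add: a_def)
    have cardB0: "0 < card {a..x}" using finite_box[of a x] ax by (simp add: card_gt_0_iff)
    have "\<bar>apply_bcontfun (P t G) \<eta>\<bar> \<le> c" if y: "y \<in> D" "\<not> \<eta> y" for y \<eta>
    proof -
      have yx: "x $ i - int L \<le> y $ i" "y $ i \<le> x $ i - 1" for i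
        using y(1) by (auto simp: D_def lattice_box_def)
      have "lattice_cone y L \<subseteq> {a..x} - {x}"
      proof
        fix w assume w: "w \<in> lattice_cone y L"
        have wy: "w $ i \<le> y $ i" for i using w by (auto simp: lattice_cone_def less_eq_vec_def)
        have "y $ i - w $ i \<le> (\<Sum>i\<in>UNIV. y $ i - w $ i)" for i
          using wy by (intro member_le_sum) auto
        then have wL: "y $ i - w $ i \<le> int L" for i
          using w by (auto simp: lattice_cone_def intro: order.trans)
        have "a $ i \<le> w $ i" for i using yx(1)[of i] wL[of i] by (simp add: a_def)
        moreover have "w $ i < x $ i" for i using yx(2)[of i] wy[of i] by linarith
        ultimately show "w \<in> {a..x} - {x}"
          by (auto simp: less_eq_vec_def less_imp_le)
      qed
      then have "\<bar>apply_bcontfun (P t G) \<eta>\<bar> \<le>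
          sqrt (exp (- t / (C * real (card {a..x}))) / \<mu> ^ card {a..x}) + t * p ^ Suc L"
        unfolding \<mu>_def by (rule sb[rule_format, OF P t _ _ G]) (rule y(2))
      \<comment> \<open>The estimate worsens as the volume grows, so an upper bound for the
        cardinality suffices.\<close>
      also have "sqrt (exp (- t / (C * real (card {a..x}))) / \<mu> ^ card {a..x}) \<le>
          sqrt (exp (- t / (C * real N)) / \<mu> ^ N)"
      proof (intro real_sqrt_le_mono frac_le)
        have "t / (C * real N) \<le> t / (C * real (card {a..x}))"
          using t C cardB cardB0 by (intro divide_left_mono mult_left_mono mult_pos_pos) auto
        then show "exp (- t / (C * real (card {a..x}))) \<le> exp (- t / (C * real N))" by simp
        show "\<mu> ^ N \<le> \<mu> ^ card {a..x}" using \<mu> cardB by (intro power_decreasing) auto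
      qed (use \<mu> in auto)
      finally show ?thesis by (simp add: c_def)
    qed
    moreover have P1: "\<bar>apply_bcontfun (P t G) \<eta>\<bar> \<le> 1" for \<eta>
      by (rule markov_semigroup_abs_le[OF mk less_imp_le[OF t] G1])
    ultimately have "\<bar>\<integral>\<eta>. apply_bcontfun (P t G) \<eta> \<partial>\<nu>\<bar> \<le> c + measure \<nu> {\<eta>. \<forall>y\<in>D. \<eta> y}"
      using c by (intro integral_le_off_filled_box[OF \<nu> finD]) auto
    also have "measure \<nu> {\<eta>. \<forall>y\<in>D. \<eta> y} \<le> exp (- m * real L)"
      using box L by (auto simp: exp_decaying_filled_boxes_def D_def)
    finally have "\<bar>M.expectation (\<lambda>w. of_bool (X t w x)) - p\<bar> \<le> c + exp (- m * real L)"
      by (simp add: E)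
    moreover have "\<bar>M.expectation (\<lambda>w. of_bool (X t w x)) - p\<bar> \<le> 1"
    proof -
      \<comment> \<open>The case of the empty set \<open>D\<close>, in which the filled event is
        everything.\<close>
      have "\<bar>\<integral>\<eta>. apply_bcontfun (P t G) \<eta> \<partial>\<nu>\<bar> \<le> 0 + measure \<nu> {\<eta>. \<forall>y\<in>{}. \<eta> y}"
        using P1 by (intro integral_le_off_filled_box[OF \<nu>]) auto
      also have "\<dots> \<le> 1" using prob_space.prob_le_1[OF \<nu>(1)] by simp
      finally show ?thesis by (simp add: E)
    qed
    ultimately show "\<bar>M.expectation (\<lambda>w. of_bool (X t w x)) - p\<bar> \<le> 1 \<and>
      \<bar>M.expectation (\<lambda>w. of_bool (X t w x)) - p\<bar> \<le>
      sqrt (exp (- t / (C * real ((2 * L + 1) ^ CARD('d)))) / (min p (1 - p)) ^ ((2 * L + 1) ^ CARD('d))) +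
      t * p ^ Suc L + exp (- m * real L)"
      by (simp add: c_def N_def \<mu>_def)
  qed
qed

end

text \<open>The bound is used with boxes of side of order \<open>L = \<epsilon> t\<^sup>1\<^sup>/\<^sup>(\<^sup>2\<^sup>d\<^sup>)\<close>: their volume \<open>N\<close> is a
  small multiple of the square root of \<open>t\<close>, so that \<open>t / N\<close> dominates \<open>N\<close>. The first alternative
  of the disjunction covers the times too small for \<open>L \<ge> 1\<close>.\<close>

lemma stretched_exponential_bound:
  fixes C p \<mu> m :: real and d :: nat
  assumes C: "1 \<le> C" and p: "0 < p" "p < 1" and \<mu>: "0 < \<mu>" "\<mu> \<le> 1" and m: "0 < m" and d: "0 < d"
  shows "\<exists>lam>0. \<exists>K>0. \<forall>t>0. 1 \<le> K * exp (- lam * t powr (1 / (2 * real d))) \<or>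
    (\<exists>L\<ge>1. sqrt (exp (- t / (C * real ((2 * L + 1) ^ d))) / \<mu> ^ ((2 * L + 1) ^ d)) +
      t * p ^ Suc L + exp (- m * real L) \<le> K * exp (- lam * t powr (1 / (2 * real d))))"
proof -
  define \<kappa> where "\<kappa> = - ln \<mu>"
  define k where "k = - ln p"
  \<comment> \<open>Chosen so that \<open>N \<le> A * T\<close>, with \<open>T\<close> the square
    root of \<open>t\<close>, gives \<open>t / (C * N) \<ge> 2 * (1 + \<kappa>) * T\<close>: this
    outweighs the volume loss \<open>N * \<kappa> \<le> T * \<kappa>\<close> and leaves at least
    \<open>2 * T\<close>.\<close>
  define A where "A = 1 / (2 * C * (1 + \<kappa>))"
  \<comment> \<open>The 3 comes from \<open>2 * L + 1 \<le> 3 * L\<close>, valid for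
    \<open>L \<ge> 1\<close>.\<close>
  define \<epsilon> where "\<epsilon> = A / 3"
  \<comment> \<open>One entry for each of the three error terms. In the second, half of the exponent
    is spent on absorbing the prefactor \<open>t\<close>; in the third, the half comes from rounding
    \<open>L\<close> down.\<close>
  define lam where "lam = min 1 (min (\<epsilon> * k / 2) (m * \<epsilon> / 2))"
  define n where "n = 2 * d"
  \<comment> \<open>Constant with \<open>t \<le> K0 * exp (\<epsilon> * k / 2 * u)\<close>, where
    \<open>t = u ^ n\<close>: the exponential dominates its \<open>n\<close>-th order
    approximation.\<close>
  define K0 where "K0 = (real n / (\<epsilon> * k / 2)) ^ n"
  define K where "K = 2 + K0 + exp (lam / \<epsilon>)"
  have \<kappa>: "0 \<le> \<kappa>" using \<mu> by (simp add: \<kappa>_def)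
  have k: "0 < k" using p by (simp add: k_def)
  have den: "1 \<le> 2 * C * (1 + \<kappa>)"
  proof -
    have "1 * 1 \<le> (2 * C) * (1 + \<kappa>)" using C \<kappa> by (intro mult_mono) auto
    then show ?thesis by simp
  qed
  then have A: "0 < A" "A \<le> 1" by (auto simp: A_def)
  have CA: "1 / (C * A) = 2 * (1 + \<kappa>)" using C \<kappa> by (simp add: A_def)
  have \<epsilon>: "0 < \<epsilon>" "\<epsilon> \<le> 1" using A by (auto simp: \<epsilon>_def)
  have lam: "0 < lam" "lam \<le> 1" "lam \<le> \<epsilon> * k / 2" "lam \<le> m * \<epsilon> / 2"
    using k \<epsilon> m by (auto simp: lam_def)
  have K0: "0 \<le> K0" using k \<epsilon> by (simp add: K0_def)
  have K: "0 < K" using K0 by (simp add: K_def add_pos_nonneg)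
  show ?thesis
  proof (rule exI[of _ lam], intro conjI[OF lam(1)], rule exI[of _ K], intro conjI[OF K] allI impI)
    fix t :: real assume t: "0 < t"
    define u where "u = t powr (1 / (2 * real d))"
    have u: "0 < u" using t by (simp add: u_def)
    have un: "u ^ n = t"
      using t d by (simp add: u_def n_def powr_powr flip: powr_realpow)
    show "1 \<le> K * exp (- lam * t powr (1 / (2 * real d))) \<or>
      (\<exists>L\<ge>1. sqrt (exp (- t / (C * real ((2 * L + 1) ^ d))) / \<mu> ^ ((2 * L + 1) ^ d)) +
      t * p ^ Suc L + exp (- m * real L) \<le> K * exp (- lam * t powr (1 / (2 * real d))))"
      unfolding u_def[symmetric]
    proof (cases "\<epsilon> * u < 1")
      case True
      have "lam * u \<le> lam / \<epsilon>" using True \<epsilon> lam by (simp add: field_simps)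
      then have "1 \<le> exp (lam / \<epsilon>) * exp (- lam * u)" by (simp flip: exp_add)
      also have "\<dots> \<le> K * exp (- lam * u)" using K0 by (intro mult_right_mono) (auto simp: K_def)
      finally show "1 \<le> K * exp (- lam * u) \<or> (\<exists>L\<ge>1.
        sqrt (exp (- t / (C * real ((2 * L + 1) ^ d))) / \<mu> ^ ((2 * L + 1) ^ d)) +
        t * p ^ Suc L + exp (- m * real L) \<le> K * exp (- lam * u))" ..
    next
      case False
      define L where "L = nat \<lfloor>\<epsilon> * u\<rfloor>"
      have L: "1 \<le> L" "real L \<le> \<epsilon> * u" "\<epsilon> * u \<le> real (Suc L)"
        using False by (auto simp: L_def le_nat_iff le_floor_iff) linarith+
      then have L2: "\<epsilon> * u / 2 \<le> real L" by simp
      have "1 * u \<ge> \<epsilon> * u" using \<epsilon> u by (intro mult_right_mono) auto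
      with False have u1: "1 \<le> u" by simp
      define N where "N = (2 * L + 1) ^ d"
      define T where "T = u ^ d"
      have T: "0 < T" "u \<le> T" "t = T * T"
        using u u1 d un power_increasing[of 1 d u] by (auto simp: T_def n_def mult_2 power_add)
      have N0: "0 < N" by (simp add: N_def)
      have NA: "real N \<le> A * T"
      proof -
        have "real N \<le> (3 * (\<epsilon> * u)) ^ d"
          unfolding N_def of_nat_power using L False by (intro power_mono) auto
        also have "\<dots> = A ^ d * T" by (simp add: \<epsilon>_def T_def power_mult_distrib)
        also have "\<dots> \<le> A * T"
          using A T d power_decreasing[of 1 d A] by (intro mult_right_mono) auto
        finally show ?thesis .
      qed
      have "sqrt (exp (- t / (C * real N)) / \<mu> ^ N) \<le> exp (- u)"
      proof (rule real_le_lsqrt)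
        have "\<mu> ^ N = exp (- (real N * \<kappa>))"
          using \<mu> by (simp add: \<kappa>_def exp_of_nat_mult)
        then have "exp (- t / (C * real N)) / \<mu> ^ N = exp (- t / (C * real N) + real N * \<kappa>)"
          by (simp only: exp_diff[symmetric] diff_minus_eq_add)
        also have "\<dots> \<le> exp (- 2 * u)"
        proof (subst exp_le_cancel_iff)
          have "t / (C * (A * T)) \<le> t / (C * real N)"
            using t C NA N0 T A by (intro divide_left_mono mult_left_mono mult_pos_pos) auto
          moreover have "t / (C * (A * T)) = (1 / (C * A)) * T"
            using T by simp
          ultimately have 1: "2 * (1 + \<kappa>) * T \<le> t / (C * real N)" by (simp only: CA)
          have "A * T \<le> 1 * T" using A T by (intro mult_right_mono) auto
          with NA have "real N \<le> T" by simp
          then have "real N * \<kappa> \<le> T * \<kappa>" using \<kappa> by (rule mult_right_mono)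
          moreover have "0 \<le> T * \<kappa>" using T \<kappa> by simp
          moreover have "2 * (1 + \<kappa>) * T = 2 * T + 2 * (T * \<kappa>)" by (simp add: algebra_simps)
          ultimately show "- t / (C * real N) + real N * \<kappa> \<le> - 2 * u" using 1 T(2) by simp
        qed
        also have "\<dots> = (exp (- u))\<^sup>2" by (simp add: power2_eq_square flip: exp_add)
        finally show "exp (- t / (C * real N)) / \<mu> ^ N \<le> (exp (- u))\<^sup>2" .
      qed (use \<mu> in auto)
      also have "exp (- u) \<le> exp (- lam * u)" using lam u by (simp add: mult_right_mono[of lam 1 u, simplified])
      finally have 1: "sqrt (exp (- t / (C * real N)) / \<mu> ^ N) \<le> exp (- lam * u)" .
      have 2: "t * p ^ Suc L \<le> K0 * exp (- lam * u)"
      proof -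
        define v where "v = \<epsilon> * k / 2 * u"
        have v: "0 < v" using \<epsilon> k u by (simp add: v_def)
        have n0: "0 < n" using d by (simp add: n_def)
        have "(v / real n) ^ n \<le> (1 + v / real n) ^ n" using v by (intro power_mono) auto
        also have "\<dots> \<le> exp v"
          using v n0 by (intro exp_ge_one_plus_x_over_n_power_n) auto
        finally have "K0 * (v / real n) ^ n \<le> K0 * exp v" using K0 by (rule mult_left_mono)
        moreover have "K0 * (v / real n) ^ n = t"
        proof -
          have "real n / (\<epsilon> * k / 2) * (v / real n) = u"
            using \<epsilon> k n0 by (simp add: v_def)
          then show ?thesis unfolding K0_def power_mult_distrib[symmetric] by (simp only: un)
        qed
        ultimately have "t \<le> K0 * exp v" by simp
        moreover have "p ^ Suc L \<le> exp (- 2 * v)"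
        proof -
          have "p ^ Suc L = exp (- k) ^ Suc L" using p by (simp add: k_def)
          also have "\<dots> = exp (- (k * real (Suc L)))" by (simp only: exp_of_nat_mult[symmetric] mult_minus_left mult_minus_right mult.commute)
          also have "\<dots> \<le> exp (- 2 * v)"
            using mult_left_mono[OF L(3), of k] k by (simp add: v_def mult_ac)
          finally show ?thesis .
        qed
        ultimately have "t * p ^ Suc L \<le> (K0 * exp v) * exp (- 2 * v)"
          using p t K0 by (intro mult_mono) auto
        also have "\<dots> = K0 * exp (- v)" by (simp add: mult.assoc flip: exp_add)
        also have "\<dots> \<le> K0 * exp (- lam * u)"
          using mult_right_mono[OF lam(3), of u] u K0 by (intro mult_left_mono) (auto simp: v_def)
        finally show ?thesis .
      qed
      have 3: "exp (- m * real L) \<le> exp (- lam * u)"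
      proof -
        have "lam * u \<le> m * (\<epsilon> * u / 2)" using mult_right_mono[OF lam(4), of u] u by simp
        also have "\<dots> \<le> m * real L" using m L2 by (intro mult_left_mono) auto
        finally show ?thesis by simp
      qed
      have "sqrt (exp (- t / (C * real N)) / \<mu> ^ N) + t * p ^ Suc L + exp (- m * real L) \<le>
          (2 + K0) * exp (- lam * u)"
        using add_mono[OF add_mono[OF 1 2] 3] by (simp add: distrib_right)
      also have "\<dots> \<le> K * exp (- lam * u)" by (intro mult_right_mono) (auto simp: K_def)
      finally show "1 \<le> K * exp (- lam * u) \<or> (\<exists>L\<ge>1.
        sqrt (exp (- t / (C * real ((2 * L + 1) ^ d))) / \<mu> ^ ((2 * L + 1) ^ d)) +
        t * p ^ Suc L + exp (- m * real L) \<le> K * exp (- lam * u))"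
        using L(1) unfolding N_def by blast
    qed
  qed
qed

theorem corollary4p4:
  fixes p q m :: real
  assumes "0 < p" "p < 1" "p = 1 - q" "0 < m"
  shows "\<exists>lam>0. \<forall>\<nu> :: 'd::finite config measure.
    prob_space \<nu> \<and> sets \<nu> = sets borel \<and> exp_decaying_filled_boxes m \<nu> \<longrightarrow>
      (\<exists>C>0. \<forall>(M :: 'w measure) X. east_like_process q \<nu> M X \<longrightarrow>
        (\<forall>t>0. (SUP x. \<bar>prob_space.expectation M (\<lambda>w. of_bool (X t w x)) - p\<bar>)
                 \<le> C * exp (- lam * t powr (1 / (2 * real CARD('d))))))"
proof -
  interpret bernoulli_spins p using assms by unfold_locales auto
  have q: "q = 1 - p" using assms by simp
  define b where "b C t L m = sqrt (exp (- t / (C * real ((2 * L + 1) ^ CARD('d)))) / (min p (1 - p)) ^ ((2 * L + 1) ^ CARD('d))) +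
      t * p ^ Suc L + exp (- m * real L)" for C t m and L :: nat
  obtain C where C: "C \<ge> 1" and bound: "\<forall>(\<nu> :: 'd config measure) (M :: 'w measure) X m t x L.
    prob_space \<nu> \<longrightarrow> sets \<nu> = sets borel \<longrightarrow> exp_decaying_filled_boxes m \<nu> \<longrightarrow>
    east_like_process (1 - p) \<nu> M X \<longrightarrow> 0 < t \<longrightarrow> 1 \<le> L \<longrightarrow>
    \<bar>prob_space.expectation M (\<lambda>w. of_bool (X t w x)) - p\<bar> \<le> 1 \<and>
    \<bar>prob_space.expectation M (\<lambda>w. of_bool (X t w x)) - p\<bar> \<le> b C t L m"
    using process_bound unfolding b_def by (elim exE conjE)
  have "\<exists>lam>0. \<exists>K>0. \<forall>t>0. 1 \<le> K * exp (- lam * t powr (1 / (2 * real CARD('d)))) \<or>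
    (\<exists>L\<ge>1. b C t L m \<le> K * exp (- lam * t powr (1 / (2 * real CARD('d)))))"
    unfolding b_def using assms(1,2,4) C by (intro stretched_exponential_bound) auto
  then obtain lam K where lam: "0 < lam" and K: "0 < K" and decay: "\<forall>t>0.
    1 \<le> K * exp (- lam * t powr (1 / (2 * real CARD('d)))) \<or>
    (\<exists>L\<ge>1. b C t L m \<le> K * exp (- lam * t powr (1 / (2 * real CARD('d)))))"
    by (elim exE conjE)
  show ?thesis
  proof (rule exI[of _ lam], intro conjI[OF lam] allI impI, elim conjE,
      rule exI[of _ K], intro conjI[OF K] allI impI)
    fix \<nu> :: "'d config measure" and M :: "'w measure" and X and t :: real
    assume \<nu>: "prob_space \<nu>" "sets \<nu> = sets borel" "exp_decaying_filled_boxes m \<nu>"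
      and X: "east_like_process q \<nu> M X" and t: "0 < t"
    note bd = bound[rule_format, OF \<nu> X[unfolded q] t]
    show "(SUP x. \<bar>prob_space.expectation M (\<lambda>w. of_bool (X t w x)) - p\<bar>)
        \<le> K * exp (- lam * t powr (1 / (2 * real CARD('d))))"
    \<comment> \<open>The constants do not depend on the site, so a bound for each \<open>x\<close>
      suffices; short times use the trivial bound 1.\<close>
    proof (rule cSUP_least)
      fix x
      show "\<bar>prob_space.expectation M (\<lambda>w. of_bool (X t w x)) - p\<bar> \<le>
          K * exp (- lam * t powr (1 / (2 * real CARD('d))))"
        using decay[rule_format, OF t]
      proof (elim disjE exE conjE)
        assume "1 \<le> K * exp (- lam * t powr (1 / (2 * real CARD('d))))"
        with conjunct1[OF bd[of 1 x]] show ?thesis by linarith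
      next
        fix L :: nat
        assume "1 \<le> L" "b C t L m \<le> K * exp (- lam * t powr (1 / (2 * real CARD('d))))"
        with conjunct2[OF bd[of L x]] show ?thesis by linarith
      qed
    qed simp
  qed
qed

end
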